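(* Let $n\ge 2$, let $1<s\le\infty$, and let $\Omega\in L^s(S^{n-1})$ be homogeneous of degree zero on $\mathbb R^n$. Let $0<\alpha<n$, $1\le s'<p<n/\alpha$, $1/q=1/p-\alpha/n$, $0<\kappa<p/q$, and let $w$ be a weight on $\mathbb R^n$ with $w^{s'}\in A(p/s',q/s')$. Then the fractional integral operator $$T_{\Omega,\alpha}f(x)=\int_{\mathbb R^n}\frac{\Omega(y')}{|y|^{n-\alpha}}f(x-y)\,dy$$ is bounded from $L^{p,\kappa}(w^p,w^q)$ to $L^{q,\kappa q/p}(w^q)$; that is, there is a constant $C>0$ such that $\|T_{\Omega,\alpha}f\|_{L^{q,\kappa q/p}(w^q)}\le C\|f\|_{L^{p,\kappa}(w^p,w^q)}$ for all $f\in L^{p,\kappa}(w^p,w^q)$.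
   Context: Notation: $S^{n-1}$ is the unit sphere of $\mathbb R^n$ with normalized Lebesgue measure $d\sigma$; $y'=y/|y|$ for $y\ne 0$; $\Omega$ homogeneous of degree zero means $\Omega(\lambda x)=\Omega(x)$ for all $\lambda>0$, $x\neq 0$, and $\Omega\in L^s(S^{n-1})$ refers to its restriction to $S^{n-1}$. Here $s'=s/(s-1)$ if $1<s<\infty$ and $s'=1$ if $s=\infty$. A weight is a nonnegative locally integrable function on $\mathbb R^n$. For a weight $v$ and a ball $B$, $v(B)=\int_B v(x)\,dx$, and $|B|$ is the Lebesgue measure of $B$. Class $A(p,q)$: for $1<p<q<\infty$, a weight $w$ belongs to $A(p,q)$ if there is $C>0$ such that for every ball $B\subseteq\mathbb R^n$, $$\left(\frac1{|B|}\int_B w(x)^q\,dx\right)^{1/q}\left(\frac1{|B|}\int_B w(x)^{-p'}\,dx\right)^{1/p'}\le C,$$ where $p'=p/(p-1)$. Weighted Morrey spaces: for $1\le p<\infty$, $0<\kappa<1$ and a weight $w$, $L^{p,\kappa}(w)$ is the set of $f\in L^p_{loc}(w)$ with $$\|f\|_{L^{p,\kappa}(w)}=\sup_B\left(\frac1{w(B)^\kappa}\int_B|f(x)|^p w(x)\,dx\right)^{1/p}<\infty.$$ For two weights $u,v$, $L^{p,\kappa}(u,v)$ is the set of $f\in L^p_{loc}(u)$ with $$\|f\|_{L^{p,\kappa}(u,v)}=\sup_B\left(\frac1{v(B)^\kappa}\int_B|f(x)|^p u(x)\,dx\right)^{1/p}<\infty.$$ Both suprema are over all balls $B\subseteq\mathbb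 R^n$. *)

theory Defs
  imports "HOL-Probability.Essential_Supremum"
begin

text \<open>Powers of extended nonnegative numbers, meant for exponents \<open>a > 0\<close> only (so \<open>\<infinity>\<close> is
  sent to \<open>\<infinity>\<close> and \<open>0\<close> to \<open>0\<close>).\<close>

definition ennpowr :: "ennreal \<Rightarrow> real \<Rightarrow> ennreal" where
  "ennpowr x a = (if x = \<infinity> then \<infinity> else ennreal (enn2real x powr a))"

definition dual_exponent :: "ereal \<Rightarrow> real" where
  "dual_exponent s = (if s = \<infinity> then 1 else real_of_ereal s / (real_of_ereal s - 1))"

text \<open>Normalized Lebesgue measure on the unit sphere, in polar coordinates: the measure of a Borel
  set \<open>A\<close> of unit vectors is the proportion of the unit ball occupied by the cone
  \<open>{y. y / \<bar>y\<bar> \<in> A}\<close>. Recall that \<open>sgn y = y / \<bar>y\<bar>\<close>, with \<open>sgn 0 = 0\<close>. The measure is completed,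
  so that functions on the sphere need only be Lebesgue measurable.\<close>

definition sphere_measure :: "(real ^ 'n) measure" where
  "sphere_measure =
     completion (restrict_space (distr (uniform_measure lborel (ball 0 1)) borel sgn) (sphere 0 1))"

definition homogeneous_degree_zero :: "(real ^ 'n \<Rightarrow> complex) \<Rightarrow> bool" where
  "homogeneous_degree_zero \<Omega> \<longleftrightarrow> (\<forall>t>0. \<forall>x. x \<noteq> 0 \<longrightarrow> \<Omega> (t *\<^sub>R x) = \<Omega> x)"

text \<open>Only the values of \<open>\<Omega>\<close> on the unit sphere matter, as this is the space of
  \<^const>\<open>sphere_measure\<close>.\<close>

definition Ls_sphere :: "ereal \<Rightarrow> (real ^ 'n \<Rightarrow> complex) set" where
  "Ls_sphere s = {\<Omega>. \<Omega> \<in> borel_measurable sphere_measure \<and>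
     (if s = \<infinity> then esssup sphere_measure (\<lambda>x. ennreal (cmod (\<Omega> x))) < \<infinity>
      else (\<integral>\<^sup>+x. ennreal (cmod (\<Omega> x) powr real_of_ereal s) \<partial>sphere_measure) < \<infinity>)}"

definition weight :: "(real ^ 'n \<Rightarrow> real) \<Rightarrow> bool" where
  "weight w \<longleftrightarrow> w \<in> borel_measurable lebesgue \<and> (\<forall>x. 0 \<le> w x) \<and>
     (\<forall>K. compact K \<longrightarrow> w absolutely_integrable_on K)"

definition balls :: "(real ^ 'n) set set" where
  "balls = {ball c r | c r. 0 < r}"

definition weighted_volume :: "(real ^ 'n \<Rightarrow> real) \<Rightarrow> (real ^ 'n) set \<Rightarrow> ennreal" where
  "weighted_volume v B = (\<integral>\<^sup>+x\<in>B. ennreal (v x) \<partial>lebesgue)"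

definition ball_average :: "(real ^ 'n) set \<Rightarrow> (real ^ 'n \<Rightarrow> ennreal) \<Rightarrow> ennreal" where
  "ball_average B g = (\<integral>\<^sup>+x\<in>B. g x \<partial>lebesgue) / emeasure lebesgue B"

text \<open>The negative power \<open>w(x) ^ (-p')\<close> is formed in the extended nonnegative reals, so that it is
  \<open>\<infinity>\<close> where \<open>w\<close> vanishes (whereas \<open>0 powr (-p') = 0\<close> in the reals).\<close>

definition A_class :: "real \<Rightarrow> real \<Rightarrow> (real ^ 'n \<Rightarrow> real) set" where
  "A_class p q = {w. weight w \<and> (\<exists>C::real. C > 0 \<and> (\<forall>B\<in>balls.
     ennpowr (ball_average B (\<lambda>x. ennreal (w x powr q))) (1 / q) *
     ennpowr (ball_average B (\<lambda>x. inverse (ennreal (w x powr (p / (p - 1)))))) (1 / (p / (p - 1)))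
       \<le> ennreal C))}"

definition Lp_loc :: "real \<Rightarrow> (real ^ 'n \<Rightarrow> real) \<Rightarrow> (real ^ 'n \<Rightarrow> complex) set" where
  "Lp_loc p u = {f. f \<in> borel_measurable lebesgue \<and>
     (\<forall>K. compact K \<longrightarrow> (\<integral>\<^sup>+x\<in>K. ennreal (cmod (f x) powr p * u x) \<partial>lebesgue) < \<infinity>)}"

definition morrey_norm2 ::
    "real \<Rightarrow> real \<Rightarrow> (real ^ 'n \<Rightarrow> real) \<Rightarrow> (real ^ 'n \<Rightarrow> real) \<Rightarrow> (real ^ 'n \<Rightarrow> complex) \<Rightarrow> ennreal" where
  "morrey_norm2 p \<kappa> u v f = (SUP B\<in>balls.
     ennpowr ((\<integral>\<^sup>+x\<in>B. ennreal (cmod (f x) powr p * u x) \<partial>lebesgue)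
                / ennpowr (weighted_volume v B) \<kappa>) (1 / p))"

definition morrey_space2 ::
    "real \<Rightarrow> real \<Rightarrow> (real ^ 'n \<Rightarrow> real) \<Rightarrow> (real ^ 'n \<Rightarrow> real) \<Rightarrow> (real ^ 'n \<Rightarrow> complex) set" where
  "morrey_space2 p \<kappa> u v = {f \<in> Lp_loc p u. morrey_norm2 p \<kappa> u v f < \<infinity>}"

definition morrey_norm ::
    "real \<Rightarrow> real \<Rightarrow> (real ^ 'n \<Rightarrow> real) \<Rightarrow> (real ^ 'n \<Rightarrow> complex) \<Rightarrow> ennreal" where
  "morrey_norm p \<kappa> w f = morrey_norm2 p \<kappa> w w f"

definition morrey_space ::
    "real \<Rightarrow> real \<Rightarrow> (real ^ 'n \<Rightarrow> real) \<Rightarrow> (real ^ 'n \<Rightarrow> complex) set" where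
  "morrey_space p \<kappa> w = morrey_space2 p \<kappa> w w"

definition frac_integrand ::
    "(real ^ 'n \<Rightarrow> complex) \<Rightarrow> real \<Rightarrow> (real ^ 'n \<Rightarrow> complex) \<Rightarrow> real ^ 'n \<Rightarrow> real ^ 'n \<Rightarrow> complex" where
  "frac_integrand \<Omega> \<alpha> f x y =
     \<Omega> (sgn y) / complex_of_real (norm y powr (real CARD('n) - \<alpha>)) * f (x - y)"

text \<open>As a Bochner integral this is \<open>0\<close> by convention where the integrand is not integrable;
  absolute convergence has to be asserted separately.\<close>

definition frac_integral ::
    "(real ^ 'n \<Rightarrow> complex) \<Rightarrow> real \<Rightarrow> (real ^ 'n \<Rightarrow> complex) \<Rightarrow> real ^ 'n \<Rightarrow> complex" where
  "frac_integral \<Omega> \<alpha> f x = (\<integral>y. frac_integrand \<Omega> \<alpha> f x y \<partial>lebesgue)"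

text \<open>The target space consists of functions defined almost everywhere with respect to
  \<open>v(x) dx\<close>, so this is the sense in which the operator is defined on \<open>f\<close>.\<close>

definition frac_integral_defined ::
    "(real ^ 'n \<Rightarrow> complex) \<Rightarrow> real \<Rightarrow> (real ^ 'n \<Rightarrow> real) \<Rightarrow> (real ^ 'n \<Rightarrow> complex) \<Rightarrow> bool" where
  "frac_integral_defined \<Omega> \<alpha> v f \<longleftrightarrow>
     (AE x in density lebesgue (\<lambda>x. ennreal (v x)). integrable lebesgue (frac_integrand \<Omega> \<alpha> f x))"

end

theory Submission
  imports Defs
begin

text \<open>
  Write \<open>\<sigma> = s'\<close>, \<open>a = \<sigma>/q\<close>, \<open>b = 1 - \<sigma>/p\<close>, \<open>v = w\<^sup>q\<close> and let \<open>u = w powr (-\<sigma>/b)\<close> be the dual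
  weight, so that \<open>v\<^sup>a u\<^sup>b = 1\<close> and the hypothesis on \<open>w\<close> bounds \<open>v(B)\<^sup>a u(B)\<^sup>b\<close> by a multiple of
  \<open>|B| powr (a + b)\<close>, where \<open>a + b = 1 - \<sigma>\<alpha>/n < 1\<close>. Cutting the kernel into dyadic annuli, Hoelder's
  inequality on each of them bounds \<open>|T f(x)|\<close> by a multiple of the sum over \<open>k\<close> of
  \<open>A\<^sub>k powr (1/\<sigma>)\<close> with \<open>A\<^sub>k = |B| powr -(a + b) \<integral>\<^sub>B |f| powr \<sigma>\<close> and \<open>B\<close> the ball of radius \<open>2\<^sup>k\<close> about \<open>x\<close>.
  Each \<open>A\<^sub>k\<close> is bounded in two ways: by \<open>v(B) powr -a\<close> times the norm of \<open>f w\<close> on \<open>B\<close> (Hoelder), and by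
  \<open>v(B) powr (1 - a - b)\<close> times \<open>H(x)\<close>, where \<open>H\<close> is built from the maximal functions with respect to
  the doubling measures \<open>u dx\<close> and \<open>v dx\<close>. Since \<open>v(B)\<close> grows geometrically in \<open>k\<close> (reverse doubling),
  summing the smaller of the two bounds gives a Hedberg inequality, from which the weighted
  \<open>L\<^sup>p\<close>-\<open>L\<^sup>q\<close> bound follows without a reverse Hoelder inequality. On a ball of radius \<open>r\<close> the
  Morrey estimate uses that bound for the radii at most \<open>r\<close>, which only see \<open>f\<close> on the
  doubled ball, and the first bound alone for the larger radii.
\<close>

subsection \<open>Powers and Hoelder's inequality in the extended nonnegative reals\<close>

text \<open>Weighted bounds for fractional operators usually rest on the openness of the weight
  class, hence on a reverse Hoelder inequality. What replaces it is that the maximal function of a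
  doubling measure is bounded on \<open>L^t\<close> of that same measure for every
  \<open>t > 1\<close>. So \<open>F = |f| powr \<sigma>\<close> is averaged as \<open>F / u\<close>
  against \<open>u dx\<close>, and a power of the outcome, divided by \<open>v\<close>, is averaged
  against \<open>v dx\<close>; the relation between \<open>u\<close> and \<open>v\<close> turns the
  norm left by the outer maximal theorem into the one bounded by the inner theorem.

  The gap \<open>1 - a - b = \<sigma>\<alpha>/n\<close> makes the small radii summable. In the
  Morrey estimate the energy of \<open>f\<close> on a large ball grows like
  \<open>v(B) powr \<kappa>\<close>, so the averages over large radii are of size
  \<open>v(B) powr (\<kappa>(1 - b) - a)\<close>. Since \<open>(1 - b)/a = q/p\<close>, these decay
  precisely when \<open>\<kappa> < p/q\<close>.

  Sums and integrals are taken in the extended nonnegative reals, so absolute convergence of the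
  operator is read off at the end from the finiteness of a majorant.\<close>

lemma ennpowr_ennreal [simp]: "0 \<le> x \<Longrightarrow> ennpowr (ennreal x) a = ennreal (x powr a)"
  by (simp add: ennpowr_def)

lemma ennpowr_top [simp]: "ennpowr top a = top"
  by (simp add: ennpowr_def)

lemma ennpowr_0 [simp]: "ennpowr 0 a = 0"
  by (simp add: ennpowr_def)

lemma ennpowr_one [simp]: "ennpowr 1 a = 1"
  using ennpowr_ennreal[of 1 a] by simp

lemma ennpowr_1 [simp]: "ennpowr x 1 = x"
  by (cases x) auto

lemma ennpowr_mono: "x \<le> y \<Longrightarrow> 0 \<le> a \<Longrightarrow> ennpowr x a \<le> ennpowr y a"
  by (cases x; cases y) (auto simp: top_unique powr_mono2 ennreal_leI)

lemma ennpowr_ennpowr: "ennpowr (ennpowr x a) b = ennpowr x (a * b)"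
  by (cases x) (auto simp: powr_powr)

text \<open>Every power of 0 is 0 and every power of \<open>top\<close> is \<open>top\<close>, even
  for exponent 0 or a negative one, so the power laws become identities on all of
  \<open>ennreal\<close>.\<close>

lemma ennpowr_add: "ennpowr x (a + b) = ennpowr x a * ennpowr x b"
  by (cases x) (auto simp: powr_add ennreal_mult)

lemma ennpowr_less_top [simp]: "ennpowr x a < top \<longleftrightarrow> x < top"
  by (cases x) auto

lemma ennpowr_eq_top [simp]: "ennpowr x a = top \<longleftrightarrow> x = top"
  by (cases x) auto

lemma ennpowr_eq_0 [simp]: "ennpowr x a = 0 \<longleftrightarrow> x = 0"
  by (cases x) auto

lemma ennpowr_mult: "ennpowr (x * y) a = ennpowr x a * ennpowr y a"
proof (cases "x = top \<or> y = top")
  case True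
  then show ?thesis
    by (cases "x = 0 \<or> y = 0") (auto simp: ennreal_mult_eq_top_iff ennreal_top_mult ennreal_mult_top)
next
  case False
  then show ?thesis
    by (cases x; cases y) (auto simp: ennreal_mult[symmetric] powr_mult)
qed

lemma borel_measurable_ennpowr [measurable]:
  assumes [measurable]: "f \<in> borel_measurable M"
  shows "(\<lambda>x. ennpowr (f x) a) \<in> borel_measurable M"
proof -
  have "f -` {top} \<inter> space M \<in> sets M"
    by (rule measurable_sets[OF assms]) simp
  moreover have "f -` {top} \<inter> space M = {x \<in> space M. f x = top}" by auto
  ultimately have "{x \<in> space M. f x = top} \<in> sets M" by simp
  then show ?thesis
    unfolding ennpowr_def infinity_ennreal_def by (intro measurable_If) auto
qed

text \<open>Comes from \<open>x + y \<le> 2 * max x y\<close>; the constant is crude but serves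
  exponents below and above 1 alike.\<close>

lemma ennpowr_add_le:
  assumes "0 < a"
  shows "ennpowr (x + y) a \<le> ennreal (2 powr a) * (ennpowr x a + ennpowr y a)"
proof -
  have "ennpowr (x + y) a \<le> ennpowr (2 * max x y) a"
    using assms by (intro ennpowr_mono) (auto simp: mult_2 add_mono)
  also have "\<dots> = ennreal (2 powr a) * ennpowr (max x y) a"
    using ennpowr_ennreal[of 2 a] by (simp add: ennpowr_mult)
  also have "\<dots> \<le> ennreal (2 powr a) * (ennpowr x a + ennpowr y a)"
    by (intro mult_left_mono) (auto simp: max_def)
  finally show ?thesis .
qed

text \<open>Weighted arithmetic-geometric mean inequality for \<open>x / X\<close> and
  \<open>y / Y\<close>. The normalisers stay free so that they can later be the integrals of the two
  factors.\<close>

lemma Young_ennpowr: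
  assumes "0 < a" "0 < b" "a + b = 1" and X: "0 < X" and Y: "0 < Y"
  shows "ennpowr x a * ennpowr y b
    \<le> ennreal (X powr a * Y powr b) * (ennreal (a / X) * x + ennreal (b / Y) * y)"
proof (cases "x = top \<or> y = top")
  case True
  then show ?thesis using assms
    by (auto simp: ennreal_mult_top ennreal_top_mult ennreal_mult_eq_top_iff)
next
  case False
  then obtain x' y' where [simp]: "x = ennreal x'" "0 \<le> x'" "y = ennreal y'" "0 \<le> y'"
    by (metis ennreal_cases)
  have "x' powr a * y' powr b \<le> X powr a * Y powr b * (a / X * x' + b / Y * y')"
  proof (cases "x' = 0 \<or> y' = 0")
    case True
    then show ?thesis using assms by auto
  next
    case False
    have "(x' / X) powr a * (y' / Y) powr b \<le> a * (x' / X) + b * (y' / Y)"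
      using assms False \<open>0 \<le> x'\<close> \<open>0 \<le> y'\<close>
      by (intro Youngs_inequality_0) (auto simp: less_le)
    then show ?thesis
      using assms False by (simp add: powr_divide divide_simps) (simp add: algebra_simps)
  qed
  then show ?thesis
    using assms by (simp add: ennreal_mult[symmetric] ennreal_plus[symmetric] ennreal_leI
        del: ennreal_plus)
qed

text \<open>For positive finite integrals, Young's inequality normalised by them integrates to the
  factor \<open>a + b = 1\<close>. A zero integral makes the integrand vanish almost everywhere, in
  accordance with \<open>0 * top = 0\<close> on the right; an infinite integral beside a nonzero one
  makes the right side infinite.\<close>

lemma nn_integral_Holder:
  assumes [measurable]: "f \<in> borel_measurable M" "g \<in> borel_measurable M"
    and ab: "0 < a" "0 < b" "a + b = 1"
  shows "(\<integral>\<^sup>+x. ennpowr (f x) a * ennpowr (g x) b \<partial>M)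
    \<le> ennpowr (\<integral>\<^sup>+x. f x \<partial>M) a * ennpowr (\<integral>\<^sup>+x. g x \<partial>M) b"
proof -
  define X Y where "X = (\<integral>\<^sup>+x. f x \<partial>M)" and "Y = (\<integral>\<^sup>+x. g x \<partial>M)"
  consider "X = 0 \<or> Y = 0" | "X \<noteq> 0" "Y \<noteq> 0" "X = top \<or> Y = top" | "X \<noteq> 0" "Y \<noteq> 0" "X \<noteq> top" "Y \<noteq> top"
    by auto
  then show ?thesis
  proof cases
    case 1
    have "AE x in M. ennpowr (f x) a * ennpowr (g x) b = 0"
      using 1 unfolding X_def Y_def
      by (auto simp: nn_integral_0_iff_AE elim: eventually_mono)
    then show ?thesis by (subst nn_integral_cong_AE[where v = "\<lambda>_. 0"]) auto
  next
    case 2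
    then show ?thesis
      by (auto simp flip: X_def Y_def simp: ennreal_top_mult ennreal_mult_top)
  next
    case 3
    then obtain X' Y' where XY: "X = ennreal X'" "0 < X'" "Y = ennreal Y'" "0 < Y'"
      by (cases X; cases Y) (auto simp: less_le)
    have "(\<integral>\<^sup>+x. ennpowr (f x) a * ennpowr (g x) b \<partial>M)
      \<le> (\<integral>\<^sup>+x. ennreal (X' powr a * Y' powr b) * (ennreal (a / X') * f x + ennreal (b / Y') * g x) \<partial>M)"
      using ab XY by (intro nn_integral_mono Young_ennpowr) auto
    also have "\<dots> = ennreal (X' powr a * Y' powr b) * (ennreal (a / X') * X + ennreal (b / Y') * Y)"
      unfolding X_def Y_def by (simp add: nn_integral_cmult nn_integral_add)
    also have "ennreal (a / X') * X + ennreal (b / Y') * Y = 1"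
      using XY ab by (simp add: ennreal_mult[symmetric] ennreal_plus[symmetric] del: ennreal_plus)
    finally show ?thesis
      unfolding X_def[symmetric] Y_def[symmetric] using XY ab by (simp add: ennreal_mult)
  qed
qed

subsection \<open>Sums over geometrically growing sequences\<close>

text \<open>Read downwards from the last index below the threshold, the terms are dominated by a
  geometric series of ratio \<open>1 / \<rho>\<close>. Sums over \<open>int\<close> are written as
  integrals for counting measure, so that exchanging them with integrals over space is Tonelli's
  theorem.\<close>

lemma geometric_sum_below:
  fixes a :: "int \<Rightarrow> real"
  assumes \<rho>: "1 < \<rho>" and pos: "\<And>k. 0 < a k" and step: "\<And>k. \<rho> * a k \<le> a (k + 1)" and T: "0 \<le> T"
  shows "(\<integral>\<^sup>+k. (if a k \<le> T then ennreal (a k) else 0) \<partial>count_space UNIV) \<le> ennreal (\<rho> / (\<rho> - 1) * T)"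
proof (cases "\<exists>k. a k \<le> T")
  case False
  then have "(\<integral>\<^sup>+k. (if a k \<le> T then ennreal (a k) else 0) \<partial>count_space UNIV) = 0"
    by (simp add: nn_integral_0_iff_AE)
  then show ?thesis by simp
next
  case True
  then obtain k0 where k0: "a k0 \<le> T" by auto
  have growth: "\<rho> ^ j * a k \<le> a (k + int j)" for j k
  proof (induction j)
    case (Suc j)
    have "\<rho> ^ Suc j * a k \<le> \<rho> * a (k + int j)" using Suc \<rho> by (simp add: mult.assoc)
    also have "\<dots> \<le> a (k + int j + 1)" by (rule step)
    finally show ?case by (simp add: add_ac)
  qed auto
  obtain m where m: "T / a k0 < \<rho> ^ m" using real_arch_pow[OF \<rho>] by blast
  have mono: "a k \<le> a l" if "k \<le> l" for k l
  proof -
    have "1 * a k \<le> \<rho> ^ nat (l - k) * a k"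
      using \<rho> pos[of k] by (intro mult_right_mono) auto
    also have "\<dots> \<le> a l" using growth[of "nat (l - k)" k] that by simp
    finally show ?thesis by simp
  qed
  have "T < a (k0 + int m)"
    using m growth[of m k0] pos[of k0] by (simp add: divide_simps)
  then have bdd: "k < k0 + int m" if "a k \<le> T" for k
    using mono[of "k0 + int m" k] that by linarith
  \<comment> \<open>The set of all \<open>k\<close> with \<open>a k \<le> T\<close> is unbounded
    below; cutting it at \<open>k0\<close> makes it finite and keeps its maximum.\<close>
  define K where "K = Max {k. a k \<le> T \<and> k0 \<le> k}"
  have fin: "finite {k. a k \<le> T \<and> k0 \<le> k}"
    by (rule finite_subset[of _ "{k0..k0 + int m}"]) (use bdd in force)+
  have "K \<in> {k. a k \<le> T \<and> k0 \<le> k}"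
    unfolding K_def using fin k0 by (intro Max_in) auto
  then have K: "a K \<le> T" "k0 \<le> K" by auto
  have le_K: "k \<le> K" if "a k \<le> T" for k
  proof (cases "k0 \<le> k")
    case True
    then show ?thesis unfolding K_def using fin that by (intro Max_ge) auto
  next
    case False
    then show ?thesis using K by linarith
  qed
  have bij: "bij_betw (\<lambda>j. K - int j) UNIV {..K}"
    by (rule bij_betwI[where g = "\<lambda>k. nat (K - k)"]) auto
  have "(\<integral>\<^sup>+k. (if a k \<le> T then ennreal (a k) else 0) \<partial>count_space UNIV)
    \<le> (\<integral>\<^sup>+k. ennreal (a k) * indicator {..K} k \<partial>count_space UNIV)"
    using le_K by (intro nn_integral_mono) (auto simp: indicator_def)
  also have "\<dots> = (\<integral>\<^sup>+k. ennreal (a k) \<partial>count_space {..K})"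
    by (simp add: nn_integral_count_space_indicator)
  also have "\<dots> = (\<integral>\<^sup>+j. ennreal (a (K - int j)) \<partial>count_space UNIV)"
    by (rule nn_integral_bij_count_space[OF bij, symmetric])
  also have "\<dots> \<le> (\<integral>\<^sup>+j. ennreal (T * (1 / \<rho>) ^ j) \<partial>count_space UNIV)"
  proof (intro nn_integral_mono ennreal_leI)
    fix j :: nat
    have "\<rho> ^ j * a (K - int j) \<le> T" using growth[of j "K - int j"] K by simp
    then show "a (K - int j) \<le> T * (1 / \<rho>) ^ j"
      using \<rho> by (simp add: power_one_over field_simps)
  qed
  also have "\<dots> = (\<Sum>j. ennreal (T * (1 / \<rho>) ^ j))"
    by (rule nn_integral_count_space_nat)
  also have "\<dots> = ennreal (\<Sum>j. T * (1 / \<rho>) ^ j)"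
    using \<rho> T by (intro suminf_ennreal2 summable_mult summable_geometric) auto
  also have "(\<Sum>j. T * (1 / \<rho>) ^ j) = \<rho> / (\<rho> - 1) * T"
    using \<rho> by (subst suminf_mult) (auto simp: suminf_geometric divide_simps intro!: summable_geometric)
  finally show ?thesis .
qed

lemma geometric_sum_powr_below:
  fixes t :: "int \<Rightarrow> real"
  assumes \<rho>: "1 < \<rho>" and pos: "\<And>k. 0 < t k" and step: "\<And>k. \<rho> * t k \<le> t (k + 1)"
    and T: "0 \<le> T" and \<theta>: "0 < \<theta>"
  shows "(\<integral>\<^sup>+k. (if t k \<le> T then ennreal (t k powr \<theta>) else 0) \<partial>count_space UNIV)
    \<le> ennreal (\<rho> powr \<theta> / (\<rho> powr \<theta> - 1) * T powr \<theta>)"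
proof -
  have iff: "t k \<le> T \<longleftrightarrow> t k powr \<theta> \<le> T powr \<theta>" for k
    using \<theta> T pos[of k] powr_less_mono2[of \<theta> T "t k"] powr_mono2[of \<theta> "t k" T] by force
  have "\<rho> powr \<theta> * t k powr \<theta> \<le> t (k + 1) powr \<theta>" for k
    using powr_mono2[OF _ _ step[of k], of \<theta>] \<theta> \<rho> pos[of k] by (simp add: powr_mult)
  then show ?thesis
    unfolding iff using \<theta> \<rho> pos
    by (intro geometric_sum_below) (auto simp: less_imp_neq[OF pos, symmetric])
qed

text \<open>The reflected reciprocals \<open>1 / t (- k)\<close> again grow by the factor
  \<open>\<rho>\<close>, which reduces the sum to the one below a threshold.\<close>

lemma geometric_sum_powr_above:
  fixes t :: "int \<Rightarrow> real"
  assumes \<rho>: "1 < \<rho>" and pos: "\<And>k. 0 < t k" and step: "\<And>k. \<rho> * t k \<le> t (k + 1)"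
    and T: "0 < T" and \<theta>: "0 < \<theta>"
  shows "(\<integral>\<^sup>+k. (if T \<le> t k then ennreal (t k powr - \<theta>) else 0) \<partial>count_space UNIV)
    \<le> ennreal (\<rho> powr \<theta> / (\<rho> powr \<theta> - 1) * T powr - \<theta>)"
proof -
  have bij: "bij_betw (\<lambda>k::int. - k) UNIV UNIV"
    by (rule bij_betwI[where g = uminus]) auto
  have iff: "T \<le> t k \<longleftrightarrow> 1 / t k \<le> 1 / T" for k
    using T pos[of k] by (simp add: field_simps)
  have "(\<integral>\<^sup>+k. (if T \<le> t k then ennreal (t k powr - \<theta>) else 0) \<partial>count_space UNIV)
    = (\<integral>\<^sup>+k. (if 1 / t k \<le> 1 / T then ennreal ((1 / t k) powr \<theta>) else 0) \<partial>count_space UNIV)"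
    unfolding iff using pos by (intro nn_integral_cong) (auto simp: powr_minus powr_divide less_imp_le field_simps)
  also have "\<dots> = (\<integral>\<^sup>+k. (if 1 / t (-k) \<le> 1 / T then ennreal ((1 / t (-k)) powr \<theta>) else 0) \<partial>count_space UNIV)"
    by (rule nn_integral_bij_count_space[OF bij, symmetric])
  also have "\<dots> \<le> ennreal (\<rho> powr \<theta> / (\<rho> powr \<theta> - 1) * (1 / T) powr \<theta>)"
  proof (rule geometric_sum_powr_below)
    fix k :: int
    have inv: "\<rho> * (1 / x) \<le> 1 / y" if "\<rho> * y \<le> x" "0 < x" "0 < y" for x y :: real
      using that by (simp add: field_simps)
    show "\<rho> * (1 / t (- k)) \<le> 1 / t (- (k + 1))"
      using step[of "- (k + 1)"] by (intro inv pos) simp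
  qed (use \<rho> pos T \<theta> in auto)
  also have "(1 / T) powr \<theta> = T powr - \<theta>"
    using T by (simp add: powr_minus powr_divide field_simps)
  finally show ?thesis .
qed

text \<open>Hedberg's optimisation in abstract form: one bound increases with \<open>t k\<close>,
  the other decreases, and the sum is split where they agree, each half being comparable to its
  value at the split. The constant is chosen before \<open>t\<close>, which will later depend on the
  point \<open>x\<close>.\<close>

lemma two_sided_geometric_sum:
  assumes \<rho>: "1 < \<rho>" and a: "0 < a" and e: "0 < e" and \<theta>: "0 < \<theta>" and c: "0 < c"
  shows "\<exists>K>0. \<forall>t :: int \<Rightarrow> real. \<forall>X :: int \<Rightarrow> ennreal. \<forall>H N.
    (\<forall>k. 0 < t k \<and> \<rho> * t k \<le> t (k + 1)) \<longrightarrow> N < top \<longrightarrow>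
    (\<forall>k. X k \<le> ennreal (c * t k powr e) * H \<and> X k \<le> ennreal (c * t k powr - a) * N) \<longrightarrow>
    (\<integral>\<^sup>+k. ennpowr (X k) \<theta> \<partial>count_space UNIV)
      \<le> ennreal K * ennpowr (ennpowr H (a / (a + e)) * ennpowr N (e / (a + e))) \<theta>"
proof (intro exI conjI allI impI)
  define K1 where "K1 = \<rho> powr (e * \<theta>) / (\<rho> powr (e * \<theta>) - 1)"
  define K2 where "K2 = \<rho> powr (a * \<theta>) / (\<rho> powr (a * \<theta>) - 1)"
  have K12: "0 < K1" "0 < K2" unfolding K1_def K2_def using \<rho> a e \<theta> by simp_all
  show "0 < c powr \<theta> * (K1 + K2)" using K12 c by simp
  fix t :: "int \<Rightarrow> real" and X :: "int \<Rightarrow> ennreal" and H N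
  assume t: "\<forall>k. 0 < t k \<and> \<rho> * t k \<le> t (k + 1)" and N: "N < top"
    and X: "\<forall>k. X k \<le> ennreal (c * t k powr e) * H \<and> X k \<le> ennreal (c * t k powr - a) * N"
  show "(\<integral>\<^sup>+k. ennpowr (X k) \<theta> \<partial>count_space UNIV)
    \<le> ennreal (c powr \<theta> * (K1 + K2)) * ennpowr (ennpowr H (a / (a + e)) * ennpowr N (e / (a + e))) \<theta>"
  proof (cases "H = 0 \<or> N = 0")
    case True
    then have "X k = 0" for k using X by (metis le_zero_eq mult_zero_right)
    then show ?thesis by simp
  next
    case False
    show ?thesis
    proof (cases "H = top")
      case True
      then show ?thesis using False K12 c by (simp add: ennreal_top_mult ennreal_mult_top ennreal_mult_eq_top_iff)
    next
      case top: False
      obtain h n where hn: "H = ennreal h" "N = ennreal n" "0 < h" "0 < n"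
        using False top N by (cases H; cases N) (auto simp: less_le)
      \<comment> \<open>The solution of \<open>h * T powr e = n * T powr - a\<close>. The common
        value is \<open>h powr (a / (a + e)) * n powr (e / (a + e))\<close>, and \<open>Z\<close> is
        its power \<open>\<theta>\<close>.\<close>
      define T where "T = (n / h) powr (1 / (a + e))"
      have T: "0 < T" using hn by (simp add: T_def)
      define Z where "Z = (h powr (a / (a + e)) * n powr (e / (a + e))) powr \<theta>"
      have *: "1 - e / (a + e) = a / (a + e)" "1 - a / (a + e) = e / (a + e)" using a e by (auto simp: field_simps)
      have "h * T powr e = h powr (1 - e / (a + e)) * n powr (e / (a + e))"
        using hn by (simp add: T_def powr_powr powr_divide powr_diff)
      then have 1: "h powr \<theta> * T powr (e * \<theta>) = Z"
        using hn T powr_mult[of h "T powr e" \<theta>] by (simp add: Z_def * powr_powr)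
      have "n * T powr - a = h powr (a / (a + e)) * n powr (1 - a / (a + e))"
        using hn by (simp add: T_def powr_powr powr_divide powr_diff powr_minus field_simps)
      then have 2: "n powr \<theta> * T powr - (a * \<theta>) = Z"
        using hn T powr_mult[of n "T powr - a" \<theta>] by (simp add: Z_def * powr_powr)
      have "(\<integral>\<^sup>+k. ennpowr (X k) \<theta> \<partial>count_space UNIV)
        \<le> (\<integral>\<^sup>+k. ennreal (c powr \<theta> * h powr \<theta>) * (if t k \<le> T then ennreal (t k powr (e * \<theta>)) else 0)
          + ennreal (c powr \<theta> * n powr \<theta>) * (if T \<le> t k then ennreal (t k powr - (a * \<theta>)) else 0) \<partial>count_space UNIV)"
      proof (rule nn_integral_mono)
        fix k
        have tk: "0 < t k" using t by blast
        show "ennpowr (X k) \<theta> \<le> ennreal (c powr \<theta> * h powr \<theta>) * (if t k \<le> T then ennreal (t k powr (e * \<theta>)) else 0)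
          + ennreal (c powr \<theta> * n powr \<theta>) * (if T \<le> t k then ennreal (t k powr - (a * \<theta>)) else 0)"
        proof (cases "t k \<le> T")
          case True
          have "ennpowr (X k) \<theta> \<le> ennpowr (ennreal (c * t k powr e) * H) \<theta>"
            using X \<theta> by (intro ennpowr_mono) auto
          also have "\<dots> = ennreal (c powr \<theta> * h powr \<theta>) * ennreal (t k powr (e * \<theta>))"
            using c hn tk by (simp add: ennpowr_mult powr_mult powr_powr ennreal_mult mult_ac)
          finally show ?thesis using True by (simp add: add_increasing2)
        next
          case False
          have "ennpowr (X k) \<theta> \<le> ennpowr (ennreal (c * t k powr - a) * N) \<theta>"
            using X \<theta> by (intro ennpowr_mono) auto
          also have "\<dots> = ennreal (c powr \<theta> * n powr \<theta>) * ennreal (t k powr - (a * \<theta>))"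
            using c hn tk by (simp add: ennpowr_mult powr_mult powr_powr ennreal_mult mult_ac)
          finally show ?thesis using False by simp
        qed
      qed
      also have "\<dots> = ennreal (c powr \<theta> * h powr \<theta>) * (\<integral>\<^sup>+k. (if t k \<le> T then ennreal (t k powr (e * \<theta>)) else 0) \<partial>count_space UNIV)
          + ennreal (c powr \<theta> * n powr \<theta>) * (\<integral>\<^sup>+k. (if T \<le> t k then ennreal (t k powr - (a * \<theta>)) else 0) \<partial>count_space UNIV)"
        by (simp add: nn_integral_add nn_integral_cmult)
      also have "\<dots> \<le> ennreal (c powr \<theta> * h powr \<theta>) * ennreal (K1 * T powr (e * \<theta>))
          + ennreal (c powr \<theta> * n powr \<theta>) * ennreal (K2 * T powr - (a * \<theta>))"
        unfolding K1_def K2_def using t T \<rho> a e \<theta>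
        by (intro add_mono mult_left_mono geometric_sum_powr_below geometric_sum_powr_above) auto
      also have "\<dots> = ennreal (c powr \<theta> * (K1 * (h powr \<theta> * T powr (e * \<theta>)) + K2 * (n powr \<theta> * T powr - (a * \<theta>))))"
        using K12 by (simp add: ennreal_mult[symmetric] ennreal_plus[symmetric] algebra_simps del: ennreal_plus)
      also have "\<dots> = ennreal (c powr \<theta> * (K1 + K2)) * ennreal Z"
        using K12 unfolding 1 2 by (simp add: ennreal_mult[symmetric] Z_def algebra_simps)
      also have "ennreal Z = ennpowr (ennpowr H (a / (a + e)) * ennpowr N (e / (a + e))) \<theta>"
        using hn by (simp add: Z_def ennreal_mult[symmetric])
      finally show ?thesis .
    qed
  qed
qed

subsection \<open>Maximal functions of doubling measures\<close>

text \<open>The uncentred version: superlevel sets are unions of balls, hence open, which settles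
  measurability, and the average over a ball is a lower bound at every point of that ball, not only
  at its centre.\<close>

definition maximal_fun :: "'a::euclidean_space measure \<Rightarrow> ('a \<Rightarrow> ennreal) \<Rightarrow> 'a \<Rightarrow> ennreal" where
  "maximal_fun \<mu> h x = (SUP (c, r)\<in>{(c, r). 0 < r \<and> x \<in> ball c r}.
     (\<integral>\<^sup>+y\<in>ball c r. h y \<partial>\<mu>) / emeasure \<mu> (ball c r))"

lemma maximal_fun_ge:
  "0 < r \<Longrightarrow> x \<in> ball c r \<Longrightarrow>
    (\<integral>\<^sup>+y\<in>ball c r. h y \<partial>\<mu>) / emeasure \<mu> (ball c r) \<le> maximal_fun \<mu> h x"
  unfolding maximal_fun_def by (rule SUP_upper2[of "(c, r)"]) auto

lemma less_maximal_fun_iff: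
  "t < maximal_fun \<mu> h x \<longleftrightarrow> (\<exists>c r. 0 < r \<and> x \<in> ball c r \<and>
     t < (\<integral>\<^sup>+y\<in>ball c r. h y \<partial>\<mu>) / emeasure \<mu> (ball c r))"
  unfolding maximal_fun_def less_SUP_iff by auto

lemma maximal_fun_superlevel:
  "{x. t < maximal_fun \<mu> h x} = \<Union> {ball c r | c r. 0 < r \<and>
     t < (\<integral>\<^sup>+y\<in>ball c r. h y \<partial>\<mu>) / emeasure \<mu> (ball c r)}"
  unfolding less_maximal_fun_iff by blast

lemma open_maximal_fun_superlevel: "open {x. t < maximal_fun \<mu> h x}"
  unfolding maximal_fun_superlevel by auto

lemma borel_measurable_maximal_fun [measurable]: "maximal_fun \<mu> h \<in> borel_measurable lebesgue"
proof -
  have "maximal_fun \<mu> h \<in> borel_measurable borel"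
    by (rule borel_measurableI_greater) (simp add: open_maximal_fun_superlevel)
  then show ?thesis by (simp add: measurable_completion)
qed

text \<open>The dilation by 5 and the closed balls are those of Vitali's covering lemma, so that
  \<open>D\<close> itself becomes the weak type constant.\<close>

locale doubling_measure =
  fixes \<mu> :: "'a::euclidean_space measure" and D :: real
  assumes sets_eq [measurable_cong]: "sets \<mu> = sets lebesgue"
    and ball_pos: "0 < r \<Longrightarrow> 0 < emeasure \<mu> (ball x r)"
    and ball_finite: "emeasure \<mu> (ball x r) < top"
    and doubling: "0 < r \<Longrightarrow> emeasure \<mu> (cball x (5 * r)) \<le> ennreal D * emeasure \<mu> (ball x r)"
begin

lemma space_eq [simp]: "space \<mu> = UNIV"
  using sets_eq_imp_space_eq[OF sets_eq] by simp

lemma open_sets [measurable]: "open S \<Longrightarrow> S \<in> sets \<mu>"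
  by (simp add: sets_eq)

lemma closed_sets [measurable]: "closed S \<Longrightarrow> S \<in> sets \<mu>"
  by (simp add: sets_eq)

text \<open>Vitali's lemma, which demands a cap \<open>B\<close> on the radii, selects disjoint
  balls whose fivefold enlargements cover the union. Doubling replaces each enlargement by
  \<open>D\<close> times the ball, where the average of \<open>h\<close> exceeds \<open>t\<close>,
  and by disjointness the integrals over the balls add up to at most the whole integral.\<close>

lemma weak_type_bounded:
  assumes [measurable]: "h \<in> borel_measurable \<mu>" and t: "0 < t"
    and K: "\<And>c r. (c, r) \<in> K \<Longrightarrow> 0 < r \<and> r \<le> B \<and>
      ennreal t < (\<integral>\<^sup>+y\<in>ball c r. h y \<partial>\<mu>) / emeasure \<mu> (ball c r)"
  shows "ennreal t * emeasure \<mu> (\<Union>(c, r)\<in>K. ball c r) \<le> ennreal D * (\<integral>\<^sup>+y. h y \<partial>\<mu>)"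
proof -
  obtain C where C: "countable C" "C \<subseteq> K"
     "pairwise (\<lambda>i j. disjnt (cball (fst i) (snd i)) (cball (fst j) (snd j))) C"
     "(\<Union>(c, r)\<in>K. ball c r) \<subseteq> (\<Union>i\<in>C. cball (fst i) (5 * snd i))"
  proof (rule Vitali_covering_lemma_cballs[where S = "\<Union>(c, r)\<in>K. ball c r" and K = K and a = fst and r = snd and B = B])
    show "(\<Union>(c, r)\<in>K. ball c r) \<subseteq> (\<Union>i\<in>K. cball (fst i) (snd i))"
      using ball_subset_cball by fastforce
    show "0 < snd i \<and> snd i \<le> B" if "i \<in> K" for i
      using K[of "fst i" "snd i"] that by simp
  qed blast
  \<comment> \<open>Disjointness in pointwise form: at most one of the selected balls contains
    \<open>x\<close>.\<close>
  have disj: "(\<integral>\<^sup>+i. indicator (ball (fst i) (snd i)) x \<partial>count_space C) \<le> (1::ennreal)" for x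
  proof (cases "\<exists>i\<in>C. x \<in> ball (fst i) (snd i)")
    case True
    then obtain i where i: "i \<in> C" "x \<in> ball (fst i) (snd i)" by auto
    have "j = i" if "j \<in> C" "x \<in> ball (fst j) (snd j)" for j
    proof (rule ccontr)
      assume "j \<noteq> i"
      then have "disjnt (cball (fst j) (snd j)) (cball (fst i) (snd i))"
        using C(3) i that by (auto simp: pairwise_def)
      then show False using that i by (auto simp: disjnt_iff) (meson less_imp_le)
    qed
    then have "(\<integral>\<^sup>+j. indicator (ball (fst j) (snd j)) x \<partial>count_space C)
      \<le> (\<integral>\<^sup>+j. indicator {i} j \<partial>count_space C :: ennreal)"
      by (intro nn_integral_mono) (auto simp: indicator_def)
    also have "\<dots> = 1" using i by simp
    finally show ?thesis .
  next
    case False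
    then have "(\<integral>\<^sup>+j. indicator (ball (fst j) (snd j)) x \<partial>count_space C) = (0::ennreal)"
      by (subst nn_integral_0_iff_AE) (auto simp: AE_count_space)
    then show ?thesis by simp
  qed
  have one: "ennreal t * emeasure \<mu> (cball (fst i) (5 * snd i))
      \<le> ennreal D * (\<integral>\<^sup>+y\<in>ball (fst i) (snd i). h y \<partial>\<mu>)" if "i \<in> C" for i
  proof -
    have i: "0 < snd i" "ennreal t < (\<integral>\<^sup>+y\<in>ball (fst i) (snd i). h y \<partial>\<mu>) / emeasure \<mu> (ball (fst i) (snd i))"
      using K[of "fst i" "snd i"] that C(2) by auto
    let ?m = "emeasure \<mu> (ball (fst i) (snd i))"
    have m: "?m \<noteq> 0" "?m < top" using ball_pos[OF i(1), of "fst i"] ball_finite by auto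
    have "ennreal t * emeasure \<mu> (cball (fst i) (5 * snd i)) \<le> ennreal t * (ennreal D * ?m)"
      by (intro mult_left_mono doubling i) auto
    also have "\<dots> = ennreal D * (ennreal t * ?m)" by (simp add: ac_simps)
    also have "\<dots> \<le> ennreal D * ((\<integral>\<^sup>+y\<in>ball (fst i) (snd i). h y \<partial>\<mu>) / ?m * ?m)"
      using i by (intro mult_left_mono mult_right_mono) auto
    also have "(\<integral>\<^sup>+y\<in>ball (fst i) (snd i). h y \<partial>\<mu>) / ?m * ?m = (\<integral>\<^sup>+y\<in>ball (fst i) (snd i). h y \<partial>\<mu>)"
      using m by (simp add: ennreal_divide_times ennreal_mult_divide_eq)
    finally show ?thesis .
  qed
  have "emeasure \<mu> (\<Union>(c, r)\<in>K. ball c r) \<le> emeasure \<mu> (\<Union>i\<in>C. cball (fst i) (5 * snd i))"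
    using C(1,4) by (intro emeasure_mono sets.countable_UN') auto
  also have "\<dots> = (\<integral>\<^sup>+x. indicator (\<Union>i\<in>C. cball (fst i) (5 * snd i)) x \<partial>\<mu>)"
    using C(1) by (intro nn_integral_indicator[symmetric] sets.countable_UN') auto
  also have "\<dots> \<le> (\<integral>\<^sup>+x. (\<integral>\<^sup>+i. indicator (cball (fst i) (5 * snd i)) x \<partial>count_space C) \<partial>\<mu>)"
  proof (rule nn_integral_mono)
    fix x
    show "indicator (\<Union>i\<in>C. cball (fst i) (5 * snd i)) x
      \<le> (\<integral>\<^sup>+i. indicator (cball (fst i) (5 * snd i)) x \<partial>count_space C :: ennreal)"
    proof (cases "x \<in> (\<Union>i\<in>C. cball (fst i) (5 * snd i))")
      case True
      then obtain i where i: "i \<in> C" "x \<in> cball (fst i) (5 * snd i)" by auto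
      have "1 = (\<integral>\<^sup>+j. indicator {i} j \<partial>count_space C :: ennreal)" using i by simp
      also have "\<dots> \<le> (\<integral>\<^sup>+i. indicator (cball (fst i) (5 * snd i)) x \<partial>count_space C)"
        using i by (intro nn_integral_mono) (auto simp: indicator_def)
      finally show ?thesis using True by simp
    qed simp
  qed
  also have "\<dots> = (\<integral>\<^sup>+i. emeasure \<mu> (cball (fst i) (5 * snd i)) \<partial>count_space C)"
    using C(1) by (subst nn_integral_count_space_nn_integral) auto
  finally have "ennreal t * emeasure \<mu> (\<Union>(c, r)\<in>K. ball c r)
    \<le> ennreal t * (\<integral>\<^sup>+i. emeasure \<mu> (cball (fst i) (5 * snd i)) \<partial>count_space C)"
    by (intro mult_left_mono) auto
  also have "\<dots> = (\<integral>\<^sup>+i. ennreal t * emeasure \<mu> (cball (fst i) (5 * snd i)) \<partial>count_space C)"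
    by (simp add: nn_integral_cmult)
  also have "\<dots> \<le> (\<integral>\<^sup>+i. ennreal D * (\<integral>\<^sup>+y\<in>ball (fst i) (snd i). h y \<partial>\<mu>) \<partial>count_space C)"
    using one by (intro nn_integral_mono) auto
  also have "\<dots> = ennreal D * (\<integral>\<^sup>+i. (\<integral>\<^sup>+y\<in>ball (fst i) (snd i). h y \<partial>\<mu>) \<partial>count_space C)"
    by (simp add: nn_integral_cmult)
  also have "(\<integral>\<^sup>+i. (\<integral>\<^sup>+y\<in>ball (fst i) (snd i). h y \<partial>\<mu>) \<partial>count_space C)
    = (\<integral>\<^sup>+y. (\<integral>\<^sup>+i. h y * indicator (ball (fst i) (snd i)) y \<partial>count_space C) \<partial>\<mu>)"
    using C(1) by (subst nn_integral_count_space_nn_integral) auto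
  also have "\<dots> \<le> (\<integral>\<^sup>+y. h y * 1 \<partial>\<mu>)"
    using mult_left_mono[OF disj] by (intro nn_integral_mono) (simp add: nn_integral_cmult)
  finally show ?thesis
    by (simp add: mult_left_mono)
qed

text \<open>Continuity from below removes the cap on the radii: the superlevel set is the increasing
  union of the parts covered by balls of radius at most \<open>B\<close>.\<close>

lemma weak_type:
  assumes h [measurable]: "h \<in> borel_measurable \<mu>" and t: "0 < t"
  shows "ennreal t * emeasure \<mu> {x. ennreal t < maximal_fun \<mu> h x} \<le> ennreal D * (\<integral>\<^sup>+y. h y \<partial>\<mu>)"
proof -
  define K where "K B = {(c, r). 0 < r \<and> r \<le> real B \<and>
      ennreal t < (\<integral>\<^sup>+y\<in>ball c r. h y \<partial>\<mu>) / emeasure \<mu> (ball c r)}" for B :: nat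
  define U where "U B = (\<Union>(c, r)\<in>K B. ball c r)" for B
  have U_eq: "{x. ennreal t < maximal_fun \<mu> h x} = (\<Union>B. U B)"
  proof (intro set_eqI iffI)
    fix x assume "x \<in> {x. ennreal t < maximal_fun \<mu> h x}"
    then obtain c r where cr: "0 < r" "x \<in> ball c r"
      "ennreal t < (\<integral>\<^sup>+y\<in>ball c r. h y \<partial>\<mu>) / emeasure \<mu> (ball c r)"
      unfolding less_maximal_fun_iff by auto
    moreover obtain B :: nat where "r \<le> real B" using real_arch_simple by blast
    ultimately have "x \<in> U B" unfolding U_def K_def by blast
    then show "x \<in> (\<Union>B. U B)" by blast
  next
    fix x assume "x \<in> (\<Union>B. U B)"
    then show "x \<in> {x. ennreal t < maximal_fun \<mu> h x}"
      unfolding U_def K_def less_maximal_fun_iff by blast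
  qed
  have "open (U B)" for B unfolding U_def by auto
  then have [measurable]: "U B \<in> sets \<mu>" for B by (rule open_sets)
  have "incseq U" unfolding U_def K_def incseq_def by fastforce
  then have "emeasure \<mu> (\<Union>B. U B) = (SUP B. emeasure \<mu> (U B))"
    by (intro SUP_emeasure_incseq[symmetric]) auto
  then have "ennreal t * emeasure \<mu> {x. ennreal t < maximal_fun \<mu> h x} = (SUP B. ennreal t * emeasure \<mu> (U B))"
    unfolding U_eq by (simp add: SUP_mult_left_ennreal)
  also have "\<dots> \<le> ennreal D * (\<integral>\<^sup>+y. h y \<partial>\<mu>)"
  proof (rule SUP_least)
    fix B show "ennreal t * emeasure \<mu> (U B) \<le> ennreal D * (\<integral>\<^sup>+y. h y \<partial>\<mu>)"
      unfolding U_def by (rule weak_type_bounded[OF h t, of _ "real B"]) (simp add: K_def)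
  qed
  finally show ?thesis .
qed

lemma D_pos: "0 < D"
proof (rule ccontr)
  assume "\<not> 0 < D"
  then have "emeasure \<mu> (cball 0 (5 * 1)) = 0"
    using doubling[of 1 0] by (simp add: ennreal_neg)
  moreover have "emeasure \<mu> (ball 0 1) \<le> emeasure \<mu> (cball 0 (5 * 1))"
    by (intro emeasure_mono closed_sets) auto
  ultimately show False using ball_pos[of 1 0] by simp
qed

lemma maximal_fun_le_add_const:
  assumes [measurable]: "h' \<in> borel_measurable \<mu>" and le: "\<And>y. h y \<le> h' y + c"
  shows "maximal_fun \<mu> h x \<le> maximal_fun \<mu> h' x + c"
  unfolding maximal_fun_def[of _ h]
proof (rule SUP_least, clarify)
  fix a r assume r: "0 < r" "x \<in> ball a r"
  let ?m = "emeasure \<mu> (ball a r)"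
  have m: "?m \<noteq> 0" "?m < top" using ball_pos[OF r(1), of a] ball_finite by auto
  have "(\<integral>\<^sup>+y\<in>ball a r. h y \<partial>\<mu>) \<le> (\<integral>\<^sup>+y. h' y * indicator (ball a r) y + c * indicator (ball a r) y \<partial>\<mu>)"
    using le by (intro nn_integral_mono) (auto simp: indicator_def)
  also have "\<dots> = (\<integral>\<^sup>+y\<in>ball a r. h' y \<partial>\<mu>) + c * ?m"
    by (subst nn_integral_add) (auto simp: nn_integral_cmult_indicator)
  finally have "(\<integral>\<^sup>+y\<in>ball a r. h y \<partial>\<mu>) / ?m \<le> ((\<integral>\<^sup>+y\<in>ball a r. h' y \<partial>\<mu>) + c * ?m) / ?m"
    by (rule divide_right_mono_ennreal)
  also have "\<dots> = (\<integral>\<^sup>+y\<in>ball a r. h' y \<partial>\<mu>) / ?m + c"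
    using m by (simp add: add_divide_distrib_ennreal ennreal_mult_divide_eq)
  also have "\<dots> \<le> maximal_fun \<mu> h' x + c"
    using r by (intro add_right_mono maximal_fun_ge)
  finally show "(\<integral>\<^sup>+y\<in>ball a r. h y \<partial>\<mu>) / ?m \<le> maximal_fun \<mu> h' x + c" .
qed

text \<open>Marcinkiewicz interpolation on the dyadic levels \<open>\<tau> k\<close>. At level
  \<open>2 * \<tau> k\<close> only the part \<open>hk k\<close> of \<open>h\<close> above
  \<open>\<tau> k\<close> counts, since the rest raises the maximal function by at most
  \<open>\<tau> k\<close>. The weak type bound uses up one factor \<open>\<tau> k\<close>; the
  remaining \<open>\<tau> k powr (p - 1)\<close>, summed over \<open>\<tau> k < h x\<close>, is at
  most a multiple of \<open>h x powr (p - 1)\<close>, and this is where \<open>1 < p\<close>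
  enters.\<close>

lemma strong_type:
  assumes p: "1 < p"
  shows "\<exists>C>0. \<forall>h\<in>borel_measurable \<mu>.
    (\<integral>\<^sup>+x. ennpowr (maximal_fun \<mu> h x) p \<partial>\<mu>) \<le> ennreal C * (\<integral>\<^sup>+x. ennpowr (h x) p \<partial>\<mu>)"
proof (intro exI conjI ballI)
  define \<tau> :: "int \<Rightarrow> real" where "\<tau> k = 2 powr real_of_int k" for k
  have \<tau>_pos: "0 < \<tau> k" for k by (simp add: \<tau>_def)
  \<comment> \<open>The constant of \<open>geometric_sum_powr_below\<close> for ratio 2 and exponent
    \<open>p - 1\<close>.\<close>
  define A where "A = 2 powr (p - 1) / (2 powr (p - 1) - 1)"
  have A: "0 < A" unfolding A_def using p by simp
  show "0 < D * 4 powr p * A" using D_pos A by simp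
  fix h :: "'a \<Rightarrow> ennreal" assume h [measurable]: "h \<in> borel_measurable \<mu>"
  define hk where "hk k x = (if ennreal (\<tau> k) < h x then h x else 0)" for k x
  have [measurable]: "hk k \<in> borel_measurable \<mu>" for k unfolding hk_def by measurable
  have layer: "ennpowr m p \<le> (\<integral>\<^sup>+k. (if ennreal (2 * \<tau> k) < m then ennreal ((4 * \<tau> k) powr p) else 0) \<partial>count_space UNIV)"
    for m :: ennreal
  proof (cases m)
    case (real m')
    show ?thesis
    proof (cases "m' = 0")
      case False
      then have m': "0 < m'" using real by simp
      \<comment> \<open>The ceiling gives \<open>2 * \<tau> k < m' \<le> 4 * \<tau> k\<close>, with
        the strict inequality on the side of the superlevel set.\<close>
      define k where "k = \<lceil>log 2 m'\<rceil> - 2"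
      have "log 2 m' \<le> real_of_int k + 2" "real_of_int k + 1 < log 2 m'"
        unfolding k_def by linarith+
      then have k: "m' \<le> 2 powr (real_of_int k + 2)" "2 powr (real_of_int k + 1) < m'"
        using m' by (auto simp: log_le_iff less_log_iff)
      have k: "m' \<le> 4 * \<tau> k" "2 * \<tau> k < m'"
        using k by (auto simp: \<tau>_def powr_add)
      have "ennpowr m p \<le> ennreal ((4 * \<tau> k) powr p)"
        using real k p by (auto intro!: ennreal_leI powr_mono2)
      also have "\<dots> = (\<integral>\<^sup>+j. ennreal ((4 * \<tau> k) powr p) * indicator {k} j \<partial>count_space UNIV)"
        by (simp add: nn_integral_cmult_indicator)
      also have "\<dots> \<le> (\<integral>\<^sup>+k. (if ennreal (2 * \<tau> k) < m then ennreal ((4 * \<tau> k) powr p) else 0) \<partial>count_space UNIV)"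
        using k real \<tau>_pos[of k] by (intro nn_integral_mono) (auto simp: indicator_def ennreal_less_iff)
      finally show ?thesis .
    qed (use real in simp)
  next
    case top
    \<comment> \<open>For \<open>m = top\<close> each \<open>k \<ge> 0\<close> contributes at least
      1, so the sum is infinite.\<close>
    have "top = emeasure (count_space UNIV) {0::int..}"
      by (subst emeasure_count_space_infinite) (auto simp: infinite_Ici)
    also have "\<dots> = (\<integral>\<^sup>+k. indicator {0::int..} k \<partial>count_space UNIV)"
      by simp
    also have "\<dots> \<le> (\<integral>\<^sup>+k. (if ennreal (2 * \<tau> k) < m then ennreal ((4 * \<tau> k) powr p) else 0) \<partial>count_space UNIV)"
    proof (rule nn_integral_mono)
      fix k :: int
      have "1 \<le> (4 * \<tau> k) powr p" if "0 \<le> k"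
      proof -
        have "2 powr 0 \<le> \<tau> k" unfolding \<tau>_def using that by (intro powr_mono) auto
        then show ?thesis using p by (intro ge_one_powr_ge_zero) auto
      qed
      then show "indicator {0..} k \<le> (if ennreal (2 * \<tau> k) < m then ennreal ((4 * \<tau> k) powr p) else 0)"
        using top by (auto simp: indicator_def)
    qed
    finally show ?thesis by (simp add: top_unique)
  qed
  have dist_fun: "ennreal (\<tau> k) * emeasure \<mu> {x. ennreal (2 * \<tau> k) < maximal_fun \<mu> h x} \<le> ennreal D * (\<integral>\<^sup>+x. hk k x \<partial>\<mu>)"
    for k
  proof -
    have "{x. ennreal (2 * \<tau> k) < maximal_fun \<mu> h x} \<subseteq> {x. ennreal (\<tau> k) < maximal_fun \<mu> (hk k) x}"
    proof safe
      fix x assume *: "ennreal (2 * \<tau> k) < maximal_fun \<mu> h x"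
      have "maximal_fun \<mu> h x \<le> maximal_fun \<mu> (hk k) x + ennreal (\<tau> k)"
        by (rule maximal_fun_le_add_const) (auto simp: hk_def not_less)
      with * have "ennreal (\<tau> k) + ennreal (\<tau> k) < maximal_fun \<mu> (hk k) x + ennreal (\<tau> k)"
        using \<tau>_pos[of k] by (simp add: ennreal_plus[symmetric] less_imp_le del: ennreal_plus)
      then show "ennreal (\<tau> k) < maximal_fun \<mu> (hk k) x"
        by (meson add_right_mono not_less)
    qed
    then have "ennreal (\<tau> k) * emeasure \<mu> {x. ennreal (2 * \<tau> k) < maximal_fun \<mu> h x}
      \<le> ennreal (\<tau> k) * emeasure \<mu> {x. ennreal (\<tau> k) < maximal_fun \<mu> (hk k) x}"
      by (intro mult_left_mono emeasure_mono open_sets open_maximal_fun_superlevel) auto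
    also have "\<dots> \<le> ennreal D * (\<integral>\<^sup>+x. hk k x \<partial>\<mu>)"
      using \<tau>_pos by (intro weak_type) auto
    finally show ?thesis .
  qed
  have [measurable]: "{x. t < maximal_fun \<mu> h x} \<in> sets \<mu>" for t
    by (intro open_sets open_maximal_fun_superlevel)
  have "(\<integral>\<^sup>+x. ennpowr (maximal_fun \<mu> h x) p \<partial>\<mu>)
    \<le> (\<integral>\<^sup>+x. (\<integral>\<^sup>+k. ennreal ((4 * \<tau> k) powr p) * indicator {x. ennreal (2 * \<tau> k) < maximal_fun \<mu> h x} x \<partial>count_space UNIV) \<partial>\<mu>)"
    by (intro nn_integral_mono order_trans[OF layer]) (auto simp: indicator_def)
  also have "\<dots> = (\<integral>\<^sup>+k. ennreal ((4 * \<tau> k) powr p) * emeasure \<mu> {x. ennreal (2 * \<tau> k) < maximal_fun \<mu> h x} \<partial>count_space UNIV)"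
    by (subst nn_integral_count_space_nn_integral) (auto simp: nn_integral_cmult_indicator)
  also have "\<dots> \<le> (\<integral>\<^sup>+k. (\<integral>\<^sup>+x. ennreal (D * 4 powr p) * (ennreal (\<tau> k powr (p - 1)) * hk k x) \<partial>\<mu>) \<partial>count_space UNIV)"
  proof (rule nn_integral_mono)
    fix k
    have "(4 * \<tau> k) powr p = 4 powr p * \<tau> k powr (p - 1) * \<tau> k"
      using \<tau>_pos[of k] by (simp add: powr_mult powr_diff)
    then have "ennreal ((4 * \<tau> k) powr p) * emeasure \<mu> {x. ennreal (2 * \<tau> k) < maximal_fun \<mu> h x}
      = ennreal (4 powr p * \<tau> k powr (p - 1)) * (ennreal (\<tau> k) * emeasure \<mu> {x. ennreal (2 * \<tau> k) < maximal_fun \<mu> h x})"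
      using \<tau>_pos[of k] by (simp add: ennreal_mult less_imp_le mult.assoc)
    also have "\<dots> \<le> ennreal (4 powr p * \<tau> k powr (p - 1)) * (ennreal D * (\<integral>\<^sup>+x. hk k x \<partial>\<mu>))"
      by (intro mult_left_mono dist_fun) auto
    also have "\<dots> = (\<integral>\<^sup>+x. ennreal (D * 4 powr p) * (ennreal (\<tau> k powr (p - 1)) * hk k x) \<partial>\<mu>)"
      using D_pos by (simp add: nn_integral_cmult ennreal_mult) (simp add: mult_ac)
    finally show "ennreal ((4 * \<tau> k) powr p) * emeasure \<mu> {x. ennreal (2 * \<tau> k) < maximal_fun \<mu> h x} \<le> \<dots>" .
  qed
  also have "\<dots> = (\<integral>\<^sup>+x. (\<integral>\<^sup>+k. ennreal (D * 4 powr p) * (ennreal (\<tau> k powr (p - 1)) * hk k x) \<partial>count_space UNIV) \<partial>\<mu>)"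
    by (subst nn_integral_count_space_nn_integral) auto
  also have "\<dots> \<le> (\<integral>\<^sup>+x. ennreal (D * 4 powr p * A) * ennpowr (h x) p \<partial>\<mu>)"
  proof (rule nn_integral_mono)
    fix x
    show "(\<integral>\<^sup>+k. ennreal (D * 4 powr p) * (ennreal (\<tau> k powr (p - 1)) * hk k x) \<partial>count_space UNIV)
      \<le> ennreal (D * 4 powr p * A) * ennpowr (h x) p"
    proof (cases "h x")
      case (real y)
      have "(\<integral>\<^sup>+k. ennreal (\<tau> k powr (p - 1)) * hk k x \<partial>count_space UNIV)
        \<le> (\<integral>\<^sup>+k. h x * (if \<tau> k \<le> y then ennreal (\<tau> k powr (p - 1)) else 0) \<partial>count_space UNIV)"
        using real \<tau>_pos by (intro nn_integral_mono) (auto simp: hk_def ennreal_less_iff less_imp_le mult.commute)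
      also have "\<dots> \<le> h x * ennreal (A * y powr (p - 1))"
        unfolding nn_integral_cmult[OF borel_measurable_count_space] A_def
        using real p \<tau>_pos
        by (intro mult_left_mono geometric_sum_powr_below) (auto simp: \<tau>_def powr_add)
      also have "\<dots> = ennreal A * ennpowr (h x) p"
        using real A by (cases "y = 0") (auto simp: ennreal_mult[symmetric] powr_diff)
      finally have "ennreal (D * 4 powr p) * (\<integral>\<^sup>+k. ennreal (\<tau> k powr (p - 1)) * hk k x \<partial>count_space UNIV)
        \<le> ennreal (D * 4 powr p) * (ennreal A * ennpowr (h x) p)"
        by (rule mult_left_mono) auto
      then show ?thesis
        using D_pos A by (simp add: nn_integral_cmult ennreal_mult mult.assoc)
    next
      case top
      then show ?thesis using D_pos A by (simp add: ennreal_mult_top)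
    qed
  qed
  also have "\<dots> = ennreal (D * 4 powr p * A) * (\<integral>\<^sup>+x. ennpowr (h x) p \<partial>\<mu>)"
    by (simp add: nn_integral_cmult)
  finally show "(\<integral>\<^sup>+x. ennpowr (maximal_fun \<mu> h x) p \<partial>\<mu>) \<le> \<dots>" .
qed

end

subsection \<open>Pairs of dual weights\<close>

definition weighted_lebesgue :: "('a::euclidean_space \<Rightarrow> real) \<Rightarrow> 'a measure" where
  "weighted_lebesgue v = density lebesgue (\<lambda>x. ennreal (v x))"

lemma sets_weighted_lebesgue [simp, measurable_cong]: "sets (weighted_lebesgue v) = sets lebesgue"
  by (simp add: weighted_lebesgue_def)

lemma space_weighted_lebesgue [simp]: "space (weighted_lebesgue v) = UNIV"
  by (simp add: weighted_lebesgue_def)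

lemma nn_integral_weighted_lebesgue:
  assumes "v \<in> borel_measurable lebesgue" "h \<in> borel_measurable lebesgue"
  shows "(\<integral>\<^sup>+x. h x \<partial>weighted_lebesgue v) = (\<integral>\<^sup>+x. ennreal (v x) * h x \<partial>lebesgue)"
  unfolding weighted_lebesgue_def using assms by (intro nn_integral_density) auto

lemma emeasure_weighted_lebesgue:
  assumes "v \<in> borel_measurable lebesgue" "E \<in> sets lebesgue"
  shows "emeasure (weighted_lebesgue v) E = (\<integral>\<^sup>+x\<in>E. ennreal (v x) \<partial>lebesgue)"
  unfolding weighted_lebesgue_def using assms by (intro emeasure_density) auto

lemma measure_lebesgue_ball_scale:
  fixes x :: "'a::euclidean_space"
  assumes "0 < r" "0 < c"
  shows "measure lebesgue (ball x (c * r)) = c ^ DIM('a) * measure lebesgue (ball x r)"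
  using assms by (simp add: content_ball power_mult_distrib)

lemma measure_lebesgue_ball_pos: "0 < r \<Longrightarrow> 0 < measure lebesgue (ball x r)"
  by (simp add: content_ball_pos)

text \<open>The assumptions are invariant under exchanging \<open>(v, a)\<close> and \<open>(u, b)\<close>, so every property of \<open>v\<close>
  holds for \<open>u\<close> as well.\<close>

locale weight_pair =
  fixes v u :: "'a::euclidean_space \<Rightarrow> real" and a b C :: real
  assumes v_measurable [measurable]: "v \<in> borel_measurable lebesgue"
    and u_measurable [measurable]: "u \<in> borel_measurable lebesgue"
    and AE_weights: "AE x in lebesgue. 0 < v x \<and> 0 < u x \<and> v x powr a * u x powr b = 1"
    and a_pos: "0 < a" and b_pos: "0 < b" and ab: "a + b < 1"
    and finite_v: "(\<integral>\<^sup>+x\<in>ball c r. ennreal (v x) \<partial>lebesgue) < top"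
    and finite_u: "(\<integral>\<^sup>+x\<in>ball c r. ennreal (u x) \<partial>lebesgue) < top"
    and bound: "0 < r \<Longrightarrow> measure (weighted_lebesgue v) (ball c r) powr a
      * measure (weighted_lebesgue u) (ball c r) powr b \<le> C * measure lebesgue (ball c r) powr (a + b)"
begin

lemma ball_in_sets_lebesgue [measurable]: "ball x r \<in> sets lebesgue" for x :: 'a
  by simp

abbreviation "\<mu>v \<equiv> weighted_lebesgue v"
abbreviation "\<mu>u \<equiv> weighted_lebesgue u"

lemma emeasure_ball_finite: "emeasure \<mu>v (ball c r) < top"
  using finite_v by (simp add: emeasure_weighted_lebesgue)

text \<open>Positivity of \<open>v\<close> almost everywhere makes Lebesgue measure absolutely
  continuous with respect to \<open>v dx\<close>.\<close>

lemma emeasure_pos: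
  assumes E: "E \<in> sets lebesgue" "emeasure lebesgue E \<noteq> 0"
  shows "emeasure \<mu>v E \<noteq> 0"
proof
  assume "emeasure \<mu>v E = 0"
  then have "AE x in lebesgue. ennreal (v x) * indicator E x = 0"
    using E by (simp add: emeasure_weighted_lebesgue nn_integral_0_iff_AE)
  with AE_weights have "AE x in lebesgue. x \<notin> E"
    by eventually_elim (auto simp: indicator_def ennreal_eq_0_iff split: if_splits)
  then show False using E by (simp add: AE_iff_measurable[OF E(1)])
qed

lemma emeasure_lebesgue_ball_neq_0: "0 < r \<Longrightarrow> emeasure lebesgue (ball c r) \<noteq> 0" for c :: 'a
  using measure_lebesgue_ball_pos[of r c] by (auto simp: measure_def)

lemma measure_ball_pos: "0 < r \<Longrightarrow> 0 < measure \<mu>v (ball c r)"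
  using emeasure_pos[OF _ emeasure_lebesgue_ball_neq_0[of r c]] emeasure_ball_finite[of c r]
  by (simp add: measure_def enn2real_positive_iff less_le enn2real_eq_0_iff)

end

sublocale weight_pair \<subseteq> swap: weight_pair u v b a C
proof unfold_locales
  show "AE x in lebesgue. 0 < u x \<and> 0 < v x \<and> u x powr b * v x powr a = 1"
    using AE_weights by eventually_elim (auto simp: mult.commute)
qed (use a_pos b_pos ab finite_v finite_u bound in \<open>auto simp: mult.commute add.commute\<close>)

context weight_pair begin

section \<open>Volume comparison between the two weights and Lebesgue measure\<close>

lemma emeasure_eq_measure_subset_ball:
  assumes "E \<subseteq> ball c r"
  shows "emeasure \<mu>v E = ennreal (measure \<mu>v E)" "emeasure \<mu>u E = ennreal (measure \<mu>u E)"
    "emeasure lebesgue E = ennreal (measure lebesgue E)"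
proof -
  have *: "emeasure \<mu> E = ennreal (measure \<mu> E)" if "emeasure \<mu> (ball c r) < top" "ball c r \<in> sets \<mu>" for \<mu>
    using order.strict_trans1[OF emeasure_mono[OF assms that(2)] that(1)] by (simp add: measure_def)
  show "emeasure \<mu>v E = ennreal (measure \<mu>v E)" "emeasure \<mu>u E = ennreal (measure \<mu>u E)"
    "emeasure lebesgue E = ennreal (measure lebesgue E)"
    using emeasure_ball_finite swap.emeasure_ball_finite
    by (auto intro!: * simp: emeasure_lborel_ball_finite[unfolded infinity_ennreal_def])
qed

text \<open>Hoelder's inequality for \<open>1 = v powr a * u powr b\<close> on \<open>E\<close> with
  the exponents \<open>a\<close>, \<open>b\<close> and \<open>1 - a - b\<close>. It is a converse of
  \<open>bound\<close> that reaches all measurable subsets of balls, not only the balls.\<close>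

lemma measure_lower_bound:
  assumes E: "E \<in> sets lebesgue" "E \<subseteq> ball c r"
  shows "measure lebesgue E powr (a + b) \<le> measure \<mu>v E powr a * measure \<mu>u E powr b"
proof (cases "measure lebesgue E = 0")
  case False
  then have pos: "0 < measure lebesgue E" using measure_nonneg[of lebesgue E] by linarith
  note em = emeasure_eq_measure_subset_ball[OF E(2)]
  note [measurable] = E(1)
  \<comment> \<open>The three-factor inequality is two nested applications: exponents
    \<open>s\<close> and \<open>1 - s\<close> outside, \<open>a / s\<close> and \<open>b / s\<close>
    inside.\<close>
  define s where "s = a + b"
  have s: "0 < s" "s < 1" using a_pos b_pos ab by (auto simp: s_def)
  let ?v = "\<lambda>x. ennreal (v x) * indicator E x" and ?u = "\<lambda>x. ennreal (u x) * indicator E x"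
  have "emeasure lebesgue E = (\<integral>\<^sup>+x. indicator E x \<partial>lebesgue)" by simp
  also have "\<dots> = (\<integral>\<^sup>+x. ennpowr (ennpowr (?v x) (a / s) * ennpowr (?u x) (b / s)) s
      * ennpowr (indicator E x) (1 - s) \<partial>lebesgue)"
  proof (rule nn_integral_cong_AE)
    show "AE x in lebesgue. indicator E x = ennpowr (ennpowr (?v x) (a / s) * ennpowr (?u x) (b / s)) s
      * ennpowr (indicator E x) (1 - s)"
      using AE_weights
    proof eventually_elim
      case (elim x)
      then show ?case using s
        by (auto simp: indicator_def ennpowr_mult ennpowr_ennpowr ennreal_mult[symmetric] powr_powr)
    qed
  qed
  also have "\<dots> \<le> ennpowr (\<integral>\<^sup>+x. ennpowr (?v x) (a / s) * ennpowr (?u x) (b / s) \<partial>lebesgue) s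
      * ennpowr (\<integral>\<^sup>+x. indicator E x \<partial>lebesgue) (1 - s)"
    using s by (intro nn_integral_Holder) auto
  also have "\<dots> \<le> ennpowr (ennpowr (\<integral>\<^sup>+x. ?v x \<partial>lebesgue) (a / s) * ennpowr (\<integral>\<^sup>+x. ?u x \<partial>lebesgue) (b / s)) s
      * ennpowr (\<integral>\<^sup>+x. indicator E x \<partial>lebesgue) (1 - s)"
    using s a_pos b_pos
    by (intro mult_right_mono ennpowr_mono nn_integral_Holder) (auto simp: s_def add_divide_distrib[symmetric])
  also have "\<dots> = ennreal (measure \<mu>v E powr a * measure \<mu>u E powr b * measure lebesgue E powr (1 - s))"
    using s by (simp add: emeasure_weighted_lebesgue[symmetric] em ennpowr_mult ennpowr_ennpowr
       ennreal_mult powr_powr powr_mult)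
  finally have "measure lebesgue E \<le> measure \<mu>v E powr a * measure \<mu>u E powr b * measure lebesgue E powr (1 - s)"
    by (simp add: em ennreal_le_iff)
  moreover have "measure lebesgue E = measure lebesgue E powr s * measure lebesgue E powr (1 - s)"
    using pos by (simp flip: powr_add)
  ultimately have "measure lebesgue E powr s * measure lebesgue E powr (1 - s)
    \<le> measure \<mu>v E powr a * measure \<mu>u E powr b * measure lebesgue E powr (1 - s)" by simp
  then show ?thesis using pos by (simp add: s_def)
qed simp

lemma C_pos: "0 < C"
proof -
  have "0 < measure \<mu>v (ball 0 1) powr a * measure \<mu>u (ball 0 1) powr b"
    using measure_ball_pos[of 1 0] swap.measure_ball_pos[of 1 0] by simp
  also have "\<dots> \<le> C * measure lebesgue (ball (0::'a) 1) powr (a + b)" by (rule bound) simp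
  finally show ?thesis by (simp add: zero_less_mult_iff)
qed

text \<open>A property of A-infinity type: a subset with a fixed share of the Lebesgue volume has a
  fixed share of the \<open>v\<close>-volume. The lower bound on \<open>E\<close> is played against
  \<open>bound\<close> on the ball, using that \<open>u\<close> gives \<open>E\<close> at most the
  volume of the ball; the Lebesgue volume then cancels. A smaller ball as \<open>E\<close> yields
  doubling, an annulus yields reverse doubling.\<close>

lemma measure_ball_le:
  assumes E: "E \<in> sets lebesgue" "E \<subseteq> ball c r" and r: "0 < r"
    and K: "measure lebesgue (ball c r) \<le> K * measure lebesgue E" "0 < K"
  shows "measure \<mu>v (ball c r) \<le> (C * K powr (a + b)) powr (1 / a) * measure \<mu>v E"
proof -
  let ?B = "ball c r"
  have Epos: "0 < measure lebesgue E"
    using K measure_lebesgue_ball_pos[OF r, of c] by (smt (verit) measure_nonneg mult_nonneg_nonneg mult_pos_neg zero_less_mult_iff)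
  have u: "measure \<mu>u E \<le> measure \<mu>u ?B"
    using emeasure_mono[of E ?B \<mu>u] E(2) emeasure_eq_measure_subset_ball(2)[OF E(2)]
      emeasure_eq_measure_subset_ball(2)[of ?B c r] by simp
  have "measure \<mu>v ?B powr a * measure lebesgue ?B powr (a + b)
    \<le> measure \<mu>v ?B powr a * (K * measure lebesgue E) powr (a + b)"
    using K a_pos b_pos by (intro mult_left_mono powr_mono2) auto
  also have "\<dots> = measure \<mu>v ?B powr a * K powr (a + b) * measure lebesgue E powr (a + b)"
    using K by (simp add: powr_mult)
  also have "\<dots> \<le> measure \<mu>v ?B powr a * K powr (a + b) * (measure \<mu>v E powr a * measure \<mu>u E powr b)"
    by (intro mult_left_mono measure_lower_bound[OF E]) auto
  also have "\<dots> \<le> measure \<mu>v ?B powr a * K powr (a + b) * (measure \<mu>v E powr a * measure \<mu>u ?B powr b)"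
    using u b_pos by (intro mult_left_mono powr_mono2) auto
  also have "\<dots> = K powr (a + b) * measure \<mu>v E powr a * (measure \<mu>v ?B powr a * measure \<mu>u ?B powr b)"
    by (simp add: mult_ac)
  also have "\<dots> \<le> K powr (a + b) * measure \<mu>v E powr a * (C * measure lebesgue ?B powr (a + b))"
    by (intro mult_left_mono bound r) auto
  finally have "measure \<mu>v ?B powr a \<le> C * K powr (a + b) * measure \<mu>v E powr a"
    using measure_lebesgue_ball_pos[OF r, of c] by (simp add: mult_ac)
  then have "(measure \<mu>v ?B powr a) powr (1 / a) \<le> (C * K powr (a + b) * measure \<mu>v E powr a) powr (1 / a)"
    using a_pos by (intro powr_mono2) auto
  then show ?thesis using a_pos C_pos by (simp add: powr_powr powr_mult)
qed

text \<open>The annulus between radii \<open>r\<close> and \<open>2 * r\<close> holds at least half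
  of the Lebesgue volume of the larger ball. Hence the \<open>v\<close>-volume of the larger ball is
  at most \<open>K\<close> times the difference of the two \<open>v\<close>-volumes, and this is
  rearranged.\<close>

lemma reverse_doubling: "\<exists>\<rho>>1. \<forall>c r. 0 < r \<longrightarrow> \<rho> * measure \<mu>v (ball c r) \<le> measure \<mu>v (ball c (2 * r))"
proof -
  \<comment> \<open>The maximum with 2 ensures \<open>K > 1\<close>, so that
    \<open>K / (K - 1)\<close> is a ratio above 1.\<close>
  define K where "K = max 2 ((C * 2 powr (a + b)) powr (1 / a))"
  have "K / (K - 1) * measure \<mu>v (ball c r) \<le> measure \<mu>v (ball c (2 * r))" if r: "0 < r" for c r
  proof -
    let ?E = "ball c (2 * r) - ball c r"
    have sub: "ball c r \<subseteq> ball c (2 * r)" using r by auto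
    have diff: "measure \<mu> ?E = measure \<mu> (ball c (2 * r)) - measure \<mu> (ball c r)"
      if "emeasure \<mu> (ball c (2 * r)) < top" "sets \<mu> = sets lebesgue" for \<mu>
      using sub that by (intro measure_Diff) auto
    have "2 ^ 1 \<le> (2::real) ^ DIM('a)" using DIM_positive[where 'a='a] by (intro power_increasing) linarith+
    then have "2 * measure lebesgue (ball c r) \<le> measure lebesgue (ball c (2 * r))"
      using measure_lebesgue_ball_scale[OF r, of 2 c] measure_lebesgue_ball_pos[OF r, of c]
      by (simp add: mult_right_mono)
    then have "measure lebesgue (ball c (2 * r)) \<le> 2 * measure lebesgue ?E"
      by (subst diff) (auto simp: emeasure_lborel_ball_finite[unfolded infinity_ennreal_def])
    then have "measure \<mu>v (ball c (2 * r)) \<le> (C * 2 powr (a + b)) powr (1 / a) * measure \<mu>v ?E"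
      using r by (intro measure_ball_le) auto
    also have "\<dots> \<le> K * measure \<mu>v ?E" by (intro mult_right_mono) (auto simp: K_def)
    also have "measure \<mu>v ?E = measure \<mu>v (ball c (2 * r)) - measure \<mu>v (ball c r)"
      by (rule diff) (auto simp: emeasure_ball_finite)
    finally have "K * measure \<mu>v (ball c r) \<le> (K - 1) * measure \<mu>v (ball c (2 * r))"
      by (simp add: algebra_simps)
    moreover have "1 < K" by (simp add: K_def)
    ultimately show ?thesis by (simp add: field_simps)
  qed
  moreover have "1 < K / (K - 1)" by (simp add: K_def)
  ultimately show ?thesis by blast
qed

text \<open>The constant is that of \<open>measure_ball_le\<close> for dilation by 6, because the
  closed ball of radius \<open>5 * r\<close> lies in the open ball of radius
  \<open>6 * r\<close>.\<close>

lemma doubling_measure_v: "doubling_measure \<mu>v ((C * (6 ^ DIM('a)) powr (a + b)) powr (1 / a))"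
proof
  show "emeasure \<mu>v (cball x (5 * r)) \<le> ennreal ((C * (6 ^ DIM('a)) powr (a + b)) powr (1 / a)) * emeasure \<mu>v (ball x r)"
    if r: "0 < r" for x r
  proof -
    have "emeasure \<mu>v (cball x (5 * r)) \<le> emeasure \<mu>v (ball x (6 * r))"
      using r by (intro emeasure_mono) auto
    also have "\<dots> = ennreal (measure \<mu>v (ball x (6 * r)))"
      by (intro emeasure_eq_measure_subset_ball) auto
    also have "\<dots> \<le> ennreal ((C * (6 ^ DIM('a)) powr (a + b)) powr (1 / a) * measure \<mu>v (ball x r))"
      using r measure_lebesgue_ball_scale[OF r, of 6 x] by (intro ennreal_leI measure_ball_le) auto
    also have "\<dots> = ennreal ((C * (6 ^ DIM('a)) powr (a + b)) powr (1 / a)) * emeasure \<mu>v (ball x r)"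
      by (simp add: ennreal_mult emeasure_eq_measure_subset_ball[of "ball x r" x r])
    finally show ?thesis .
  qed
  show "0 < emeasure \<mu>v (ball x r)" if "0 < r" for x r
    using emeasure_pos[OF _ emeasure_lebesgue_ball_neq_0[OF that, of x]] by (simp add: zero_less_iff_neq_zero)
qed (use emeasure_ball_finite in auto)

end

context weight_pair begin

subsection \<open>Averages over dyadic balls\<close>

text \<open>In the application \<open>F = |f| powr \<sigma>\<close> and
  \<open>a + b = 1 - \<sigma>\<alpha>/n\<close>, so this is the mean of \<open>F\<close> over the
  ball multiplied by \<open>|B| powr (\<sigma>\<alpha>/n)\<close>.\<close>

definition frac_avg :: "('a \<Rightarrow> real) \<Rightarrow> 'a \<Rightarrow> real \<Rightarrow> ennreal" where
  "frac_avg F x R = ennreal (measure lebesgue (ball x R) powr - (a + b)) * (\<integral>\<^sup>+y\<in>ball x R. ennreal (F y) \<partial>lebesgue)"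

text \<open>Where \<open>u > 0\<close> this is \<open>(F / u) powr P * u\<close> with
  \<open>P = 1 / (1 - b)\<close>, the integrand of the norm of \<open>F / u\<close> in
  \<open>L^P(u dx)\<close>. In the application it equals \<open>|f| powr p * w powr p\<close> almost
  everywhere.\<close>

definition energy_density :: "('a \<Rightarrow> real) \<Rightarrow> 'a \<Rightarrow> ennreal" where
  "energy_density F y = ennreal (F y powr (1 / (1 - b)) * u y powr - (b / (1 - b)))"

lemma energy_density_measurable [measurable]:
  "F \<in> borel_measurable lebesgue \<Longrightarrow> energy_density F \<in> borel_measurable lebesgue"
  unfolding energy_density_def
  by (intro measurable_compose[OF _ measurable_ennreal] borel_measurable_times powr_real_measurable) auto

lemma dual_volume_le:
  assumes R: "0 < R"
  shows "measure \<mu>u (ball x R) powr b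
    \<le> C * measure lebesgue (ball x R) powr (a + b) * measure \<mu>v (ball x R) powr - a"
proof -
  define L V U where "L = measure lebesgue (ball x R)" and "V = measure \<mu>v (ball x R)"
    and "U = measure \<mu>u (ball x R)"
  have "0 < V" using measure_ball_pos[OF R, of x] by (simp add: V_def)
  then show ?thesis
    using bound[OF R, of x] unfolding L_def[symmetric] V_def[symmetric] U_def[symmetric]
    by (simp add: powr_minus field_simps)
qed

text \<open>Hoelder's inequality after factoring \<open>F\<close> into the powers
  \<open>1 - b\<close> of the energy density and \<open>b\<close> of \<open>u\<close>. The weight
  condition trades the \<open>u\<close>-volume for the \<open>v\<close>-volume, and the Lebesgue
  volume cancels the normalisation of \<open>frac_avg\<close>. The energy stays localised on the
  ball, so that the Morrey growth can be inserted later.\<close>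

lemma frac_avg_le_energy:
  assumes [measurable]: "F \<in> borel_measurable lebesgue" and F: "\<And>y. 0 \<le> F y" and R: "0 < R"
  shows "frac_avg F x R \<le> ennreal (C * measure \<mu>v (ball x R) powr - a)
    * ennpowr (\<integral>\<^sup>+y\<in>ball x R. energy_density F y \<partial>lebesgue) (1 - b)"
proof -
  let ?B = "ball x R"
  let ?f = "\<lambda>y. energy_density F y * indicator ?B y"
  let ?g = "\<lambda>y. ennreal (u y) * indicator ?B y"
  have b: "0 < b" "b < 1" using a_pos b_pos ab by auto
  have "(\<integral>\<^sup>+y\<in>?B. ennreal (F y) \<partial>lebesgue) = (\<integral>\<^sup>+y. ennpowr (?f y) (1 - b) * ennpowr (?g y) b \<partial>lebesgue)"
  proof (rule nn_integral_cong_AE)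
    show "AE y in lebesgue. ennreal (F y) * indicator ?B y = ennpowr (?f y) (1 - b) * ennpowr (?g y) b"
      using AE_weights
    proof eventually_elim
      case (elim y)
      have "(F y powr (1 / (1 - b)) * u y powr - (b / (1 - b))) powr (1 - b) * u y powr b = F y"
        using elim b F[of y] by (simp add: powr_mult powr_powr mult.assoc powr_add[symmetric])
      then show ?case using elim
        by (simp add: energy_density_def indicator_def ennreal_mult[symmetric])
    qed
  qed
  also have "\<dots> \<le> ennpowr (\<integral>\<^sup>+y\<in>?B. energy_density F y \<partial>lebesgue) (1 - b) * ennpowr (\<integral>\<^sup>+y. ?g y \<partial>lebesgue) b"
    using b by (intro nn_integral_Holder) auto
  also have "(\<integral>\<^sup>+y. ?g y \<partial>lebesgue) = ennreal (measure \<mu>u ?B)"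
    by (simp add: emeasure_weighted_lebesgue[symmetric] emeasure_eq_measure_subset_ball[OF order_refl])
  finally have "frac_avg F x R \<le> ennreal (measure lebesgue ?B powr - (a + b)) *
     (ennpowr (\<integral>\<^sup>+y\<in>?B. energy_density F y \<partial>lebesgue) (1 - b) * ennreal (measure \<mu>u ?B powr b))"
    unfolding frac_avg_def by (intro mult_left_mono) auto
  also have "\<dots> = ennreal (measure lebesgue ?B powr - (a + b) * measure \<mu>u ?B powr b)
      * ennpowr (\<integral>\<^sup>+y\<in>?B. energy_density F y \<partial>lebesgue) (1 - b)"
    by (simp add: ennreal_mult mult_ac)
  also have "measure lebesgue ?B powr - (a + b) * measure \<mu>u ?B powr b
      \<le> measure lebesgue ?B powr - (a + b) * (C * measure lebesgue ?B powr (a + b) * measure \<mu>v ?B powr - a)"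
    by (intro mult_left_mono dual_volume_le R) auto
  also have "\<dots> = C * measure \<mu>v ?B powr - a"
    using R by (simp add: powr_add[symmetric] mult_ac)
  finally show ?thesis by (simp add: mult_right_mono ennreal_leI)
qed

text \<open>The exponent \<open>(1 - b)(a + b)/b\<close> is chosen so that all powers of \<open>|B|\<close> cancel in the bound of
  \<open>frac_avg\<close> by \<open>hedberg_fun\<close>, leaving \<open>v(B) powr (1 - a - b)\<close>; divided by \<open>1 - b\<close> it is
  \<open>1 + a/b\<close>, and \<open>v powr -(a/b) = u\<close>, which lets the two maximal theorems be composed.\<close>

definition hedberg_fun :: "('a \<Rightarrow> real) \<Rightarrow> 'a \<Rightarrow> ennreal" where
  "hedberg_fun F x = ennpowr (maximal_fun \<mu>v (\<lambda>y.
      ennpowr (maximal_fun \<mu>u (\<lambda>y. ennreal (F y / u y)) y) (b / ((1 - b) * (a + b))) * ennreal (1 / v y)) x)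
    ((1 - b) * (a + b) / b)"

text \<open>The \<open>u\<close>-average \<open>c\<close> of \<open>F / u\<close> over the ball is
  at most \<open>G\<close> on the whole ball. Integrating \<open>G powr (1 / \<beta>)\<close> there
  for Lebesgue measure, rewritten as the \<open>v\<close>-integral of \<open>h\<close>, turns this
  into a bound by a maximal function at the single point \<open>x\<close>. The
  \<open>u\<close>-volume is then eliminated by the weight condition.\<close>

lemma frac_avg_le_hedberg:
  assumes [measurable]: "F \<in> borel_measurable lebesgue" and F: "\<And>y. 0 \<le> F y" and R: "0 < R"
  shows "frac_avg F x R \<le> ennreal (C powr (1 / b) * measure \<mu>v (ball x R) powr (1 - a - b)) * hedberg_fun F x"
proof -
  let ?B = "ball x R"
  define \<beta> where "\<beta> = (1 - b) * (a + b) / b"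
  have \<beta>: "0 < \<beta>" and inv: "b / ((1 - b) * (a + b)) = 1 / \<beta>" unfolding \<beta>_def using a_pos b_pos ab by auto
  define G where "G = maximal_fun \<mu>u (\<lambda>y. ennreal (F y / u y))"
  have [measurable]: "G \<in> borel_measurable lebesgue" unfolding G_def by simp
  define h where "h y = ennpowr (G y) (1 / \<beta>) * ennreal (1 / v y)" for y
  have [measurable]: "h \<in> borel_measurable lebesgue" unfolding h_def by measurable
  define c where "c = (\<integral>\<^sup>+y\<in>?B. ennreal (F y) \<partial>lebesgue) / emeasure \<mu>u ?B"
  have uB: "emeasure \<mu>u ?B = ennreal (measure \<mu>u ?B)" "0 < measure \<mu>u ?B"
    using R by (simp_all add: emeasure_eq_measure_subset_ball[of ?B x R] swap.measure_ball_pos)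
  have vB: "emeasure \<mu>v ?B = ennreal (measure \<mu>v ?B)" "0 < measure \<mu>v ?B"
    using R by (simp_all add: emeasure_eq_measure_subset_ball[of ?B x R] measure_ball_pos)
  have lB: "emeasure lebesgue ?B = ennreal (measure lebesgue ?B)" "0 < measure lebesgue ?B"
    using R emeasure_eq_measure_subset_ball(3)[of ?B x R] measure_lebesgue_ball_pos[OF R, of x] by auto
  have "(\<integral>\<^sup>+y\<in>?B. ennreal (F y) \<partial>lebesgue) = (\<integral>\<^sup>+y\<in>?B. ennreal (F y / u y) \<partial>\<mu>u)"
  proof (subst nn_integral_weighted_lebesgue)
    show "(\<integral>\<^sup>+y\<in>?B. ennreal (F y) \<partial>lebesgue) = (\<integral>\<^sup>+y. ennreal (u y) * (ennreal (F y / u y) * indicator ?B y) \<partial>lebesgue)"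
    proof (intro nn_integral_cong_AE)
      show "AE y in lebesgue. ennreal (F y) * indicator ?B y = ennreal (u y) * (ennreal (F y / u y) * indicator ?B y)"
        using AE_weights by eventually_elim (simp add: ennreal_mult[symmetric] F mult.assoc[symmetric])
    qed
  qed auto
  then have c_le: "c \<le> G y" if "y \<in> ?B" for y
    unfolding c_def G_def using R that by (simp add: maximal_fun_ge)
  \<comment> \<open>Integrating the constant for Lebesgue measure, instead of \<open>u dx\<close> or
    \<open>v dx\<close>, is what produces the factor \<open>|B| powr \<beta>\<close> beside
    \<open>c\<close>.\<close>
  have "ennpowr c (1 / \<beta>) * ennreal (measure lebesgue ?B) = (\<integral>\<^sup>+y\<in>?B. ennpowr c (1 / \<beta>) \<partial>lebesgue)"
    by (simp add: nn_integral_cmult_indicator lB)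
  also have "\<dots> \<le> (\<integral>\<^sup>+y\<in>?B. ennpowr (G y) (1 / \<beta>) \<partial>lebesgue)"
    using c_le \<beta> by (intro nn_integral_mono) (auto simp: indicator_def ennpowr_mono)
  also have "\<dots> = (\<integral>\<^sup>+y\<in>?B. h y \<partial>\<mu>v)"
  proof (subst nn_integral_weighted_lebesgue)
    show "(\<integral>\<^sup>+y\<in>?B. ennpowr (G y) (1 / \<beta>) \<partial>lebesgue) = (\<integral>\<^sup>+y. ennreal (v y) * (h y * indicator ?B y) \<partial>lebesgue)"
    proof (intro nn_integral_cong_AE)
      show "AE y in lebesgue. ennpowr (G y) (1 / \<beta>) * indicator ?B y = ennreal (v y) * (h y * indicator ?B y)"
        using AE_weights
      proof eventually_elim
        case (elim y)
        then have "ennreal (v y) * ennreal (1 / v y) = 1" by (simp add: ennreal_mult[symmetric])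
        then show ?case unfolding h_def by (metis mult.assoc mult.commute mult_1)
      qed
    qed
  qed auto
  also have "\<dots> = (\<integral>\<^sup>+y\<in>?B. h y \<partial>\<mu>v) / emeasure \<mu>v ?B * emeasure \<mu>v ?B"
    using vB by (simp add: ennreal_divide_times ennreal_mult_divide_eq)
  also have "\<dots> \<le> maximal_fun \<mu>v h x * emeasure \<mu>v ?B"
    using R by (intro mult_right_mono maximal_fun_ge) auto
  finally have "ennpowr (ennpowr c (1 / \<beta>) * ennreal (measure lebesgue ?B)) \<beta> \<le> ennpowr (maximal_fun \<mu>v h x * emeasure \<mu>v ?B) \<beta>"
    using \<beta> by (intro ennpowr_mono) auto
  then have cH: "c * ennreal (measure lebesgue ?B powr \<beta>) \<le> hedberg_fun F x * ennreal (measure \<mu>v ?B powr \<beta>)"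
    using \<beta> by (simp add: ennpowr_mult ennpowr_ennpowr vB hedberg_fun_def inv \<beta>_def[symmetric] h_def[abs_def] G_def)
  have s: "0 < a + b" using a_pos b_pos by simp
  define L V U where "L = measure lebesgue ?B" and "V = measure \<mu>v ?B" and "U = measure \<mu>u ?B"
  have pos: "0 < L" "0 < V" "0 < U" using lB vB uB by (auto simp: L_def V_def U_def)
  have "U powr b \<le> C * L powr (a + b) * V powr - a"
    unfolding L_def V_def U_def by (rule dual_volume_le[OF R])
  then have "(U powr b) powr (1 / b) \<le> (C * L powr (a + b) * V powr - a) powr (1 / b)"
    using b_pos by (intro powr_mono2) auto
  then have U: "U \<le> C powr (1 / b) * L powr ((a + b) / b) * V powr - (a / b)"
    using pos b_pos C_pos by (simp add: powr_powr powr_mult)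
  have "frac_avg F x R = ennreal (L powr - (a + b)) * (c * ennreal U)"
    unfolding frac_avg_def c_def L_def U_def using uB by (simp add: ennreal_divide_times ennreal_mult_divide_eq)
  also have "c = c * ennreal (L powr \<beta>) * ennreal (L powr - \<beta>)"
    using pos by (simp add: mult.assoc ennreal_mult[symmetric] powr_add[symmetric])
  also have "\<dots> \<le> hedberg_fun F x * ennreal (V powr \<beta>) * ennreal (L powr - \<beta>)"
    using cH by (intro mult_right_mono) (auto simp: L_def V_def)
  also have "ennreal (L powr - (a + b)) * (\<dots> * ennreal U) = ennreal (L powr - (a + b) * V powr \<beta> * L powr - \<beta> * U) * hedberg_fun F x"
    using pos by (simp add: ennreal_mult mult_ac)
  finally have 1: "frac_avg F x R \<le> ennreal (L powr - (a + b) * V powr \<beta> * L powr - \<beta> * U) * hedberg_fun F x"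
    by (simp add: mult_left_mono mult_right_mono)
  have "L powr - (a + b) * V powr \<beta> * L powr - \<beta> * U
    \<le> L powr - (a + b) * V powr \<beta> * L powr - \<beta> * (C powr (1 / b) * L powr ((a + b) / b) * V powr - (a / b))"
    using U by (intro mult_left_mono) auto
  also have "\<dots> = C powr (1 / b) * (V powr \<beta> * V powr - (a / b)) * (L powr - (a + b) * L powr - \<beta> * L powr ((a + b) / b))"
    by (simp only: mult_ac)
  also have "\<dots> = C powr (1 / b) * V powr (\<beta> - a / b) * L powr (- (a + b) - \<beta> + (a + b) / b)"
    by (simp add: powr_add[symmetric])
  also have "\<beta> - a / b = 1 - a - b"
    using b_pos unfolding \<beta>_def by (simp add: field_simps)
  also have "- (a + b) - \<beta> + (a + b) / b = 0"
    using b_pos unfolding \<beta>_def by (simp add: field_simps)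
  finally have "L powr - (a + b) * V powr \<beta> * L powr - \<beta> * U \<le> C powr (1 / b) * V powr (1 - a - b)"
    using pos by simp
  then show ?thesis
    using order_trans[OF 1] by (simp add: V_def mult_right_mono ennreal_leI)
qed

lemma hedberg_fun_measurable [measurable]: "hedberg_fun F \<in> borel_measurable lebesgue"
  unfolding hedberg_fun_def by measurable

text \<open>The outer maximal operator acts on \<open>L^p1(v dx)\<close> with
  \<open>p1 = 1 + a / b\<close>. There \<open>v * v powr - p1 = u\<close>, so what is left is the
  norm of the inner maximal function in \<open>L^P(u dx)\<close>; the exponents fit because
  \<open>r * p1 = P\<close>.\<close>

lemma hedberg_fun_norm:
  "\<exists>K>0. \<forall>F\<in>borel_measurable lebesgue. (\<forall>y. 0 \<le> F y) \<longrightarrow>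
    (\<integral>\<^sup>+x. ennpowr (hedberg_fun F x) (1 / (1 - b)) \<partial>\<mu>v)
      \<le> ennreal K * (\<integral>\<^sup>+y. energy_density F y \<partial>lebesgue)"
proof -
  interpret V: doubling_measure \<mu>v "(C * (6 ^ DIM('a)) powr (a + b)) powr (1 / a)"
    by (rule doubling_measure_v)
  interpret U: doubling_measure \<mu>u "(C * (6 ^ DIM('a)) powr (b + a)) powr (1 / b)"
    by (rule swap.doubling_measure_v)
  have b: "0 < b" "b < 1" using a_pos b_pos ab by auto
  define r where "r = b / ((1 - b) * (a + b))"
  define p1 where "p1 = (a + b) / b"
  define P where "P = 1 / (1 - b)"
  have "b / ((1 - b) * s) * (s / b) = 1 / (1 - b)" if "s \<noteq> 0" for s
    using b that by simp
  from this[of "a + b"] have p1: "1 < p1" "(1 - b) * (a + b) / b * P = p1" "r * p1 = P"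
    and P: "1 < P"
    using a_pos b by (auto simp: p1_def P_def r_def)
  then have p1': "p1 * r = P" by (simp add: mult.commute)
  obtain K1 where K1: "0 < K1" "\<And>h. h \<in> borel_measurable lebesgue \<Longrightarrow>
    (\<integral>\<^sup>+x. ennpowr (maximal_fun \<mu>v h x) p1 \<partial>\<mu>v) \<le> ennreal K1 * (\<integral>\<^sup>+x. ennpowr (h x) p1 \<partial>\<mu>v)"
    using V.strong_type[OF p1(1)] by (auto simp: measurable_cong_sets[OF sets_weighted_lebesgue refl])
  obtain K2 where K2: "0 < K2" "\<And>h. h \<in> borel_measurable lebesgue \<Longrightarrow>
    (\<integral>\<^sup>+x. ennpowr (maximal_fun \<mu>u h x) P \<partial>\<mu>u) \<le> ennreal K2 * (\<integral>\<^sup>+x. ennpowr (h x) P \<partial>\<mu>u)"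
    using U.strong_type[OF P] by (auto simp: measurable_cong_sets[OF sets_weighted_lebesgue refl])
  have "(\<integral>\<^sup>+x. ennpowr (hedberg_fun F x) P \<partial>\<mu>v) \<le> ennreal (K1 * K2) * (\<integral>\<^sup>+y. energy_density F y \<partial>lebesgue)"
    if [measurable]: "F \<in> borel_measurable lebesgue" and F: "\<forall>y. 0 \<le> F y" for F
  proof -
    define G where "G = maximal_fun \<mu>u (\<lambda>y. ennreal (F y / u y))"
    have [measurable]: "G \<in> borel_measurable lebesgue" unfolding G_def by simp
    have "(\<integral>\<^sup>+x. ennpowr (hedberg_fun F x) P \<partial>\<mu>v)
      = (\<integral>\<^sup>+x. ennpowr (maximal_fun \<mu>v (\<lambda>y. ennpowr (G y) r * ennreal (1 / v y)) x) p1 \<partial>\<mu>v)"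
      unfolding hedberg_fun_def ennpowr_ennpowr p1 G_def r_def ..
    also have "\<dots> \<le> ennreal K1 * (\<integral>\<^sup>+y. ennpowr (ennpowr (G y) r * ennreal (1 / v y)) p1 \<partial>\<mu>v)"
      by (intro K1) measurable
    also have "(\<integral>\<^sup>+y. ennpowr (ennpowr (G y) r * ennreal (1 / v y)) p1 \<partial>\<mu>v) = (\<integral>\<^sup>+y. ennpowr (G y) P \<partial>\<mu>u)"
    proof -
      have "(\<lambda>y. ennpowr (ennpowr (G y) r * ennreal (1 / v y)) p1) \<in> borel_measurable lebesgue"
        and "(\<lambda>y. ennpowr (G y) P) \<in> borel_measurable lebesgue" by measurable
      note eqs = this[THEN nn_integral_weighted_lebesgue[rotated]]
      have "(\<integral>\<^sup>+y. ennreal (v y) * ennpowr (ennpowr (G y) r * ennreal (1 / v y)) p1 \<partial>lebesgue)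
        = (\<integral>\<^sup>+y. ennreal (u y) * ennpowr (G y) P \<partial>lebesgue)"
      proof (rule nn_integral_cong_AE)
        show "AE y in lebesgue. ennreal (v y) * ennpowr (ennpowr (G y) r * ennreal (1 / v y)) p1 = ennreal (u y) * ennpowr (G y) P"
          using AE_weights
        proof eventually_elim
          case (elim y)
          have pos: "0 < v y" "0 < u y" using elim by auto
          \<comment> \<open>The relation between the weights is solved for \<open>u\<close>, which
            gives \<open>u = v powr (1 - p1)\<close>.\<close>
          then have "v y powr (a / b) * u y = (v y powr a * u y powr b) powr (1 / b)"
            using b by (simp add: powr_mult powr_powr)
          then have "v y powr (a / b) * u y = 1" using elim by simp
          then have "u y = v y powr - (a / b)" using elim by (simp add: powr_minus field_simps)
          also have "- (a / b) = 1 - p1" using b by (simp add: p1_def field_simps)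
          finally have "u y = v y * (1 / v y) powr p1"
            using elim by (simp add: powr_diff powr_divide)
          then show ?case
            using elim by (simp add: ennpowr_mult ennpowr_ennpowr p1' ennreal_mult mult_ac)
        qed
      qed
      then show ?thesis by (simp add: eqs)
    qed
    also have "\<dots> \<le> ennreal K2 * (\<integral>\<^sup>+y. ennpowr (ennreal (F y / u y)) P \<partial>\<mu>u)"
      unfolding G_def by (intro K2) measurable
    also have "(\<integral>\<^sup>+y. ennpowr (ennreal (F y / u y)) P \<partial>\<mu>u) = (\<integral>\<^sup>+y. energy_density F y \<partial>lebesgue)"
    proof -
      have "(\<lambda>y. ennpowr (ennreal (F y / u y)) P) \<in> borel_measurable lebesgue" by measurable
      note eq = nn_integral_weighted_lebesgue[OF u_measurable this]
      show ?thesis unfolding eq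
      proof (rule nn_integral_cong_AE)
        show "AE y in lebesgue. ennreal (u y) * ennpowr (ennreal (F y / u y)) P = energy_density F y"
          using AE_weights
        proof eventually_elim
          case (elim y)
          have "- (b / (1 - b)) = 1 - P" using b by (simp add: P_def field_simps)
          then show ?case
            using elim F by (simp add: energy_density_def P_def[symmetric] ennreal_mult[symmetric] powr_divide powr_diff)
        qed
      qed
    qed
    finally show ?thesis
      using K1(1) K2(1) by (simp add: ennreal_mult mult.assoc mult_left_mono)
  qed
  then show ?thesis
    using K1(1) K2(1) unfolding P_def by (intro exI[of _ "K1 * K2"]) auto
qed

section \<open>Dyadic sums of fractional averages: pointwise and norm bounds\<close>

definition frac_sum :: "real \<Rightarrow> ('a \<Rightarrow> real) \<Rightarrow> 'a \<Rightarrow> ennreal" where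
  "frac_sum \<theta> F x = (\<integral>\<^sup>+k. ennpowr (frac_avg F x (2 powr real_of_int k)) \<theta> \<partial>count_space UNIV)"

lemma ball_volume_growth:
  assumes "\<forall>c r. 0 < r \<longrightarrow> \<rho> * measure \<mu>v (ball c r) \<le> measure \<mu>v (ball c (2 * r))"
  shows "0 < measure \<mu>v (ball x (2 powr real_of_int k))"
    "\<rho> * measure \<mu>v (ball x (2 powr real_of_int k)) \<le> measure \<mu>v (ball x (2 powr real_of_int (k + 1)))"
  using assms[rule_format, of "2 powr real_of_int k" x] measure_ball_pos[of "2 powr real_of_int k" x]
  by (auto simp: powr_add mult.commute[of _ 2])

text \<open>By reverse doubling the volumes \<open>t k\<close> of the dyadic balls about
  \<open>x\<close> grow geometrically, so the two-sided sum applies with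
  \<open>e = 1 - a - b\<close>, \<open>H\<close> the Hedberg function and \<open>N\<close> the
  energy to the power \<open>1 - b\<close>. As \<open>a + e = 1 - b\<close>, the energy ends up with
  the exponent \<open>1 - a - b\<close>.\<close>

lemma frac_sum_le_hedberg:
  assumes \<theta>: "0 < \<theta>"
  shows "\<exists>K>0. \<forall>F\<in>borel_measurable lebesgue. (\<forall>y. 0 \<le> F y) \<longrightarrow> (\<integral>\<^sup>+y. energy_density F y \<partial>lebesgue) < top \<longrightarrow>
    (\<forall>x. frac_sum \<theta> F x \<le> ennreal K * ennpowr (ennpowr (hedberg_fun F x) (a / (1 - b))
      * ennpowr (\<integral>\<^sup>+y. energy_density F y \<partial>lebesgue) (1 - a - b)) \<theta>)"
proof -
  obtain \<rho> where \<rho>: "1 < \<rho>" "\<forall>c r. 0 < r \<longrightarrow> \<rho> * measure \<mu>v (ball c r) \<le> measure \<mu>v (ball c (2 * r))"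
    using reverse_doubling by blast
  \<comment> \<open>One constant for both bounds of \<open>frac_avg\<close>: \<open>C\<close> comes
    from the energy bound, \<open>C powr (1 / b)\<close> from the Hedberg bound.\<close>
  define c where "c = max C (C powr (1 / b))"
  have c: "0 < c" using C_pos by (simp add: c_def)
  have e: "0 < 1 - a - b" using ab by simp
  obtain K where K: "0 < K" and sum: "\<And>t :: int \<Rightarrow> real. \<And>X :: int \<Rightarrow> ennreal. \<And>H N.
    (\<And>k. 0 < t k \<and> \<rho> * t k \<le> t (k + 1)) \<Longrightarrow> N < top \<Longrightarrow>
    (\<And>k. X k \<le> ennreal (c * t k powr (1 - a - b)) * H \<and> X k \<le> ennreal (c * t k powr - a) * N) \<Longrightarrow>
    (\<integral>\<^sup>+k. ennpowr (X k) \<theta> \<partial>count_space UNIV)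
      \<le> ennreal K * ennpowr (ennpowr H (a / (a + (1 - a - b))) * ennpowr N ((1 - a - b) / (a + (1 - a - b)))) \<theta>"
    using two_sided_geometric_sum[OF \<rho>(1) a_pos e \<theta> c] by blast
  have "frac_sum \<theta> F x \<le> ennreal K * ennpowr (ennpowr (hedberg_fun F x) (a / (1 - b))
      * ennpowr (\<integral>\<^sup>+y. energy_density F y \<partial>lebesgue) (1 - a - b)) \<theta>"
    if [measurable]: "F \<in> borel_measurable lebesgue" and F: "\<forall>y. 0 \<le> F y"
      and fin: "(\<integral>\<^sup>+y. energy_density F y \<partial>lebesgue) < top" for F x
  proof -
    let ?J = "\<integral>\<^sup>+y. energy_density F y \<partial>lebesgue"
    let ?r = "\<lambda>k::int. 2 powr real_of_int k :: real"
    have "frac_sum \<theta> F x \<le> ennreal K * ennpowr (ennpowr (hedberg_fun F x) (a / (a + (1 - a - b)))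
      * ennpowr (ennpowr ?J (1 - b)) ((1 - a - b) / (a + (1 - a - b)))) \<theta>"
      unfolding frac_sum_def
    proof (rule sum[where t = "\<lambda>k. measure \<mu>v (ball x (?r k))"])
      fix k
      show "0 < measure \<mu>v (ball x (?r k)) \<and> \<rho> * measure \<mu>v (ball x (?r k)) \<le> measure \<mu>v (ball x (?r (k + 1)))"
        using ball_volume_growth[OF \<rho>(2)] by blast
      show "frac_avg F x (?r k) \<le> ennreal (c * measure \<mu>v (ball x (?r k)) powr (1 - a - b)) * hedberg_fun F x
        \<and> frac_avg F x (?r k) \<le> ennreal (c * measure \<mu>v (ball x (?r k)) powr - a) * ennpowr ?J (1 - b)"
      proof (intro conjI)
        have "frac_avg F x (?r k) \<le> ennreal (C powr (1 / b) * measure \<mu>v (ball x (?r k)) powr (1 - a - b)) * hedberg_fun F x"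
          using F by (intro frac_avg_le_hedberg) auto
        also have "\<dots> \<le> ennreal (c * measure \<mu>v (ball x (?r k)) powr (1 - a - b)) * hedberg_fun F x"
          by (intro mult_right_mono ennreal_leI) (auto simp: c_def)
        finally show "frac_avg F x (?r k) \<le> \<dots>" .
        have "frac_avg F x (?r k) \<le> ennreal (C * measure \<mu>v (ball x (?r k)) powr - a)
          * ennpowr (\<integral>\<^sup>+y\<in>ball x (?r k). energy_density F y \<partial>lebesgue) (1 - b)"
          using F by (intro frac_avg_le_energy) auto
        also have "\<dots> \<le> ennreal (c * measure \<mu>v (ball x (?r k)) powr - a) * ennpowr ?J (1 - b)"
          using ab a_pos b_pos
          by (intro mult_mono ennreal_leI mult_right_mono ennpowr_mono nn_integral_mono) (auto simp: c_def indicator_def)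
        finally show "frac_avg F x (?r k) \<le> \<dots>" .
      qed
    qed (use fin in auto)
    then show ?thesis using ab a_pos by (simp add: ennpowr_ennpowr)
  qed
  then show ?thesis using K by blast
qed

text \<open>The exponent \<open>1 / (a * \<theta>)\<close>, which becomes \<open>q\<close>, turns
  the factor with the Hedberg function into its power \<open>1 / (1 - b)\<close>, whose
  \<open>v\<close>-integral the energy controls. The result is stated through a measurable majorant
  \<open>\<Psi>\<close>, so that measurability of \<open>frac_sum\<close> in \<open>x\<close> does
  not have to be discussed.\<close>

lemma frac_sum_norm:
  assumes \<theta>: "0 < \<theta>"
  shows "\<exists>K>0. \<forall>F\<in>borel_measurable lebesgue. (\<forall>y. 0 \<le> F y) \<longrightarrow> (\<integral>\<^sup>+y. energy_density F y \<partial>lebesgue) < top \<longrightarrow>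
    (\<exists>\<Psi>\<in>borel_measurable lebesgue. (\<forall>x. ennpowr (frac_sum \<theta> F x) (1 / (a * \<theta>)) \<le> \<Psi> x) \<and>
      (\<integral>\<^sup>+x. \<Psi> x \<partial>\<mu>v) \<le> ennreal K * ennpowr (\<integral>\<^sup>+y. energy_density F y \<partial>lebesgue) ((1 - b) / a))"
proof -
  obtain K1 where K1: "0 < K1" "\<And>F x. F \<in> borel_measurable lebesgue \<Longrightarrow> (\<forall>y. 0 \<le> F y) \<Longrightarrow>
    (\<integral>\<^sup>+y. energy_density F y \<partial>lebesgue) < top \<Longrightarrow>
    frac_sum \<theta> F x \<le> ennreal K1 * ennpowr (ennpowr (hedberg_fun F x) (a / (1 - b))
      * ennpowr (\<integral>\<^sup>+y. energy_density F y \<partial>lebesgue) (1 - a - b)) \<theta>"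
    using frac_sum_le_hedberg[OF \<theta>] by blast
  obtain K2 where K2: "0 < K2" "\<And>F. F \<in> borel_measurable lebesgue \<Longrightarrow> (\<forall>y. 0 \<le> F y) \<Longrightarrow>
    (\<integral>\<^sup>+x. ennpowr (hedberg_fun F x) (1 / (1 - b)) \<partial>\<mu>v) \<le> ennreal K2 * (\<integral>\<^sup>+y. energy_density F y \<partial>lebesgue)"
    using hedberg_fun_norm by blast
  let ?q = "1 / (a * \<theta>)"
  have "\<exists>\<Psi>\<in>borel_measurable lebesgue. (\<forall>x. ennpowr (frac_sum \<theta> F x) ?q \<le> \<Psi> x) \<and>
      (\<integral>\<^sup>+x. \<Psi> x \<partial>\<mu>v) \<le> ennreal (K1 powr ?q * K2) * ennpowr (\<integral>\<^sup>+y. energy_density F y \<partial>lebesgue) ((1 - b) / a)"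
    if F: "F \<in> borel_measurable lebesgue" "\<forall>y. 0 \<le> F y" "(\<integral>\<^sup>+y. energy_density F y \<partial>lebesgue) < top" for F
  proof -
    note [measurable] = F(1)
    let ?J = "\<integral>\<^sup>+y. energy_density F y \<partial>lebesgue"
    define \<Psi> where "\<Psi> x = ennreal (K1 powr ?q) * ennpowr ?J ((1 - a - b) / a) * ennpowr (hedberg_fun F x) (1 / (1 - b))" for x
    have [measurable]: "\<Psi> \<in> borel_measurable lebesgue" unfolding \<Psi>_def by measurable
    have "\<forall>x. ennpowr (frac_sum \<theta> F x) ?q \<le> \<Psi> x"
    proof
      fix x
      have "ennpowr (frac_sum \<theta> F x) ?q \<le> ennpowr (ennreal K1 * ennpowr (ennpowr (hedberg_fun F x) (a / (1 - b))
        * ennpowr ?J (1 - a - b)) \<theta>) ?q"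
        using a_pos \<theta> by (intro ennpowr_mono K1 F) auto
      also have "\<dots> = \<Psi> x"
        using a_pos \<theta> K1(1) by (simp add: \<Psi>_def ennpowr_mult ennpowr_ennpowr mult_ac)
      finally show "ennpowr (frac_sum \<theta> F x) ?q \<le> \<Psi> x" .
    qed
    moreover have "(\<integral>\<^sup>+x. \<Psi> x \<partial>\<mu>v) \<le> ennreal (K1 powr ?q * K2) * ennpowr ?J ((1 - b) / a)"
    proof -
      have "(\<integral>\<^sup>+x. \<Psi> x \<partial>\<mu>v) = ennreal (K1 powr ?q) * ennpowr ?J ((1 - a - b) / a) * (\<integral>\<^sup>+x. ennpowr (hedberg_fun F x) (1 / (1 - b)) \<partial>\<mu>v)"
        unfolding \<Psi>_def by (rule nn_integral_cmult) measurable
      then have "(\<integral>\<^sup>+x. \<Psi> x \<partial>\<mu>v) \<le> ennreal (K1 powr ?q) * ennpowr ?J ((1 - a - b) / a) * (ennreal K2 * ?J)"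
        using K2(2)[OF F(1,2)] by (simp add: mult_left_mono)
      also have "\<dots> = ennreal (K1 powr ?q * K2) * (ennpowr ?J ((1 - a - b) / a) * ennpowr ?J 1)"
        using K2(1) by (simp add: ennreal_mult mult_ac)
      also have "ennpowr ?J ((1 - a - b) / a) * ennpowr ?J 1 = ennpowr ?J ((1 - b) / a)"
        using a_pos by (simp only: ennpowr_add[symmetric]) (simp add: field_simps)
      finally show ?thesis .
    qed
    ultimately show ?thesis by (intro bexI[of _ \<Psi>]) auto
  qed
  then show ?thesis using K1(1) K2(1) by (intro exI[of _ "K1 powr ?q * K2"]) auto
qed

section \<open>The Morrey estimate: radii up to r and radii beyond r\<close>

definition far_sum :: "real \<Rightarrow> ('a \<Rightarrow> real) \<Rightarrow> real \<Rightarrow> 'a \<Rightarrow> ennreal" where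
  "far_sum \<theta> F r x = (\<integral>\<^sup>+k. (if r < 2 powr real_of_int k then ennpowr (frac_avg F x (2 powr real_of_int k)) \<theta> else 0) \<partial>count_space UNIV)"

text \<open>Inserting the energy growth into \<open>frac_avg_le_energy\<close> leaves the
  \<open>v\<close>-volume with the exponent \<open>- \<eta>\<close>, where
  \<open>\<eta> = a - \<kappa> * (1 - b)\<close> is positive by the assumption on
  \<open>\<kappa>\<close>. Beyond radius \<open>r\<close> these terms decay geometrically, starting
  from the volume of the ball of radius \<open>r\<close>. \<open>M\<close> stands for the power
  \<open>p\<close> of the Morrey norm.\<close>

lemma far_sum_le:
  assumes \<theta>: "0 < \<theta>" and \<kappa>: "\<kappa> * (1 - b) < a"
  shows "\<exists>K>0. \<forall>F\<in>borel_measurable lebesgue. \<forall>M. (\<forall>y. 0 \<le> F y) \<longrightarrow> 0 \<le> M \<longrightarrow>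
    (\<forall>c r. 0 < r \<longrightarrow> (\<integral>\<^sup>+y\<in>ball c r. energy_density F y \<partial>lebesgue) \<le> ennreal (M * measure \<mu>v (ball c r) powr \<kappa>)) \<longrightarrow>
    (\<forall>x r. 0 < r \<longrightarrow> far_sum \<theta> F r x \<le> ennreal (K * (M powr (1 - b) * measure \<mu>v (ball x r) powr - (a - \<kappa> * (1 - b))) powr \<theta>))"
proof -
  obtain \<rho> where \<rho>: "1 < \<rho>" "\<forall>c r. 0 < r \<longrightarrow> \<rho> * measure \<mu>v (ball c r) \<le> measure \<mu>v (ball c (2 * r))"
    using reverse_doubling by blast
  define \<eta> where "\<eta> = a - \<kappa> * (1 - b)"
  have \<eta>: "0 < \<eta>" using \<kappa> by (simp add: \<eta>_def)
  define K where "K = \<rho> powr (\<eta> * \<theta>) / (\<rho> powr (\<eta> * \<theta>) - 1)"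
  have K: "0 < K" using \<rho>(1) \<eta> \<theta> by (simp add: K_def)
  have "far_sum \<theta> F r x \<le> ennreal (C powr \<theta> * K * (M powr (1 - b) * measure \<mu>v (ball x r) powr - \<eta>) powr \<theta>)"
    if F [measurable]: "F \<in> borel_measurable lebesgue" and F0: "\<forall>y. 0 \<le> F y" and M: "0 \<le> M"
      and energy: "\<forall>c r. 0 < r \<longrightarrow> (\<integral>\<^sup>+y\<in>ball c r. energy_density F y \<partial>lebesgue) \<le> ennreal (M * measure \<mu>v (ball c r) powr \<kappa>)"
      and r: "0 < r" for F M x r
  proof -
    let ?V = "\<lambda>k::int. measure \<mu>v (ball x (2 powr real_of_int k))"
    have V: "0 < ?V k" for k by (simp add: measure_ball_pos)
    let ?A = "C powr \<theta> * M powr ((1 - b) * \<theta>)"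
    have "far_sum \<theta> F r x \<le> (\<integral>\<^sup>+k. ennreal ?A * (if measure \<mu>v (ball x r) \<le> ?V k then ennreal (?V k powr - (\<eta> * \<theta>)) else 0) \<partial>count_space UNIV)"
      unfolding far_sum_def
    proof (rule nn_integral_mono)
      fix k
      show "(if r < 2 powr real_of_int k then ennpowr (frac_avg F x (2 powr real_of_int k)) \<theta> else 0)
        \<le> ennreal ?A * (if measure \<mu>v (ball x r) \<le> ?V k then ennreal (?V k powr - (\<eta> * \<theta>)) else 0)"
      proof (cases "r < 2 powr real_of_int k")
        case True
        have "emeasure \<mu>v (ball x r) \<le> emeasure \<mu>v (ball x (2 powr real_of_int k))"
          using True by (intro emeasure_mono) auto
        then have le: "measure \<mu>v (ball x r) \<le> ?V k"
          using emeasure_eq_measure_subset_ball(1)[OF order_refl[of "ball x r"]]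
            emeasure_eq_measure_subset_ball(1)[OF order_refl[of "ball x (2 powr real_of_int k)"]] by simp
        have "frac_avg F x (2 powr real_of_int k) \<le> ennreal (C * ?V k powr - a)
          * ennpowr (\<integral>\<^sup>+y\<in>ball x (2 powr real_of_int k). energy_density F y \<partial>lebesgue) (1 - b)"
          using F0 by (intro frac_avg_le_energy) auto
        also have "\<dots> \<le> ennreal (C * ?V k powr - a) * ennpowr (ennreal (M * ?V k powr \<kappa>)) (1 - b)"
          using energy a_pos ab by (intro mult_left_mono ennpowr_mono) auto
        also have "\<dots> = ennreal (C * M powr (1 - b) * (?V k powr - a * ?V k powr (\<kappa> * (1 - b))))"
          using M C_pos V[of k] by (simp add: powr_mult powr_powr ennreal_mult[symmetric] mult_ac)
        also have "?V k powr - a * ?V k powr (\<kappa> * (1 - b)) = ?V k powr - \<eta>"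
          by (simp add: powr_add[symmetric] \<eta>_def)
        finally have "ennpowr (frac_avg F x (2 powr real_of_int k)) \<theta> \<le> ennpowr (ennreal (C * M powr (1 - b) * ?V k powr - \<eta>)) \<theta>"
          using \<theta> by (intro ennpowr_mono) auto
        also have "\<dots> = ennreal ?A * ennreal (?V k powr - (\<eta> * \<theta>))"
          using C_pos V[of k] by (simp add: powr_mult powr_powr ennreal_mult[symmetric])
        finally show ?thesis using True le by simp
      qed simp
    qed
    also have "\<dots> = ennreal ?A * (\<integral>\<^sup>+k. (if measure \<mu>v (ball x r) \<le> ?V k then ennreal (?V k powr - (\<eta> * \<theta>)) else 0) \<partial>count_space UNIV)"
      by (simp add: nn_integral_cmult)
    also have "\<dots> \<le> ennreal ?A * ennreal (K * measure \<mu>v (ball x r) powr - (\<eta> * \<theta>))"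
      unfolding K_def using \<rho> \<eta> \<theta> ball_volume_growth[OF \<rho>(2)] measure_ball_pos[OF r]
      by (intro mult_left_mono geometric_sum_powr_above) auto
    also have "\<dots> = ennreal (C powr \<theta> * K * (M powr (1 - b) * measure \<mu>v (ball x r) powr - \<eta>) powr \<theta>)"
      using K measure_ball_pos[OF r, of x] by (simp add: powr_mult powr_powr ennreal_mult[symmetric] mult_ac)
    finally show ?thesis .
  qed
  then show ?thesis
    using K C_pos unfolding \<eta>_def[symmetric] by (intro exI[of _ "C powr \<theta> * K"]) auto
qed

text \<open>A ball of radius at most \<open>r\<close> about a point of \<open>ball c r\<close> lies
  in \<open>ball c (2 * r)\<close>, so averages over it do not notice the truncation.\<close>

lemma frac_sum_le_near_far:
  assumes "0 < r" "x \<in> ball c r"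
  shows "frac_sum \<theta> F x \<le> frac_sum \<theta> (\<lambda>y. F y * indicator (ball c (2 * r)) y) x + far_sum \<theta> F r x"
proof -
  let ?F = "\<lambda>y. F y * indicator (ball c (2 * r)) y"
  have "frac_avg F x R = frac_avg ?F x R" if "R \<le> r" for R
  proof -
    have "ball x R \<subseteq> ball c (2 * r)"
    proof
      fix y assume "y \<in> ball x R"
      then show "y \<in> ball c (2 * r)" using assms that dist_triangle[of c y x] by auto
    qed
    then have "(\<integral>\<^sup>+y\<in>ball x R. ennreal (F y) \<partial>lebesgue) = (\<integral>\<^sup>+y\<in>ball x R. ennreal (?F y) \<partial>lebesgue)"
      by (intro nn_integral_cong) (auto simp: indicator_def subset_iff)
    then show ?thesis by (simp add: frac_avg_def)
  qed
  then have "frac_sum \<theta> F x \<le> (\<integral>\<^sup>+k. ennpowr (frac_avg ?F x (2 powr real_of_int k)) \<theta>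
     + (if r < 2 powr real_of_int k then ennpowr (frac_avg F x (2 powr real_of_int k)) \<theta> else 0) \<partial>count_space UNIV)"
    unfolding frac_sum_def by (intro nn_integral_mono) auto
  also have "\<dots> = frac_sum \<theta> ?F x + far_sum \<theta> F r x"
    unfolding frac_sum_def far_sum_def by (rule nn_integral_add) auto
  finally show ?thesis .
qed

text \<open>The near part is the global norm bound for the truncated function, whose energy is that
  of the doubled ball; the far part is a constant of size \<open>v(B) powr - (\<eta> / a)\<close>,
  integrated over \<open>B\<close>. Both yield the power \<open>\<kappa> * (1 - b) / a\<close> of
  \<open>v(B)\<close>, because \<open>1 - \<eta> / a\<close> has this value.\<close>

lemma frac_sum_morrey:
  assumes \<theta>: "0 < \<theta>" and \<kappa>: "0 < \<kappa>" "\<kappa> * (1 - b) < a"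
  shows "\<exists>K>0. \<forall>F\<in>borel_measurable lebesgue. \<forall>M. (\<forall>y. 0 \<le> F y) \<longrightarrow> 0 \<le> M \<longrightarrow>
    (\<forall>c r. 0 < r \<longrightarrow> (\<integral>\<^sup>+y\<in>ball c r. energy_density F y \<partial>lebesgue) \<le> ennreal (M * measure \<mu>v (ball c r) powr \<kappa>)) \<longrightarrow>
    (\<forall>c r. 0 < r \<longrightarrow> (\<exists>\<Psi>\<in>borel_measurable lebesgue. (\<forall>x\<in>ball c r. ennpowr (frac_sum \<theta> F x) (1 / (a * \<theta>)) \<le> \<Psi> x) \<and>
      (\<integral>\<^sup>+x\<in>ball c r. \<Psi> x \<partial>\<mu>v) \<le> ennreal (K * M powr ((1 - b) / a) * measure \<mu>v (ball c r) powr (\<kappa> * (1 - b) / a))))"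
proof -
  obtain K1 where K1: "0 < K1" and near: "\<forall>F\<in>borel_measurable lebesgue. (\<forall>y. 0 \<le> F y) \<longrightarrow>
    (\<integral>\<^sup>+y. energy_density F y \<partial>lebesgue) < top \<longrightarrow>
    (\<exists>\<Psi>\<in>borel_measurable lebesgue. (\<forall>x. ennpowr (frac_sum \<theta> F x) (1 / (a * \<theta>)) \<le> \<Psi> x) \<and>
      (\<integral>\<^sup>+x. \<Psi> x \<partial>\<mu>v) \<le> ennreal K1 * ennpowr (\<integral>\<^sup>+y. energy_density F y \<partial>lebesgue) ((1 - b) / a))"
    using frac_sum_norm[OF \<theta>] by (elim exE conjE) (rule that)
  obtain K2 where K2: "0 < K2" and far: "\<forall>F\<in>borel_measurable lebesgue. \<forall>M. (\<forall>y. 0 \<le> F y) \<longrightarrow> 0 \<le> M \<longrightarrow>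
    (\<forall>c r. 0 < r \<longrightarrow> (\<integral>\<^sup>+y\<in>ball c r. energy_density F y \<partial>lebesgue) \<le> ennreal (M * measure \<mu>v (ball c r) powr \<kappa>)) \<longrightarrow>
    (\<forall>x r. 0 < r \<longrightarrow> far_sum \<theta> F r x \<le> ennreal (K2 * (M powr (1 - b) * measure \<mu>v (ball x r) powr - (a - \<kappa> * (1 - b))) powr \<theta>))"
    using far_sum_le[OF \<theta> \<kappa>(2)] by (elim exE conjE) (rule that)
  define q where "q = 1 / (a * \<theta>)"
  have q: "0 < q" "\<theta> * q = 1 / a" using a_pos \<theta> by (auto simp: q_def)
  define \<eta> where "\<eta> = a - \<kappa> * (1 - b)"
  have \<eta>: "0 < \<eta>" using \<kappa> by (simp add: \<eta>_def)
  define D where "D = (C * (2 ^ DIM('a)) powr (a + b)) powr (1 / a)"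
  have D: "0 < D" using C_pos by (simp add: D_def)
  have doubling: "measure \<mu>v (ball c (2 * r)) \<le> D * measure \<mu>v (ball c r)" if r: "0 < r" for c r
    unfolding D_def using r measure_lebesgue_ball_scale[OF r, of 2 c] by (intro measure_ball_le) auto
  define \<tau> where "\<tau> = (1 - b) / a"
  have \<tau>: "0 < \<tau>" using a_pos b_pos ab by (simp add: \<tau>_def)
  \<comment> \<open>The factor \<open>2 powr q\<close> pays for splitting the power \<open>q\<close>
    of near plus far; the two summands are the near and the far constant, each with its loss from
    doubling.\<close>
  define K where "K = 2 powr q * (K1 * D powr (\<kappa> * \<tau>) + K2 powr q * D powr (\<eta> / a))"
  have "0 < K" unfolding K_def using K1 K2 D by (simp add: add_pos_pos)
  moreover have "\<exists>\<Psi>\<in>borel_measurable lebesgue. (\<forall>x\<in>ball c r. ennpowr (frac_sum \<theta> F x) q \<le> \<Psi> x) \<and>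
      (\<integral>\<^sup>+x\<in>ball c r. \<Psi> x \<partial>\<mu>v) \<le> ennreal (K * M powr \<tau> * measure \<mu>v (ball c r) powr (\<kappa> * \<tau>))"
    if F [measurable]: "F \<in> borel_measurable lebesgue" and F0: "\<forall>y. 0 \<le> F y" and M: "0 \<le> M"
      and energy: "\<forall>c r. 0 < r \<longrightarrow> (\<integral>\<^sup>+y\<in>ball c r. energy_density F y \<partial>lebesgue) \<le> ennreal (M * measure \<mu>v (ball c r) powr \<kappa>)"
      and r: "0 < r" for F M c r
  proof -
    let ?F = "\<lambda>y. F y * indicator (ball c (2 * r)) y"
    let ?V = "measure \<mu>v (ball c r)"
    have V: "0 < ?V" by (rule measure_ball_pos[OF r])
    have "(\<integral>\<^sup>+y. energy_density ?F y \<partial>lebesgue) = (\<integral>\<^sup>+y\<in>ball c (2 * r). energy_density F y \<partial>lebesgue)"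
      by (intro nn_integral_cong) (auto simp: energy_density_def indicator_def)
    also have "\<dots> \<le> ennreal (M * measure \<mu>v (ball c (2 * r)) powr \<kappa>)" using energy r by simp
    also have "\<dots> \<le> ennreal (M * (D * ?V) powr \<kappa>)"
      using M \<kappa> doubling[OF r, of c] by (intro ennreal_leI mult_left_mono powr_mono2) auto
    finally have J: "(\<integral>\<^sup>+y. energy_density ?F y \<partial>lebesgue) \<le> ennreal (M * (D * ?V) powr \<kappa>)" .
    then have Jfin: "(\<integral>\<^sup>+y. energy_density ?F y \<partial>lebesgue) < top" by (rule order.strict_trans1) simp
    have "ennpowr (\<integral>\<^sup>+y. energy_density ?F y \<partial>lebesgue) \<tau> \<le> ennpowr (ennreal (M * (D * ?V) powr \<kappa>)) \<tau>"
      using J \<tau> by (intro ennpowr_mono) auto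
    also have "\<dots> = ennreal (M powr \<tau> * (D powr (\<kappa> * \<tau>) * ?V powr (\<kappa> * \<tau>)))"
      using M D V by (simp add: powr_mult powr_powr)
    finally have J\<tau>: "ennpowr (\<integral>\<^sup>+y. energy_density ?F y \<partial>lebesgue) \<tau> \<le> ennreal (M powr \<tau> * (D powr (\<kappa> * \<tau>) * ?V powr (\<kappa> * \<tau>)))" .
    obtain \<Psi> where [measurable]: "\<Psi> \<in> borel_measurable lebesgue" and \<Psi>: "\<And>x. ennpowr (frac_sum \<theta> ?F x) q \<le> \<Psi> x"
      "(\<integral>\<^sup>+x. \<Psi> x \<partial>\<mu>v) \<le> ennreal K1 * ennpowr (\<integral>\<^sup>+y. energy_density ?F y \<partial>lebesgue) \<tau>"
    proof -
      have "?F \<in> borel_measurable lebesgue" by measurable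
      from near[rule_format, OF this _ Jfin] F0 that show thesis
        unfolding q_def \<tau>_def by (auto simp: indicator_def)
    qed
    define B where "B = K2 powr q * D powr (\<eta> / a) * (M powr \<tau> * ?V powr - (\<eta> / a))"
    have B: "0 \<le> B" by (simp add: B_def)
    have far_B: "ennpowr (far_sum \<theta> F r x) q \<le> ennreal B" if x: "x \<in> ball c r" for x
    proof -
      let ?T = "measure \<mu>v (ball x r)"
      have T: "0 < ?T" by (rule measure_ball_pos[OF r])
      \<comment> \<open>Recentring from \<open>x\<close> to \<open>c\<close> costs one doubling and
        makes the far bound uniform over the ball.\<close>
      have "ball c r \<subseteq> ball x (2 * r)"
      proof
        fix y assume "y \<in> ball c r"
        then show "y \<in> ball x (2 * r)" using x dist_triangle[of x y c] by (auto simp: dist_commute)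
      qed
      then have "emeasure \<mu>v (ball c r) \<le> emeasure \<mu>v (ball x (2 * r))" by (intro emeasure_mono) auto
      then have "?V \<le> measure \<mu>v (ball x (2 * r))"
        using emeasure_eq_measure_subset_ball(1)[OF order_refl[of "ball c r"]]
          emeasure_eq_measure_subset_ball(1)[OF order_refl[of "ball x (2 * r)"]] by simp
      also have "\<dots> \<le> D * ?T" by (rule doubling[OF r])
      finally have "(D * ?T) powr - (\<eta> / a) \<le> ?V powr - (\<eta> / a)"
        using V \<eta> a_pos by (intro powr_mono2') auto
      then have *: "?T powr - (\<eta> / a) \<le> D powr (\<eta> / a) * ?V powr - (\<eta> / a)"
        using D T by (simp add: powr_mult powr_minus field_simps)
      have "ennpowr (far_sum \<theta> F r x) q \<le> ennpowr (ennreal (K2 * (M powr (1 - b) * ?T powr - \<eta>) powr \<theta>)) q"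
        unfolding \<eta>_def using q F F0 M energy r by (intro ennpowr_mono far[rule_format]) auto
      also have "\<dots> = ennreal (K2 powr q * (M powr \<tau> * ?T powr - (\<eta> / a)))"
        using K2 T M by (simp add: powr_mult powr_powr mult.assoc q(2) \<tau>_def)
      also have "\<dots> \<le> ennreal (K2 powr q * (M powr \<tau> * (D powr (\<eta> / a) * ?V powr - (\<eta> / a))))"
        using * by (intro ennreal_leI mult_left_mono) auto
      also have "\<dots> = ennreal B" by (simp add: B_def mult_ac)
      finally show ?thesis .
    qed
    define \<Phi> where "\<Phi> x = ennreal (2 powr q) * (\<Psi> x + ennreal B)" for x
    have [measurable]: "\<Phi> \<in> borel_measurable lebesgue" unfolding \<Phi>_def by measurable
    have "ennpowr (frac_sum \<theta> F x) q \<le> \<Phi> x" if x: "x \<in> ball c r" for x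
    proof -
      have "ennpowr (frac_sum \<theta> F x) q \<le> ennpowr (frac_sum \<theta> ?F x + far_sum \<theta> F r x) q"
        using q x by (intro ennpowr_mono frac_sum_le_near_far r) auto
      also have "\<dots> \<le> ennreal (2 powr q) * (ennpowr (frac_sum \<theta> ?F x) q + ennpowr (far_sum \<theta> F r x) q)"
        by (rule ennpowr_add_le[OF q(1)])
      also have "\<dots> \<le> \<Phi> x"
        unfolding \<Phi>_def using \<Psi>(1) far_B[OF x] by (intro mult_left_mono add_mono) auto
      finally show ?thesis .
    qed
    moreover have "(\<integral>\<^sup>+x\<in>ball c r. \<Phi> x \<partial>\<mu>v) \<le> ennreal (K * M powr \<tau> * ?V powr (\<kappa> * \<tau>))"
    proof -
      have "(\<integral>\<^sup>+x\<in>ball c r. \<Phi> x \<partial>\<mu>v)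
        = (\<integral>\<^sup>+x. ennreal (2 powr q) * (\<Psi> x * indicator (ball c r) x + ennreal B * indicator (ball c r) x) \<partial>\<mu>v)"
        by (intro nn_integral_cong) (auto simp: \<Phi>_def indicator_def)
      also have "\<dots> = ennreal (2 powr q) * ((\<integral>\<^sup>+x\<in>ball c r. \<Psi> x \<partial>\<mu>v) + ennreal B * emeasure \<mu>v (ball c r))"
        by (simp add: nn_integral_cmult nn_integral_add nn_integral_cmult_indicator)
      also have "\<dots> \<le> ennreal (2 powr q) * (ennreal K1 * ennreal (M powr \<tau> * (D powr (\<kappa> * \<tau>) * ?V powr (\<kappa> * \<tau>))) + ennreal B * ennreal ?V)"
      proof (intro mult_left_mono add_mono)
        have "(\<integral>\<^sup>+x\<in>ball c r. \<Psi> x \<partial>\<mu>v) \<le> (\<integral>\<^sup>+x. \<Psi> x \<partial>\<mu>v)" by (intro nn_integral_mono) (auto simp: indicator_def)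
        also note \<Psi>(2)
        also have "ennreal K1 * ennpowr (\<integral>\<^sup>+y. energy_density ?F y \<partial>lebesgue) \<tau>
          \<le> ennreal K1 * ennreal (M powr \<tau> * (D powr (\<kappa> * \<tau>) * ?V powr (\<kappa> * \<tau>)))"
          by (intro mult_left_mono J\<tau>) auto
        finally show "(\<integral>\<^sup>+x\<in>ball c r. \<Psi> x \<partial>\<mu>v) \<le> \<dots>" .
      qed (auto simp: emeasure_eq_measure_subset_ball[OF order_refl])
      also have "\<dots> = ennreal (2 powr q * (K1 * (M powr \<tau> * (D powr (\<kappa> * \<tau>) * ?V powr (\<kappa> * \<tau>))) + B * ?V))"
        using K1 B by (simp add: ennreal_mult[symmetric] ennreal_plus[symmetric] del: ennreal_plus)
      also have "B * ?V = K2 powr q * D powr (\<eta> / a) * M powr \<tau> * (?V powr - (\<eta> / a) * ?V powr 1)"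
        using V by (simp add: B_def)
      also have "?V powr - (\<eta> / a) * ?V powr 1 = ?V powr (\<kappa> * \<tau>)"
      proof -
        have "- (\<eta> / a) + 1 = \<kappa> * \<tau>" using a_pos by (simp add: \<eta>_def \<tau>_def field_simps)
        then show ?thesis by (simp only: powr_add[symmetric])
      qed
      also have "2 powr q * (K1 * (M powr \<tau> * (D powr (\<kappa> * \<tau>) * ?V powr (\<kappa> * \<tau>))) + K2 powr q * D powr (\<eta> / a) * M powr \<tau> * ?V powr (\<kappa> * \<tau>))
        = K * M powr \<tau> * ?V powr (\<kappa> * \<tau>)"
        by (simp add: K_def algebra_simps)
      finally show ?thesis .
    qed
    ultimately show ?thesis by (intro bexI[of _ \<Phi>]) auto
  qed
  moreover have "\<kappa> * (1 - b) / a = \<kappa> * \<tau>" by (simp add: \<tau>_def)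
  ultimately show ?thesis
    unfolding q_def[symmetric] \<tau>_def[symmetric] by (intro exI[of _ K] conjI ballI allI impI) simp_all
qed

end

subsection \<open>The rough kernel\<close>

lemma
  fixes t :: "'a::euclidean_space"
  assumes "c \<noteq> 0"
  shows lebesgue_density_affine: "lebesgue = density (distr lebesgue lebesgue (\<lambda>x. t + c *\<^sub>R x)) (\<lambda>_. ennreal (\<bar>c\<bar> ^ DIM('a)))"
    and lebesgue_measurable_affine: "(\<lambda>x. t + c *\<^sub>R x) \<in> lebesgue \<rightarrow>\<^sub>M lebesgue"
  using assms lebesgue_affine_euclidean[where c="\<lambda>_::'a. c" and t=t]
    lebesgue_affine_measurable[where c="\<lambda>_::'a. c" and t=t]
  unfolding scaleR_scaleR[symmetric] scaleR_sum_right[symmetric] euclidean_representation prod_constant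
  by simp_all

lemma AE_lebesgue_affine:
  fixes t :: "'a::euclidean_space"
  assumes "AE x in lebesgue. P x" "c \<noteq> 0"
  shows "AE x in lebesgue. P (t + c *\<^sub>R x)"
proof -
  have "AE x in density (distr lebesgue lebesgue (\<lambda>x. t + c *\<^sub>R x)) (\<lambda>_. ennreal (\<bar>c\<bar> ^ DIM('a))). P x"
    using assms(1) unfolding lebesgue_density_affine[OF assms(2), of t, symmetric] .
  then have "AE x in distr lebesgue lebesgue (\<lambda>x. t + c *\<^sub>R x). P x"
    using assms(2) by (subst (asm) AE_density) auto
  then show ?thesis by (rule AE_distrD[OF lebesgue_measurable_affine[OF assms(2)]])
qed

lemma nn_integral_lebesgue_affine:
  fixes t :: "'a::euclidean_space"
  assumes [measurable]: "f \<in> borel_measurable lebesgue" and c: "c \<noteq> 0"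
  shows "(\<integral>\<^sup>+x. f x \<partial>lebesgue) = ennreal (\<bar>c\<bar> ^ DIM('a)) * (\<integral>\<^sup>+x. f (t + c *\<^sub>R x) \<partial>lebesgue)"
proof -
  note [measurable] = lebesgue_measurable_affine[OF c, of t]
  have "(\<integral>\<^sup>+x. f x \<partial>lebesgue)
    = (\<integral>\<^sup>+x. f x \<partial>density (distr lebesgue lebesgue (\<lambda>x. t + c *\<^sub>R x)) (\<lambda>_. ennreal (\<bar>c\<bar> ^ DIM('a))))"
    by (simp only: lebesgue_density_affine[OF c, of t, symmetric])
  also have "\<dots> = (\<integral>\<^sup>+x. ennreal (\<bar>c\<bar> ^ DIM('a)) * f x \<partial>distr lebesgue lebesgue (\<lambda>x. t + c *\<^sub>R x))"
    by (rule nn_integral_density) auto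
  also have "\<dots> = (\<integral>\<^sup>+x. ennreal (\<bar>c\<bar> ^ DIM('a)) * f (t + c *\<^sub>R x) \<partial>lebesgue)"
    by (subst nn_integral_distr) auto
  also have "\<dots> = ennreal (\<bar>c\<bar> ^ DIM('a)) * (\<integral>\<^sup>+x. f (t + c *\<^sub>R x) \<partial>lebesgue)"
    by (rule nn_integral_cmult) measurable
  finally show ?thesis .
qed

lemma AE_lebesgue_reflect:
  fixes x :: "'a::euclidean_space"
  shows "AE y in lebesgue. P y \<Longrightarrow> AE y in lebesgue. P (x - y)"
  using AE_lebesgue_affine[of P "-1" x] by simp

lemma lebesgue_measurable_reflect:
  "f \<in> borel_measurable lebesgue \<Longrightarrow> (\<lambda>y. f (x - y)) \<in> borel_measurable lebesgue" for x :: "'a::euclidean_space"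
  using measurable_compose[OF lebesgue_measurable_affine[of "-1" x], of f borel] by simp

lemma nn_integral_lebesgue_reflect:
  fixes x :: "'a::euclidean_space"
  shows "f \<in> borel_measurable lebesgue \<Longrightarrow> (\<integral>\<^sup>+y. f (x - y) \<partial>lebesgue) = (\<integral>\<^sup>+y. f y \<partial>lebesgue)"
  using nn_integral_lebesgue_affine[of f "-1" x] by simp

section \<open>Borel versions and functions of the direction\<close>

lemma completion_ex_borel_measurable_complex:
  fixes g :: "'a \<Rightarrow> complex"
  assumes "g \<in> borel_measurable (completion M)"
  shows "\<exists>g'\<in>borel_measurable M. AE x in M. g x = g' x"
proof -
  have "(\<lambda>x. Re (g x)) \<in> borel_measurable (completion M)" using assms by (simp only: borel_measurable_complex_iff)
  then obtain r where r: "r \<in> borel_measurable M" "AE x in M. Re (g x) = r x"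
    by (rule completion_ex_borel_measurable_real[elim_format]) (elim bexE)
  have "(\<lambda>x. Im (g x)) \<in> borel_measurable (completion M)" using assms by (simp only: borel_measurable_complex_iff)
  then obtain i where i: "i \<in> borel_measurable M" "AE x in M. Im (g x) = i x"
    by (rule completion_ex_borel_measurable_real[elim_format]) (elim bexE)
  have "(\<lambda>x. Complex (r x) (i x)) \<in> borel_measurable M"
    using r(1) i(1) by (subst borel_measurable_complex_iff) simp
  moreover have "AE x in M. g x = Complex (r x) (i x)"
    using r(2) i(2) by eventually_elim (intro complex_eqI, simp_all)
  ultimately show ?thesis by (intro bexI[of _ "\<lambda>x. Complex (r x) (i x)"])
qed

text \<open>The sphere measure sees a cone only inside the unit ball. Since \<open>sgn\<close> is
  invariant under positive dilations, the exceptional null set there can be blown up by the factors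
  \<open>m + 1\<close>, and the countably many dilated balls cover the space.\<close>

lemma AE_sgn:
  fixes P :: "real ^ 'n \<Rightarrow> bool"
  assumes "AE x in sphere_measure. P x"
  shows "AE y in lebesgue. y \<noteq> 0 \<longrightarrow> P (sgn y)"
proof -
  have ball: "emeasure lborel (ball (0 :: real ^ 'n) 1) \<noteq> 0" "emeasure lborel (ball (0 :: real ^ 'n) 1) < \<infinity>"
    using content_ball_pos[of 1 "0 :: real ^ 'n"] emeasure_lborel_ball_finite[of "0 :: real ^ 'n" 1]
    by (auto simp: measure_def)
  have "AE x in distr (uniform_measure lborel (ball 0 1)) borel sgn. x \<in> sphere 0 1 \<longrightarrow> P x"
    using assms unfolding sphere_measure_def AE_completion_iff
    by (subst (asm) AE_restrict_space_iff) auto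
  then have "AE y in uniform_measure lborel (ball 0 1). sgn y \<in> sphere 0 1 \<longrightarrow> P (sgn y)"
    by (rule AE_distrD[rotated]) simp
  then have "AE y in lborel. y \<in> ball 0 1 \<longrightarrow> sgn y \<in> sphere 0 1 \<longrightarrow> P (sgn y)"
    by (subst (asm) AE_uniform_measure[OF ball])
  then have "AE y in lebesgue. y \<in> ball 0 1 \<longrightarrow> sgn y \<in> sphere 0 1 \<longrightarrow> P (sgn y)"
    by (simp add: AE_completion_iff)
  then have 1: "AE y in lebesgue. 0 + (1 / (real m + 1)) *\<^sub>R y \<in> ball 0 1 \<longrightarrow> sgn (0 + (1 / (real m + 1)) *\<^sub>R y) \<in> sphere 0 1
    \<longrightarrow> P (sgn (0 + (1 / (real m + 1)) *\<^sub>R y))" for m :: nat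
    by (rule AE_lebesgue_affine) simp
  then have "AE y in lebesgue. \<forall>m :: nat. 0 + (1 / (real m + 1)) *\<^sub>R y \<in> ball 0 1 \<longrightarrow> sgn (0 + (1 / (real m + 1)) *\<^sub>R y) \<in> sphere 0 1
    \<longrightarrow> P (sgn (0 + (1 / (real m + 1)) *\<^sub>R y))"
    by (subst AE_all_countable) simp
  then show ?thesis
  proof eventually_elim
    case (elim y)
    show ?case
    proof
      assume y: "y \<noteq> 0"
      obtain m :: nat where "norm y < real m" using reals_Archimedean2 by blast
      then have "norm y < real m + 1" by simp
      with elim y show "P (sgn y)"
        by (auto simp: norm_sgn sgn_scaleR divide_simps dest!: spec[of _ m])
    qed
  qed
qed

text \<open>A dilation takes the place of polar coordinates: it preserves directions and multiplies
  volume by \<open>R ^ n\<close>.\<close>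

lemma nn_integral_sgn_ball:
  fixes h :: "real ^ 'n \<Rightarrow> ennreal"
  assumes [measurable]: "h \<in> borel_measurable borel" and R: "0 < R"
  shows "(\<integral>\<^sup>+y\<in>ball 0 R. h (sgn y) \<partial>lebesgue) = ennreal (R ^ CARD('n)) * (\<integral>\<^sup>+y\<in>ball 0 1. h (sgn y) \<partial>lebesgue)"
proof -
  have [measurable]: "ball (0 :: real ^ 'n) R \<in> sets borel" by simp
  have "(\<lambda>y. h (sgn y) * indicator (ball 0 R) y) \<in> borel_measurable lborel" by measurable
  then have "(\<lambda>y. h (sgn y) * indicator (ball 0 R) y) \<in> borel_measurable lebesgue"
    by (rule measurable_completion)
  from nn_integral_lebesgue_affine[OF this, of R 0] R
  have "(\<integral>\<^sup>+y\<in>ball 0 R. h (sgn y) \<partial>lebesgue)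
    = ennreal (R ^ CARD('n)) * (\<integral>\<^sup>+y. h (sgn (R *\<^sub>R y)) * indicator (ball 0 R) (R *\<^sub>R y) \<partial>lebesgue)"
    by simp
  also have "(\<integral>\<^sup>+y. h (sgn (R *\<^sub>R y)) * indicator (ball 0 R) (R *\<^sub>R y) \<partial>lebesgue) = (\<integral>\<^sup>+y\<in>ball 0 1. h (sgn y) \<partial>lebesgue)"
    using R by (intro nn_integral_cong) (auto simp: indicator_def sgn_scaleR)
  finally show ?thesis .
qed

text \<open>The volume of the unit ball undoes the normalisation. Only the origin has no direction
  on the sphere, and it is a null set.\<close>

lemma nn_integral_sphere_measure:
  fixes h :: "real ^ 'n \<Rightarrow> ennreal"
  assumes [measurable]: "h \<in> borel_measurable borel"
  shows "(\<integral>\<^sup>+y\<in>ball 0 1. h (sgn y) \<partial>lebesgue)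
    = emeasure lborel (ball (0 :: real ^ 'n) 1) * (\<integral>\<^sup>+x. h x \<partial>sphere_measure)"
proof -
  let ?B = "ball (0 :: real ^ 'n) 1"
  have [measurable]: "sphere (0 :: real ^ 'n) 1 \<in> sets borel" by simp
  have ball: "emeasure lborel ?B \<noteq> 0" "emeasure lborel ?B < top"
    using content_ball_pos[of 1 "0 :: real ^ 'n"] emeasure_lborel_ball_finite[of "0 :: real ^ 'n" 1]
    by (auto simp: measure_def)
  have "(\<integral>\<^sup>+x. h x \<partial>sphere_measure) = (\<integral>\<^sup>+y. h (sgn y) * indicator (sphere 0 1) (sgn y) \<partial>uniform_measure lborel ?B)"
    unfolding sphere_measure_def nn_integral_completion
    by (subst nn_integral_restrict_space, simp, subst nn_integral_distr) auto
  also have "\<dots> = (\<integral>\<^sup>+y. h (sgn y) * indicator (sphere 0 1) (sgn y) * indicator ?B y \<partial>lborel) / emeasure lborel ?B"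
    by (rule nn_integral_uniform_measure) auto
  also have "(\<integral>\<^sup>+y. h (sgn y) * indicator (sphere 0 1) (sgn y) * indicator ?B y \<partial>lborel) = (\<integral>\<^sup>+y\<in>?B. h (sgn y) \<partial>lborel)"
  proof (rule nn_integral_cong_AE)
    have "AE y in lborel. y \<noteq> (0 :: real ^ 'n)" by (rule AE_lborel_singleton)
    then show "AE y in lborel. h (sgn y) * indicator (sphere 0 1) (sgn y) * indicator ?B y = h (sgn y) * indicator ?B y"
      by eventually_elim (simp add: norm_sgn)
  qed
  finally have "emeasure lborel ?B * (\<integral>\<^sup>+x. h x \<partial>sphere_measure)
    = (\<integral>\<^sup>+y\<in>?B. h (sgn y) \<partial>lborel) * emeasure lborel ?B / emeasure lborel ?B"
    by (simp add: ennreal_times_divide mult.commute)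
  also have "\<dots> = (\<integral>\<^sup>+y\<in>?B. h (sgn y) \<partial>lborel)"
    using ball by (simp add: ennreal_mult_divide_eq)
  finally show ?thesis by (simp add: nn_integral_completion)
qed

text \<open>A function measurable for the completed sphere measure need not compose well with
  \<open>sgn\<close>. A Borel version, extended by 0 off the sphere, does, and it gives the same
  function of the direction almost everywhere.\<close>

lemma sphere_function_borel_version:
  assumes "\<Omega> \<in> borel_measurable sphere_measure"
  obtains \<Omega>' :: "real ^ 'n \<Rightarrow> complex" where "\<Omega>' \<in> borel_measurable borel"
    "AE x in sphere_measure. \<Omega> x = \<Omega>' x" "AE y in lebesgue. \<Omega> (sgn y) = \<Omega>' (sgn y)"
proof -
  let ?\<nu> = "distr (uniform_measure lborel (ball 0 1)) borel sgn :: (real ^ 'n) measure"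
  obtain g where g: "g \<in> borel_measurable (restrict_space ?\<nu> (sphere 0 1))" "AE x in restrict_space ?\<nu> (sphere 0 1). \<Omega> x = g x"
    using completion_ex_borel_measurable_complex assms unfolding sphere_measure_def by blast
  define \<Omega>' where "\<Omega>' x = indicator (sphere 0 1) x *\<^sub>R g x" for x
  have 1: "\<Omega>' \<in> borel_measurable borel"
    using g(1) by (subst (asm) borel_measurable_restrict_space_iff) (auto simp: \<Omega>'_def[abs_def])
  have "AE x in restrict_space ?\<nu> (sphere 0 1). \<Omega> x = \<Omega>' x"
    using g(2) by (subst (asm) AE_restrict_space_iff, simp, subst AE_restrict_space_iff) (auto simp: \<Omega>'_def elim!: eventually_mono)
  then have 2: "AE x in sphere_measure. \<Omega> x = \<Omega>' x"
    unfolding sphere_measure_def by (rule AE_completion)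
  have "AE y in lborel. y \<noteq> (0 :: real ^ 'n)" by (rule AE_lborel_singleton)
  then have "AE y in lebesgue. y \<noteq> (0 :: real ^ 'n)" by (rule AE_completion)
  with AE_sgn[OF 2] have "AE y in lebesgue. \<Omega> (sgn y) = \<Omega>' (sgn y)"
    by eventually_elim auto
  with 1 2 show thesis by (rule that)
qed

text \<open>Hoelder's inequality with the exponents \<open>1 / s\<close> and
  \<open>\<theta> = 1 - 1 / s\<close>: over the ball of radius \<open>R\<close> the integral of the
  power \<open>s\<close> of the kernel is a multiple of \<open>R ^ n\<close>, and its root supplies
  \<open>R powr (n * (1 - \<theta>))\<close>. For \<open>s = \<infinity>\<close> one has
  \<open>\<theta> = 1\<close>, and the essential bound is used directly.\<close>

lemma rough_kernel_Holder:
  fixes \<Omega> :: "real ^ 'n \<Rightarrow> complex" and s :: ereal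
  assumes s: "1 < s" and \<Omega>: "\<Omega> \<in> Ls_sphere s" and \<theta>: "\<theta> = 1 / dual_exponent s"
  shows "\<exists>K>0. \<forall>h\<in>borel_measurable lebesgue. \<forall>R>0. (\<forall>y. 0 \<le> h y) \<longrightarrow>
    (\<integral>\<^sup>+y\<in>ball 0 R. ennreal (cmod (\<Omega> (sgn y)) * h y) \<partial>lebesgue)
      \<le> ennreal (K * R powr (real CARD('n) * (1 - \<theta>)))
        * ennpowr (\<integral>\<^sup>+y\<in>ball 0 R. ennreal (h y powr (1 / \<theta>)) \<partial>lebesgue) \<theta>"
proof -
  have meas: "\<Omega> \<in> borel_measurable sphere_measure" using \<Omega> by (simp add: Ls_sphere_def)
  show ?thesis
  proof (cases "s = \<infinity>")
    case True
    then have \<theta>1: "\<theta> = 1" using \<theta> by (simp add: dual_exponent_def)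
    have "esssup sphere_measure (\<lambda>x. ennreal (cmod (\<Omega> x))) < top"
      using \<Omega> True by (simp add: Ls_sphere_def)
    then obtain L where L: "esssup sphere_measure (\<lambda>x. ennreal (cmod (\<Omega> x))) = ennreal L" "0 \<le> L"
      by (cases "esssup sphere_measure (\<lambda>x. ennreal (cmod (\<Omega> x)))") auto
    have "AE x in sphere_measure. cmod (\<Omega> x) \<le> L"
      using esssup_AE[of "\<lambda>x. ennreal (cmod (\<Omega> x))" sphere_measure] unfolding L by (simp add: L)
    then have "AE y in lebesgue. y \<noteq> 0 \<longrightarrow> cmod (\<Omega> (sgn y)) \<le> L" by (rule AE_sgn)
    moreover have "AE y in lebesgue. y \<noteq> (0 :: real ^ 'n)" by (rule AE_completion[OF AE_lborel_singleton])
    ultimately have bdd: "AE y in lebesgue. cmod (\<Omega> (sgn y)) \<le> L + 1" by eventually_elim auto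
    have "(\<integral>\<^sup>+y\<in>ball 0 R. ennreal (cmod (\<Omega> (sgn y)) * h y) \<partial>lebesgue) \<le> ennreal (L + 1) * (\<integral>\<^sup>+y\<in>ball 0 R. ennreal (h y) \<partial>lebesgue)"
      if [measurable]: "h \<in> borel_measurable lebesgue" and h: "\<forall>y. 0 \<le> h y" for h :: "real ^ 'n \<Rightarrow> real" and R
    proof -
      have [measurable]: "ball (0 :: real ^ 'n) R \<in> sets lebesgue" by simp
      have "(\<integral>\<^sup>+y\<in>ball 0 R. ennreal (cmod (\<Omega> (sgn y)) * h y) \<partial>lebesgue) \<le> (\<integral>\<^sup>+y. ennreal (L + 1) * (ennreal (h y) * indicator (ball 0 R) y) \<partial>lebesgue)"
      proof (rule nn_integral_mono_AE)
        show "AE y in lebesgue. ennreal (cmod (\<Omega> (sgn y)) * h y) * indicator (ball 0 R) y \<le> ennreal (L + 1) * (ennreal (h y) * indicator (ball 0 R) y)"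
          using bdd by eventually_elim (use h L in \<open>auto simp: indicator_def ennreal_mult[symmetric] simp del: ennreal_plus intro!: ennreal_leI mult_right_mono\<close>)
      qed
      also have "\<dots> = ennreal (L + 1) * (\<integral>\<^sup>+y\<in>ball 0 R. ennreal (h y) \<partial>lebesgue)"
        by (rule nn_integral_cmult) simp
      finally show ?thesis .
    qed
    then show ?thesis using L(2) unfolding \<theta>1 by (intro exI[of _ "L + 1"]) auto
  next
    case False
    then obtain s0 where s0: "s = ereal s0" "1 < s0" using s by (cases s) auto
    have \<theta>s: "\<theta> = 1 - 1 / s0" using s0 by (simp add: \<theta> dual_exponent_def field_simps)
    have \<theta>01: "0 < \<theta>" "\<theta> < 1" using s0 by (auto simp: \<theta>s)
    obtain \<Omega>' where [measurable]: "\<Omega>' \<in> borel_measurable borel"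
      and \<Omega>': "AE x in sphere_measure. \<Omega> x = \<Omega>' x" "AE y in lebesgue. \<Omega> (sgn y) = \<Omega>' (sgn y)"
      using sphere_function_borel_version[OF meas] .
    define A where "A = (\<integral>\<^sup>+y\<in>ball 0 1. ennreal (cmod (\<Omega>' (sgn y)) powr s0) \<partial>lebesgue)"
    have "(\<integral>\<^sup>+x. ennreal (cmod (\<Omega>' x) powr s0) \<partial>sphere_measure) = (\<integral>\<^sup>+x. ennreal (cmod (\<Omega> x) powr s0) \<partial>sphere_measure)"
      using \<Omega>'(1) by (intro nn_integral_cong_AE) (auto elim!: eventually_mono)
    also have "\<dots> < top" using \<Omega> s0 by (simp add: Ls_sphere_def)
    finally have "A < top"
      unfolding A_def using emeasure_lborel_ball_finite[of "0 :: real ^ 'n" 1]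
      by (subst nn_integral_sphere_measure) (auto simp: ennreal_mult_less_top)
    then obtain A' where A': "A = ennreal A'" "0 \<le> A'" by (cases A) auto
    \<comment> \<open>Adding 1 keeps the constant positive when \<open>A' = 0\<close>.\<close>
    let ?K = "A' powr (1 / s0) + 1"
    have "(\<integral>\<^sup>+y\<in>ball 0 R. ennreal (cmod (\<Omega> (sgn y)) * h y) \<partial>lebesgue)
      \<le> ennreal (?K * R powr (real CARD('n) * (1 - \<theta>))) * ennpowr (\<integral>\<^sup>+y\<in>ball 0 R. ennreal (h y powr (1 / \<theta>)) \<partial>lebesgue) \<theta>"
      if [measurable]: "h \<in> borel_measurable lebesgue" and h: "\<forall>y. 0 \<le> h y" and R: "0 < R" for h :: "real ^ 'n \<Rightarrow> real" and R
    proof -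
      let ?I = "\<integral>\<^sup>+y\<in>ball 0 R. ennreal (h y powr (1 / \<theta>)) \<partial>lebesgue"
      let ?f = "\<lambda>y. ennreal (cmod (\<Omega>' (sgn y)) powr s0) * indicator (ball 0 R) y"
      let ?g = "\<lambda>y. ennreal (h y powr (1 / \<theta>)) * indicator (ball 0 R) y"
      have [measurable]: "ball (0 :: real ^ 'n) R \<in> sets borel" by simp
      have "?f \<in> borel_measurable lborel" by measurable
      then have [measurable]: "?f \<in> borel_measurable lebesgue" by (rule measurable_completion)
      have "ball (0 :: real ^ 'n) R \<in> sets lebesgue" by simp
      note [measurable] = this
      have [measurable]: "(\<lambda>y. h y powr (1 / \<theta>)) \<in> borel_measurable lebesgue" by (rule powr_real_measurable) auto
      have [measurable]: "?g \<in> borel_measurable lebesgue" by measurable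
      have "(\<integral>\<^sup>+y\<in>ball 0 R. ennreal (cmod (\<Omega> (sgn y)) * h y) \<partial>lebesgue) = (\<integral>\<^sup>+y. ennpowr (?f y) (1 / s0) * ennpowr (?g y) \<theta> \<partial>lebesgue)"
      proof (rule nn_integral_cong_AE)
        show "AE y in lebesgue. ennreal (cmod (\<Omega> (sgn y)) * h y) * indicator (ball 0 R) y = ennpowr (?f y) (1 / s0) * ennpowr (?g y) \<theta>"
          using \<Omega>'(2) by eventually_elim (use h \<theta>01 s0 in \<open>auto simp: indicator_def powr_powr ennreal_mult[symmetric]\<close>)
      qed
      also have "\<dots> \<le> ennpowr (\<integral>\<^sup>+y. ?f y \<partial>lebesgue) (1 / s0) * ennpowr ?I \<theta>"
        using s0 \<theta>01 by (intro nn_integral_Holder) (auto simp: \<theta>s)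
      also have "(\<integral>\<^sup>+y. ?f y \<partial>lebesgue) = ennreal (R ^ CARD('n)) * A"
        unfolding A_def using R by (intro nn_integral_sgn_ball) measurable
      also have "ennpowr (ennreal (R ^ CARD('n)) * A) (1 / s0) = ennreal (R powr (real CARD('n) * (1 - \<theta>)) * A' powr (1 / s0))"
        using R A' by (simp add: ennpowr_mult ennreal_mult \<theta>s powr_realpow[symmetric] powr_powr)
      also have "\<dots> \<le> ennreal (?K * R powr (real CARD('n) * (1 - \<theta>)))"
        by (intro ennreal_leI) (simp add: algebra_simps)
      finally show ?thesis by (simp add: mult_right_mono)
    qed
    then show ?thesis by (intro exI[of _ ?K]) (auto intro!: add_nonneg_pos)
  qed
qed

text \<open>On the annulus between the radii \<open>2 powr (k - 1)\<close> and
  \<open>2 powr k\<close> the factor \<open>|y| powr (\<alpha> - n)\<close> is comparable to its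
  value at the outer radius. Hoelder's inequality on the full ball contributes
  \<open>(2 powr k) powr (n * (1 - \<theta>))\<close>, and the exponents add up to
  \<open>k * (\<alpha> - n * \<theta>)\<close>.\<close>

lemma frac_integrand_bound:
  fixes \<Omega> :: "real ^ 'n \<Rightarrow> complex" and s :: ereal
  assumes s: "1 < s" and \<Omega>: "\<Omega> \<in> Ls_sphere s" and \<theta>: "\<theta> = 1 / dual_exponent s"
    and \<alpha>: "0 < \<alpha>" "\<alpha> < real CARD('n)"
  shows "\<exists>K>0. \<forall>f\<in>borel_measurable lebesgue. \<forall>x.
    (\<integral>\<^sup>+y. ennreal (cmod (frac_integrand \<Omega> \<alpha> f x y)) \<partial>lebesgue)
      \<le> ennreal K * (\<integral>\<^sup>+k. ennreal (2 powr (real_of_int k * (\<alpha> - real CARD('n) * \<theta>)))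
        * ennpowr (\<integral>\<^sup>+y\<in>ball x (2 powr real_of_int k). ennreal (cmod (f y) powr (1 / \<theta>)) \<partial>lebesgue) \<theta> \<partial>count_space UNIV)"
proof -
  let ?n = "real CARD('n)"
  obtain K where K: "0 < K" and bound: "\<forall>h\<in>borel_measurable lebesgue. \<forall>R>0. (\<forall>y. 0 \<le> h y) \<longrightarrow>
    (\<integral>\<^sup>+y\<in>ball 0 R. ennreal (cmod (\<Omega> (sgn y)) * h y) \<partial>lebesgue)
      \<le> ennreal (K * R powr (?n * (1 - \<theta>))) * ennpowr (\<integral>\<^sup>+y\<in>ball 0 R. ennreal (h y powr (1 / \<theta>)) \<partial>lebesgue) \<theta>"
    using rough_kernel_Holder[OF s \<Omega> \<theta>] by (elim exE conjE) (rule that)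
  \<comment> \<open>The ratio of \<open>|y| powr (\<alpha> - n)\<close> at the inner and at the
    outer radius of a dyadic annulus.\<close>
  define c where "c = 2 powr (?n - \<alpha>)"
  have c: "0 < c" by (simp add: c_def)
  obtain \<Omega>' where [measurable]: "\<Omega>' \<in> borel_measurable borel"
    and \<Omega>': "AE y in lebesgue. \<Omega> (sgn y) = \<Omega>' (sgn y)"
    using sphere_function_borel_version[of \<Omega>] \<Omega> unfolding Ls_sphere_def by blast
  have "(\<integral>\<^sup>+y. ennreal (cmod (frac_integrand \<Omega> \<alpha> f x y)) \<partial>lebesgue)
      \<le> ennreal (K * c) * (\<integral>\<^sup>+k. ennreal (2 powr (real_of_int k * (\<alpha> - ?n * \<theta>)))
        * ennpowr (\<integral>\<^sup>+y\<in>ball x (2 powr real_of_int k). ennreal (cmod (f y) powr (1 / \<theta>)) \<partial>lebesgue) \<theta> \<partial>count_space UNIV)"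
    if f: "f \<in> borel_measurable lebesgue" for f :: "real ^ 'n \<Rightarrow> complex" and x
  proof -
    let ?R = "\<lambda>k::int. 2 powr real_of_int k :: real"
    define h where "h y = cmod (f (x - y))" for y
    have [measurable]: "h \<in> borel_measurable lebesgue"
      unfolding h_def using lebesgue_measurable_reflect[OF f, of x] by simp
    \<comment> \<open>The majorant of annulus \<open>k\<close>, enlarged to a ball for the sake of
      Hoelder's inequality. The Borel version of the kernel makes it measurable, as Tonelli's
      theorem requires.\<close>
    define g where "g k y = ennreal (c * ?R k powr (\<alpha> - ?n)) * (ennreal (cmod (\<Omega>' (sgn y)) * h y) * indicator (ball 0 (?R k)) y)" for k y
    have "(\<lambda>y. \<Omega>' (sgn y)) \<in> borel_measurable lborel" by measurable
    then have [measurable]: "(\<lambda>y. \<Omega>' (sgn y)) \<in> borel_measurable lebesgue" by (rule measurable_completion)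
    have [measurable]: "ball (0 :: real ^ 'n) r \<in> sets lebesgue" for r by simp
    have g_meas: "g k \<in> borel_measurable lebesgue" for k unfolding g_def by measurable
    have zero: "AE y in lebesgue. y \<noteq> (0 :: real ^ 'n)" by (rule AE_completion[OF AE_lborel_singleton])
    have "(\<integral>\<^sup>+y. ennreal (cmod (frac_integrand \<Omega> \<alpha> f x y)) \<partial>lebesgue) \<le> (\<integral>\<^sup>+y. (\<integral>\<^sup>+k. g k y \<partial>count_space UNIV) \<partial>lebesgue)"
    proof (rule nn_integral_mono_AE)
      show "AE y in lebesgue. ennreal (cmod (frac_integrand \<Omega> \<alpha> f x y)) \<le> (\<integral>\<^sup>+k. g k y \<partial>count_space UNIV)"
        using \<Omega>' zero
      proof eventually_elim
        case (elim y)
        \<comment> \<open>Floor plus one gives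
          \<open>2 powr (k - 1) \<le> norm y < 2 powr k\<close>, strict at the outer radius because
          the balls are open.\<close>
        define k where "k = \<lfloor>log 2 (norm y)\<rfloor> + 1"
        have "real_of_int k - 1 \<le> log 2 (norm y)" "log 2 (norm y) < real_of_int k"
          unfolding k_def by linarith+
        then have k: "2 powr (real_of_int k - 1) \<le> norm y" "norm y < ?R k"
          using elim(2) by (auto simp: le_log_iff log_less_iff)
        have "norm y powr - (?n - \<alpha>) \<le> (2 powr (real_of_int k - 1)) powr - (?n - \<alpha>)"
          using k(1) \<alpha> by (intro powr_mono2') auto
        also have "\<dots> = c * ?R k powr (\<alpha> - ?n)"
          by (simp add: c_def powr_powr powr_add[symmetric] algebra_simps)
        finally have 1: "1 / norm y powr (?n - \<alpha>) \<le> c * ?R k powr (\<alpha> - ?n)"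
          using powr_minus[of "norm y" "?n - \<alpha>"] by (simp add: divide_inverse)
        have "cmod (frac_integrand \<Omega> \<alpha> f x y) = 1 / norm y powr (?n - \<alpha>) * (cmod (\<Omega>' (sgn y)) * h y)"
          by (simp add: frac_integrand_def norm_mult norm_divide h_def elim(1))
        also have "\<dots> \<le> c * ?R k powr (\<alpha> - ?n) * (cmod (\<Omega>' (sgn y)) * h y)"
          by (intro mult_right_mono 1) (auto simp: h_def)
        finally have "ennreal (cmod (frac_integrand \<Omega> \<alpha> f x y)) \<le> g k y"
          using k(2) c by (simp add: g_def h_def ennreal_mult[symmetric] ennreal_leI)
        also have "\<dots> = (\<integral>\<^sup>+j. g k y * indicator {k} j \<partial>count_space UNIV)"
          by (simp add: nn_integral_cmult_indicator)
        also have "\<dots> \<le> (\<integral>\<^sup>+k. g k y \<partial>count_space UNIV)"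
          by (intro nn_integral_mono) (auto simp: indicator_def)
        finally show ?case .
      qed
    qed
    also have "\<dots> = (\<integral>\<^sup>+k. (\<integral>\<^sup>+y. g k y \<partial>lebesgue) \<partial>count_space UNIV)"
      by (intro nn_integral_count_space_nn_integral g_meas) auto
    also have "\<dots> \<le> (\<integral>\<^sup>+k. ennreal (K * c) * (ennreal (2 powr (real_of_int k * (\<alpha> - ?n * \<theta>)))
        * ennpowr (\<integral>\<^sup>+y\<in>ball x (?R k). ennreal (cmod (f y) powr (1 / \<theta>)) \<partial>lebesgue) \<theta>) \<partial>count_space UNIV)"
    proof (rule nn_integral_mono)
      fix k :: int
      let ?I = "\<integral>\<^sup>+y\<in>ball x (?R k). ennreal (cmod (f y) powr (1 / \<theta>)) \<partial>lebesgue"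
      have "(\<lambda>y. ennreal (cmod (f y) powr (1 / \<theta>)) * indicator (ball x (?R k)) y) \<in> borel_measurable lebesgue"
      proof -
        have [measurable]: "(\<lambda>y. cmod (f y) powr (1 / \<theta>)) \<in> borel_measurable lebesgue"
          using f by (intro powr_real_measurable) auto
        have [measurable]: "ball x (?R k) \<in> sets lebesgue" by simp
        show ?thesis by measurable
      qed
      from nn_integral_lebesgue_reflect[OF this, of x]
      have I: "(\<integral>\<^sup>+y\<in>ball 0 (?R k). ennreal (h y powr (1 / \<theta>)) \<partial>lebesgue) = ?I"
        by (simp add: h_def indicator_def dist_norm norm_minus_commute)
      have "(\<integral>\<^sup>+y. g k y \<partial>lebesgue) = ennreal (c * ?R k powr (\<alpha> - ?n)) * (\<integral>\<^sup>+y\<in>ball 0 (?R k). ennreal (cmod (\<Omega>' (sgn y)) * h y) \<partial>lebesgue)"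
        unfolding g_def by (rule nn_integral_cmult) measurable
      also have "(\<integral>\<^sup>+y\<in>ball 0 (?R k). ennreal (cmod (\<Omega>' (sgn y)) * h y) \<partial>lebesgue)
        = (\<integral>\<^sup>+y\<in>ball 0 (?R k). ennreal (cmod (\<Omega> (sgn y)) * h y) \<partial>lebesgue)"
        using \<Omega>' by (intro nn_integral_cong_AE) (auto elim!: eventually_mono)
      also have "\<dots> \<le> ennreal (K * ?R k powr (?n * (1 - \<theta>))) * ennpowr ?I \<theta>"
        unfolding I[symmetric] by (rule bound[rule_format]) (auto simp: h_def[abs_def, symmetric], simp add: h_def)
      also have "ennreal (c * ?R k powr (\<alpha> - ?n)) * (ennreal (K * ?R k powr (?n * (1 - \<theta>))) * ennpowr ?I \<theta>)
        = ennreal (K * c) * (ennreal (?R k powr (\<alpha> - ?n) * ?R k powr (?n * (1 - \<theta>))) * ennpowr ?I \<theta>)"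
        using c K by (simp add: ennreal_mult mult_ac)
      also have "?R k powr (\<alpha> - ?n) * ?R k powr (?n * (1 - \<theta>)) = 2 powr (real_of_int k * (\<alpha> - ?n * \<theta>))"
        by (simp add: powr_powr powr_add[symmetric] algebra_simps)
      finally show "(\<integral>\<^sup>+y. g k y \<partial>lebesgue) \<le> ennreal (K * c) * (ennreal (2 powr (real_of_int k * (\<alpha> - ?n * \<theta>))) * ennpowr ?I \<theta>)"
        by (simp add: mult_left_mono)
    qed
    also have "\<dots> = ennreal (K * c) * (\<integral>\<^sup>+k. ennreal (2 powr (real_of_int k * (\<alpha> - ?n * \<theta>)))
        * ennpowr (\<integral>\<^sup>+y\<in>ball x (?R k). ennreal (cmod (f y) powr (1 / \<theta>)) \<partial>lebesgue) \<theta> \<partial>count_space UNIV)"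
      by (rule nn_integral_cmult) simp
    finally show ?thesis .
  qed
  then show ?thesis using K c by (intro exI[of _ "K * c"]) simp
qed

text \<open>Measurability in \<open>x\<close> of a parameter integral asks for joint measurability
  in \<open>(x, y)\<close>, which is clear once \<open>\<Omega>\<close> and \<open>f\<close> are
  Borel. For each fixed \<open>x\<close>, passing to Borel versions alters the integrand only on a
  null set of \<open>y\<close>, so the integral is unchanged at every \<open>x\<close>.\<close>

lemma
  fixes \<Omega> :: "real ^ 'n \<Rightarrow> complex"
  assumes \<Omega>: "\<Omega> \<in> borel_measurable sphere_measure" and f: "f \<in> borel_measurable lebesgue"
  shows frac_integrand_measurable: "frac_integrand \<Omega> \<alpha> f x \<in> borel_measurable lebesgue"
    and frac_integral_measurable: "frac_integral \<Omega> \<alpha> f \<in> borel_measurable lebesgue"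
proof -
  obtain \<Omega>' where [measurable]: "\<Omega>' \<in> borel_measurable borel"
    and \<Omega>': "AE y in lebesgue. \<Omega> (sgn y) = \<Omega>' (sgn y)"
    using sphere_function_borel_version[OF \<Omega>] by blast
  obtain f' where [measurable]: "f' \<in> borel_measurable lborel" and "AE y in lborel. f y = f' y"
    using completion_ex_borel_measurable_complex[OF f] by (elim bexE) (rule that)
  then have f': "AE y in lebesgue. f y = f' y" by (intro AE_completion)
  define g where "g x y = \<Omega>' (sgn y) / complex_of_real (norm y powr (real CARD('n) - \<alpha>)) * f' (x - y)" for x y :: "real ^ 'n"
  have g_joint: "case_prod g \<in> borel_measurable (borel \<Otimes>\<^sub>M lborel)" unfolding g_def by measurable
  have "g x \<in> borel_measurable lborel" for x unfolding g_def by measurable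
  then have g: "g x \<in> borel_measurable lebesgue" for x by (rule measurable_completion)
  have AE: "AE y in lebesgue. frac_integrand \<Omega> \<alpha> f x y = g x y" for x
    using \<Omega>' AE_lebesgue_reflect[OF f', of x] by eventually_elim (simp add: frac_integrand_def g_def)
  show meas: "frac_integrand \<Omega> \<alpha> f x \<in> borel_measurable lebesgue" for x
    using AE[of x] by (intro borel_measurable_AE[OF g[of x]]) (auto elim!: eventually_mono)
  have "frac_integral \<Omega> \<alpha> f = (\<lambda>x. \<integral>y. g x y \<partial>lborel)"
  proof
    fix x
    have "frac_integral \<Omega> \<alpha> f x = (\<integral>y. g x y \<partial>lebesgue)"
      unfolding frac_integral_def by (intro integral_cong_AE meas g AE)
    also have "\<dots> = (\<integral>y. g x y \<partial>lborel)"
      by (rule integral_completion) fact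
    finally show "frac_integral \<Omega> \<alpha> f x = (\<integral>y. g x y \<partial>lborel)" .
  qed
  moreover have "(\<lambda>x. \<integral>y. g x y \<partial>lborel) \<in> borel_measurable borel"
    by (rule lborel.borel_measurable_lebesgue_integral[OF g_joint])
  ultimately have "frac_integral \<Omega> \<alpha> f \<in> borel_measurable borel" by simp
  then have "frac_integral \<Omega> \<alpha> f \<in> borel_measurable lborel" by simp
  then show "frac_integral \<Omega> \<alpha> f \<in> borel_measurable lebesgue" by (rule measurable_completion)
qed

subsection \<open>The weight class\<close>

text \<open>The exponents \<open>1 / Q\<close> and \<open>1 - 1 / P\<close> are those on the two
  averages of the class, and the weights are the functions averaged. Both local volumes are finite
  because each is nonzero, the weights being positive almost everywhere, while the product of their
  powers is bounded.\<close>

lemma A_class_weight_pair: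
  fixes w :: "real ^ 'n \<Rightarrow> real"
  assumes w: "weight w" and \<sigma>: "0 < \<sigma>" and P: "1 < P" and Q: "0 < Q"
    and A: "(\<lambda>x. w x powr \<sigma>) \<in> A_class P Q"
    and pos: "AE x in lebesgue. 0 < w x" and sum: "1 / Q + (1 - 1 / P) < 1"
  shows "\<exists>C. weight_pair (\<lambda>x. w x powr (\<sigma> * Q)) (\<lambda>x. w x powr - (\<sigma> / (1 - 1 / P))) (1 / Q) (1 - 1 / P) C"
proof -
  define a b where "a = 1 / Q" and "b = 1 - 1 / P"
  have ab: "0 < a" "0 < b" "a + b < 1" using P Q sum by (auto simp: a_def b_def)
  let ?v = "\<lambda>x. w x powr (\<sigma> * Q)" and ?u = "\<lambda>x. w x powr - (\<sigma> / b)"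
  have [measurable]: "w \<in> borel_measurable lebesgue" using w by (simp add: weight_def)
  have w0: "0 \<le> w x" for x using w by (simp add: weight_def)
  have vm: "?v \<in> borel_measurable lebesgue" and um: "?u \<in> borel_measurable lebesgue"
    by (rule powr_real_measurable; simp)+
  obtain C where C: "0 < C" and AC: "\<And>B. B \<in> balls \<Longrightarrow>
     ennpowr (ball_average B (\<lambda>x. ennreal ((w x powr \<sigma>) powr Q))) (1 / Q) *
     ennpowr (ball_average B (\<lambda>x. inverse (ennreal ((w x powr \<sigma>) powr (P / (P - 1)))))) (1 / (P / (P - 1)))
       \<le> ennreal C"
    using A unfolding A_class_def by auto
  have exps: "P / (P - 1) = 1 / b" "1 / (P / (P - 1)) = b" using P by (auto simp: b_def field_simps)
  have AE: "AE x in lebesgue. 0 < ?v x \<and> 0 < ?u x \<and> ?v x powr a * ?u x powr b = 1"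
    using pos by eventually_elim (use ab Q in \<open>simp add: powr_powr a_def[symmetric] powr_add[symmetric], simp add: a_def\<close>)
  let ?B = "\<lambda>c r. ball (c :: real ^ 'n) r"
  define V U where "V c r = (\<integral>\<^sup>+x\<in>?B c r. ennreal (?v x) \<partial>lebesgue)"
    and "U c r = (\<integral>\<^sup>+x\<in>?B c r. ennreal (?u x) \<partial>lebesgue)" for c r
  \<comment> \<open>Where \<open>w > 0\<close> the inverse in the extended reals is the real
    negative power, so the two integrals agree.\<close>
  have U_inv: "(\<integral>\<^sup>+x\<in>?B c r. inverse (ennreal ((w x powr \<sigma>) powr (P / (P - 1)))) \<partial>lebesgue) = U c r" for c r
    unfolding U_def
  proof (rule nn_integral_cong_AE)
    show "AE x in lebesgue. inverse (ennreal ((w x powr \<sigma>) powr (P / (P - 1)))) * indicator (?B c r) x = ennreal (?u x) * indicator (?B c r) x"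
      using pos by eventually_elim (simp add: exps powr_powr inverse_ennreal powr_minus)
  qed
  have L: "emeasure lebesgue (?B c r) = ennreal (measure lebesgue (?B c r))" "0 < r \<Longrightarrow> 0 < measure lebesgue (?B c r)" for c r
    using emeasure_lborel_ball_finite[of c r] measure_lebesgue_ball_pos[of r c] by (auto simp: measure_def)
  have cond: "ennpowr (V c r / ennreal (measure lebesgue (?B c r))) a * ennpowr (U c r / ennreal (measure lebesgue (?B c r))) b \<le> ennreal C"
    if "0 < r" for c r
    using AC[of "?B c r"] that unfolding ball_average_def U_inv exps(2) L(1)
    by (auto simp: balls_def V_def powr_powr a_def)
  have pos_int: "(\<integral>\<^sup>+x\<in>?B c r. ennreal (g x) \<partial>lebesgue) \<noteq> 0"
    if g: "g \<in> borel_measurable lebesgue" "AE x in lebesgue. 0 < g x" and r: "0 < r" for g c r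
  proof
    have [measurable]: "?B c r \<in> sets lebesgue" by simp
    note [measurable] = g(1)
    assume "(\<integral>\<^sup>+x\<in>?B c r. ennreal (g x) \<partial>lebesgue) = 0"
    then have "AE x in lebesgue. ennreal (g x) * indicator (?B c r) x = 0"
      by (subst (asm) nn_integral_0_iff_AE) auto
    with g(2) have "AE x in lebesgue. x \<notin> ?B c r"
      by eventually_elim (auto simp: indicator_def ennreal_eq_0_iff split: if_splits)
    then have "emeasure lebesgue (?B c r) = 0"
      by (subst (asm) AE_iff_measurable[where N = "?B c r"]) auto
    then show False using L(1)[where c = c and r = r] L(2)[OF r, of c] by simp
  qed
  have AEv: "AE x in lebesgue. 0 < ?v x" using AE by eventually_elim blast
  have AEu: "AE x in lebesgue. 0 < ?u x" using AE by eventually_elim blast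
  have V0: "V c r \<noteq> 0" if "0 < r" for c r unfolding V_def by (rule pos_int[OF vm AEv that])
  have U0: "U c r \<noteq> 0" if "0 < r" for c r unfolding U_def by (rule pos_int[OF um AEu that])
  have V_fin: "V c r < top" and U_fin: "U c r < top" for c r
  proof -
    have "V c r < top \<and> U c r < top"
    proof (cases "0 < r")
      case True
      have "V c r \<noteq> top"
      proof
        assume "V c r = top"
        then have "ennpowr (V c r / ennreal (measure lebesgue (?B c r))) a * ennpowr (U c r / ennreal (measure lebesgue (?B c r))) b = top"
          using U0[OF True, of c] by (auto simp: ennreal_top_divide ennreal_top_mult ennreal_divide_eq_0_iff)
        then show False using cond[OF True, of c] by (simp add: top_unique)
      qed
      moreover have "U c r \<noteq> top"
      proof
        assume "U c r = top"
        then have "ennpowr (V c r / ennreal (measure lebesgue (?B c r))) a * ennpowr (U c r / ennreal (measure lebesgue (?B c r))) b = top"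
          using V0[OF True, of c] by (auto simp: ennreal_top_divide ennreal_mult_top ennreal_divide_eq_0_iff)
        then show False using cond[OF True, of c] by (simp add: top_unique)
      qed
      ultimately show ?thesis by (simp add: less_top)
    next
      case False
      then have empty: "?B c r = {}" by simp
      show ?thesis unfolding V_def U_def empty by simp
    qed
    then show "V c r < top" "U c r < top" by auto
  qed
  have "weight_pair ?v ?u a b C"
  proof
    fix c r
    show "(\<integral>\<^sup>+x\<in>?B c r. ennreal (?v x) \<partial>lebesgue) < top" "(\<integral>\<^sup>+x\<in>?B c r. ennreal (?u x) \<partial>lebesgue) < top"
      using V_fin U_fin by (auto simp: V_def U_def)
    assume r: "0 < r"
    define mV mU mL where "mV = measure (weighted_lebesgue ?v) (?B c r)" and "mU = measure (weighted_lebesgue ?u) (?B c r)"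
      and "mL = measure lebesgue (?B c r)"
    have "V c r = ennreal mV" "U c r = ennreal mU"
      using V_fin[of c r] U_fin[of c r] vm um
      by (auto simp: mV_def mU_def measure_def V_def U_def emeasure_weighted_lebesgue)
    moreover have "0 < mL" "0 \<le> mV" "0 \<le> mU" using L(2)[OF r, of c] by (auto simp: mL_def mV_def mU_def)
    ultimately have "(mV / mL) powr a * (mU / mL) powr b \<le> C"
      using cond[OF r, of c] C unfolding mL_def[symmetric] by (simp add: divide_ennreal ennreal_mult[symmetric])
    then show "mV powr a * mU powr b \<le> C * mL powr (a + b)"
      using \<open>0 < mL\<close> by (simp add: powr_divide powr_add field_simps)
  qed (use AE ab vm um in auto)
  then show ?thesis unfolding a_def b_def by blast
qed

text \<open>If \<open>w\<close> vanishes on a nonnull set, then the average of the negative power is \<open>\<infinity>\<close> on every large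
  ball; since \<open>0 \<cdot> \<infinity> = 0\<close>, the class then still admits \<open>w = 0\<close>.\<close>

lemma A_class_pos_or_zero_AE:
  fixes w :: "real ^ 'n \<Rightarrow> real"
  assumes w: "weight w" and \<sigma>: "0 < \<sigma>" and P: "1 < P" and Q: "0 < Q"
    and A: "(\<lambda>x. w x powr \<sigma>) \<in> A_class P Q"
  shows "(AE x in lebesgue. 0 < w x) \<or> (AE x in lebesgue. w x = 0)"
proof (rule disjCI)
  assume notzero: "\<not> (AE x in lebesgue. w x = 0)"
  have [measurable]: "w \<in> borel_measurable lebesgue" using w by (simp add: weight_def)
  have w0: "0 \<le> w x" for x using w by (simp add: weight_def)
  let ?v = "\<lambda>x. (w x powr \<sigma>) powr Q" and ?i = "\<lambda>x. inverse (ennreal ((w x powr \<sigma>) powr (P / (P - 1))))"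
  have [measurable]: "?v \<in> borel_measurable lebesgue" "(\<lambda>x. (w x powr \<sigma>) powr (P / (P - 1))) \<in> borel_measurable lebesgue"
    by (intro powr_real_measurable; simp)+
  \<comment> \<open>Balls exhausting the space; the radius \<open>m + 1\<close> makes
    \<open>m = 0\<close> a genuine ball as well.\<close>
  define B where "B m = ball (0 :: real ^ 'n) (real m + 1)" for m :: nat
  have [measurable]: "B m \<in> sets lebesgue" for m unfolding B_def by simp
  have B_ex: "\<exists>m0. \<forall>m\<ge>m0. x \<in> B m" for x
  proof -
    obtain m0 :: nat where "norm x < real m0" using reals_Archimedean2 by blast
    then show ?thesis by (intro exI[of _ m0]) (auto simp: B_def)
  qed
  have Lfin: "emeasure lebesgue (B m) \<noteq> top" for m
    using emeasure_lborel_ball_finite[of "0 :: real ^ 'n" "real m + 1"] by (simp add: B_def)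
  obtain C where C: "\<forall>B\<in>balls. ennpowr (ball_average B (\<lambda>x. ennreal (?v x))) (1 / Q) *
     ennpowr (ball_average B ?i) (1 / (P / (P - 1))) \<le> ennreal C"
    using A unfolding A_class_def by blast
  have AC: "ennpowr (ball_average (B m) (\<lambda>x. ennreal (?v x))) (1 / Q) *
     ennpowr (ball_average (B m) ?i) (1 / (P / (P - 1))) \<le> ennreal C" for m
  proof (rule C[rule_format])
    have "0 < real m + 1" by simp
    then show "B m \<in> balls" unfolding balls_def B_def by blast
  qed
  obtain m0 where m0: "\<not> (AE x in lebesgue. x \<in> B m0 \<longrightarrow> w x = 0)"
  proof (rule ccontr)
    assume "\<not> thesis"
    then have "AE x in lebesgue. \<forall>m. x \<in> B m \<longrightarrow> w x = 0"
      using that by (subst AE_all_countable) blast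
    then have "AE x in lebesgue. w x = 0" by eventually_elim (use B_ex in blast)
    then show False using notzero by simp
  qed
  have "AE x in lebesgue. x \<in> B m \<longrightarrow> 0 < w x" if m: "m0 \<le> m" for m
  proof -
    have "(\<integral>\<^sup>+x\<in>B m. ennreal (?v x) \<partial>lebesgue) \<noteq> 0"
    proof
      assume "(\<integral>\<^sup>+x\<in>B m. ennreal (?v x) \<partial>lebesgue) = 0"
      then have "AE x in lebesgue. ennreal (?v x) * indicator (B m) x = 0"
        by (subst (asm) nn_integral_0_iff_AE) auto
      then have "AE x in lebesgue. x \<in> B m0 \<longrightarrow> w x = 0"
        by eventually_elim (use m in \<open>auto simp: indicator_def ennreal_eq_0_iff B_def split: if_splits\<close>)
      then show False using m0 by simp
    qed
    then have v: "ball_average (B m) (\<lambda>x. ennreal (?v x)) \<noteq> 0"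
      using Lfin by (simp add: ball_average_def ennreal_divide_eq_0_iff)
    \<comment> \<open>Once the first average is nonzero, the bound by \<open>C\<close> forbids an
      infinite second average, and hence zeros of \<open>w\<close> on a nonnull subset of the
      ball.\<close>
    have "ball_average (B m) ?i \<noteq> top"
    proof
      assume "ball_average (B m) ?i = top"
      then have "ennreal C = top" using AC[of m] v by (simp add: ennreal_mult_top top_unique)
      then show False by simp
    qed
    then have "(\<integral>\<^sup>+x\<in>B m. ?i x \<partial>lebesgue) \<noteq> top"
      using Lfin[of m] by (auto simp: ball_average_def ennreal_top_divide)
    then have "AE x in lebesgue. ?i x * indicator (B m) x \<noteq> \<infinity>"
      by (intro nn_integral_PInf_AE) auto
    then show ?thesis
    proof eventually_elim
      case (elim x)
      then show ?case using w0[of x] by (auto simp: less_le)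
    qed
  qed
  then have "AE x in lebesgue. \<forall>m\<ge>m0. x \<in> B m \<longrightarrow> 0 < w x"
    by (subst AE_ball_countable'[of "{m0..}", unfolded Ball_def atLeast_iff]) auto
  then show "AE x in lebesgue. 0 < w x"
    by eventually_elim (use B_ex in \<open>meson nle_le\<close>)
qed

section \<open>From dyadic sums to the operator on Morrey spaces\<close>

theorem theorem1p2:
  fixes \<Omega> :: "real ^ 'n \<Rightarrow> complex" and w :: "real ^ 'n \<Rightarrow> real"
    and s :: ereal and \<alpha> p q \<kappa> :: real
  assumes "CARD('n) \<ge> 2"
    and "1 < s"
    and "\<Omega> \<in> Ls_sphere s"
    and "homogeneous_degree_zero \<Omega>"
    and "0 < \<alpha>" "\<alpha> < real CARD('n)"
    and "1 \<le> dual_exponent s" "dual_exponent s < p" "p < real CARD('n) / \<alpha>"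
    and "1 / q = 1 / p - \<alpha> / real CARD('n)"
    and "0 < \<kappa>" "\<kappa> < p / q"
    and "weight w"
    and "(\<lambda>x. w x powr dual_exponent s) \<in> A_class (p / dual_exponent s) (q / dual_exponent s)"
  shows "\<exists>C::real. C > 0 \<and>
    (\<forall>f \<in> morrey_space2 p \<kappa> (\<lambda>x. w x powr p) (\<lambda>x. w x powr q).
       frac_integral_defined \<Omega> \<alpha> (\<lambda>x. w x powr q) f \<and>
       frac_integral \<Omega> \<alpha> f \<in> morrey_space q (\<kappa> * q / p) (\<lambda>x. w x powr q) \<and>
       morrey_norm q (\<kappa> * q / p) (\<lambda>x. w x powr q) (frac_integral \<Omega> \<alpha> f)
         \<le> ennreal C * morrey_norm2 p \<kappa> (\<lambda>x. w x powr p) (\<lambda>x. w x powr q) f)"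
proof -
  let ?n = "real CARD('n)"
  define \<sigma> where "\<sigma> = dual_exponent s"
  define \<theta> where "\<theta> = 1 / \<sigma>"
  have \<sigma>: "1 \<le> \<sigma>" "\<sigma> < p" using assms(7,8) by (simp_all add: \<sigma>_def)
  have \<theta>: "0 < \<theta>" "1 / \<theta> = \<sigma>" "\<theta> = 1 / dual_exponent s" using \<sigma> by (simp_all add: \<theta>_def \<sigma>_def)
  have p: "0 < p" using \<sigma> by simp
  have "\<alpha> / ?n < 1 / p" using assms(5,9) p by (simp add: field_simps)
  then have "0 < 1 / q" using assms(10) by linarith
  then have q: "0 < q" by simp
  have \<Omega>: "\<Omega> \<in> borel_measurable sphere_measure" using assms(3) by (simp add: Ls_sphere_def)
  have [measurable]: "w \<in> borel_measurable lebesgue" using assms(13) by (simp add: weight_def)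
  define v where "v x = w x powr q" for x
  have v_eq: "(\<lambda>x. w x powr q) = v" by (simp add: v_def fun_eq_iff)
  have v0: "0 \<le> v x" for x by (simp add: v_def)
  have [measurable]: "v \<in> borel_measurable lebesgue" unfolding v_def by (rule powr_real_measurable) auto
  have "(AE x in lebesgue. 0 < w x) \<or> (AE x in lebesgue. w x = 0)"
    by (rule A_class_pos_or_zero_AE[OF assms(13) _ _ _ assms(14)]) (use \<sigma> q in \<open>auto simp: \<sigma>_def[symmetric]\<close>)
  then consider "AE x in lebesgue. 0 < w x" | "AE x in lebesgue. w x = 0" by blast
  then show ?thesis
  proof cases
    \<comment> \<open>Here \<open>v dx\<close> is the zero measure: the operator is defined almost
      everywhere for trivial reasons and the target norm is 0, so the constant 1 serves.\<close>
    case 2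
    then have v: "AE x in lebesgue. v x = 0" by eventually_elim (simp add: v_def)
    show ?thesis unfolding v_eq
    proof (intro exI[of _ 1] conjI ballI)
      fix f assume "f \<in> morrey_space2 p \<kappa> (\<lambda>x. w x powr p) v"
      then have f: "f \<in> borel_measurable lebesgue" by (simp add: morrey_space2_def Lp_loc_def)
      have meas: "frac_integral \<Omega> \<alpha> f \<in> borel_measurable lebesgue" by (rule frac_integral_measurable[OF \<Omega> f])
      show "frac_integral_defined \<Omega> \<alpha> v f"
        unfolding frac_integral_defined_def using v by (subst AE_density) (auto elim!: eventually_mono)
      have zero: "(\<integral>\<^sup>+x\<in>B. ennreal (cmod (frac_integral \<Omega> \<alpha> f x) powr q * v x) \<partial>lebesgue) = 0" for B
        using v by (subst nn_integral_cong_AE[where v = "\<lambda>_. 0"]) (auto elim!: eventually_mono)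
      have "morrey_norm2 q (\<kappa> * q / p) v v (frac_integral \<Omega> \<alpha> f) \<le> 0"
        unfolding morrey_norm2_def zero by (rule SUP_least) simp
      then show "frac_integral \<Omega> \<alpha> f \<in> morrey_space q (\<kappa> * q / p) v"
        "morrey_norm q (\<kappa> * q / p) v (frac_integral \<Omega> \<alpha> f) \<le> ennreal 1 * morrey_norm2 p \<kappa> (\<lambda>x. w x powr p) v f"
        using meas zero by (simp_all add: morrey_space_def morrey_space2_def morrey_norm_def Lp_loc_def)
    qed simp
  next
    case 1
    \<comment> \<open>These are \<open>1 / Q\<close> and \<open>1 - 1 / P\<close> for the class
      exponents \<open>P = p / \<sigma>\<close> and \<open>Q = q / \<sigma>\<close>.\<close>
    define a b where "a = \<sigma> / q" and "b = 1 - \<sigma> / p"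
    define u where "u x = w x powr - (\<sigma> / b)" for x
    have sum: "a + b = 1 - \<sigma> * \<alpha> / ?n"
    proof -
      have "a = \<sigma> * (1 / q)" by (simp add: a_def)
      also have "\<dots> = \<sigma> / p - \<sigma> * \<alpha> / ?n" unfolding assms(10) by (simp add: algebra_simps)
      finally show ?thesis by (simp add: b_def)
    qed
    have "a + b < 1" unfolding sum using \<sigma> assms(5) by simp
    have "\<exists>C. weight_pair (\<lambda>x. w x powr (\<sigma> * (q / \<sigma>))) (\<lambda>x. w x powr - (\<sigma> / (1 - 1 / (p / \<sigma>)))) (1 / (q / \<sigma>)) (1 - 1 / (p / \<sigma>)) C"
      by (rule A_class_weight_pair[OF assms(13) _ _ _ assms(14)[folded \<sigma>_def] 1])
        (use \<sigma> q \<open>a + b < 1\<close> in \<open>auto simp: a_def b_def\<close>)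
    then obtain C where "weight_pair v u a b C"
      using \<sigma> by (auto simp: v_def[abs_def] u_def[abs_def] a_def b_def)
    then interpret weight_pair v u a b C .
    have exps: "1 / (a * \<theta>) = q" "(1 - b) / a = q / p" "\<kappa> * (1 - b) / a = \<kappa> * q / p" "1 / (1 - b) = p / \<sigma>"
      using \<sigma> q by (simp_all add: a_def b_def \<theta>_def)
    \<comment> \<open>Since \<open>a / (1 - b) = p / q\<close>, this is
      \<open>\<kappa> < p / q\<close>.\<close>
    have "\<kappa> * (1 - b) < a"
      using assms(12) \<sigma> p q by (simp add: a_def b_def field_simps)
    obtain K where K: "0 < K" and morrey: "\<forall>F\<in>borel_measurable lebesgue. \<forall>M. (\<forall>y. 0 \<le> F y) \<longrightarrow> 0 \<le> M \<longrightarrow>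
      (\<forall>c r. 0 < r \<longrightarrow> (\<integral>\<^sup>+y\<in>ball c r. energy_density F y \<partial>lebesgue) \<le> ennreal (M * measure \<mu>v (ball c r) powr \<kappa>)) \<longrightarrow>
      (\<forall>c r. 0 < r \<longrightarrow> (\<exists>\<Psi>\<in>borel_measurable lebesgue. (\<forall>x\<in>ball c r. ennpowr (frac_sum \<theta> F x) q \<le> \<Psi> x) \<and>
        (\<integral>\<^sup>+x\<in>ball c r. \<Psi> x \<partial>\<mu>v) \<le> ennreal (K * M powr (q / p) * measure \<mu>v (ball c r) powr (\<kappa> * q / p))))"
      using frac_sum_morrey[OF \<theta>(1) assms(11) \<open>\<kappa> * (1 - b) < a\<close>] unfolding exps by (elim exE conjE) (rule that)
    obtain K1 where K1: "0 < K1" and kernel: "\<forall>f\<in>borel_measurable lebesgue. \<forall>x.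
      (\<integral>\<^sup>+y. ennreal (cmod (frac_integrand \<Omega> \<alpha> f x y)) \<partial>lebesgue)
        \<le> ennreal K1 * (\<integral>\<^sup>+k. ennreal (2 powr (real_of_int k * (\<alpha> - ?n * \<theta>)))
          * ennpowr (\<integral>\<^sup>+y\<in>ball x (2 powr real_of_int k). ennreal (cmod (f y) powr (1 / \<theta>)) \<partial>lebesgue) \<theta> \<partial>count_space UNIV)"
      using frac_integrand_bound[OF assms(2,3) \<theta>(3) assms(5,6)] by (elim exE conjE) (rule that)
    \<comment> \<open>Compensates for \<open>frac_avg\<close> being normalised by the volume of the
      ball and the kernel bound by its radius.\<close>
    define \<omega> where "\<omega> = unit_ball_vol ?n powr ((a + b) * \<theta>)"
    have unit_ball: "0 < unit_ball_vol ?n" by simp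
    then have unit_ball_neq: "unit_ball_vol ?n \<noteq> 0" by (metis less_irrefl)
    then have \<omega>: "0 < \<omega>" by (simp add: \<omega>_def)
    define K2 where "K2 = K1 * \<omega>"
    have K2: "0 < K2" using K1 \<omega> by (simp add: K2_def)
    \<comment> \<open>\<open>K2\<close> compares the operator with the dyadic sum pointwise;
      \<open>K\<close> belongs to an estimate of powers \<open>q\<close>, hence the root.\<close>
    define C' where "C' = K2 * K powr (1 / q)"
    have C': "0 < C'" using K2 K by (simp add: C'_def)
    show ?thesis unfolding v_eq
    proof (intro exI[of _ C'] conjI ballI C')
      fix f assume f_in: "f \<in> morrey_space2 p \<kappa> (\<lambda>x. w x powr p) v"
      then have f: "f \<in> borel_measurable lebesgue" by (simp add: morrey_space2_def Lp_loc_def)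
      define F where "F y = cmod (f y) powr \<sigma>" for y
      have F: "F \<in> borel_measurable lebesgue" unfolding F_def using f by (intro powr_real_measurable) auto
      have F0: "\<forall>y. 0 \<le> F y" by (simp add: F_def)
      let ?T = "frac_integral \<Omega> \<alpha> f"
      have T: "?T \<in> borel_measurable lebesgue" by (rule frac_integral_measurable[OF \<Omega> f])
      \<comment> \<open>\<open>E x < top\<close> is absolute convergence at \<open>x\<close>. The
        bound of the operator by \<open>E\<close> holds at every \<open>x\<close>, trivially where
        \<open>E x = top\<close>.\<close>
      define E where "E x = (\<integral>\<^sup>+y. ennreal (cmod (frac_integrand \<Omega> \<alpha> f x y)) \<partial>lebesgue)" for x
      have E_le: "E x \<le> ennreal K2 * frac_sum \<theta> F x" for x
      proof -
        have term_eq: "ennreal (2 powr (real_of_int k * (\<alpha> - ?n * \<theta>))) * ennpowr (\<integral>\<^sup>+y\<in>ball x (2 powr real_of_int k). ennreal (F y) \<partial>lebesgue) \<theta>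
          = ennreal \<omega> * ennpowr (frac_avg F x (2 powr real_of_int k)) \<theta>" for k
        proof -
          let ?R = "2 powr real_of_int k :: real"
          \<comment> \<open>The identity \<open>a + b = 1 - \<sigma>\<alpha>/n\<close> multiplied by
            \<open>n * \<theta>\<close>; it matches the scaling of the kernel with that of
            \<open>frac_avg\<close>.\<close>
          have e: "?n * ((a + b) * \<theta>) = ?n * \<theta> - \<alpha>"
            unfolding sum using \<sigma> by (simp add: \<theta>_def field_simps)
          have "(measure lebesgue (ball x ?R) powr - (a + b)) powr \<theta>
            = unit_ball_vol ?n powr - ((a + b) * \<theta>) * (?R powr ?n) powr - ((a + b) * \<theta>)"
          proof -
            have "measure lebesgue (ball x ?R) = unit_ball_vol ?n * ?R powr ?n"
              by (simp add: content_ball powr_realpow)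
            moreover have "(X powr - (a + b)) powr \<theta> = X powr - ((a + b) * \<theta>)" for X :: real
              by (simp only: powr_powr minus_mult_left)
            ultimately show ?thesis by (simp only: powr_mult)
          qed
          also have "(?R powr ?n) powr - ((a + b) * \<theta>) = 2 powr (real_of_int k * (\<alpha> - ?n * \<theta>))"
            using e by (simp add: powr_powr mult.assoc) (simp add: algebra_simps)
          finally have "\<omega> * (measure lebesgue (ball x ?R) powr - (a + b)) powr \<theta> = 2 powr (real_of_int k * (\<alpha> - ?n * \<theta>))"
            using unit_ball unit_ball_neq by (simp add: \<omega>_def powr_minus)
          then show ?thesis
            using \<omega> unfolding frac_avg_def by (simp add: ennpowr_mult mult.assoc[symmetric] ennreal_mult[symmetric])
        qed
        have "E x \<le> ennreal K1 * (\<integral>\<^sup>+k. ennreal (2 powr (real_of_int k * (\<alpha> - ?n * \<theta>)))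
          * ennpowr (\<integral>\<^sup>+y\<in>ball x (2 powr real_of_int k). ennreal (F y) \<partial>lebesgue) \<theta> \<partial>count_space UNIV)"
          using kernel[rule_format, OF f, of x] unfolding E_def F_def \<theta>(2) .
        also have "\<dots> = ennreal K1 * (ennreal \<omega> * frac_sum \<theta> F x)"
          unfolding term_eq frac_sum_def by (simp add: nn_integral_cmult)
        finally show ?thesis using K1 \<omega> by (simp add: K2_def ennreal_mult mult.assoc)
      qed
      define N where "N = morrey_norm2 p \<kappa> (\<lambda>x. w x powr p) v f"
      have "N < top" using f_in by (simp add: morrey_space2_def N_def)
      then obtain N' where N': "N = ennreal N'" "0 \<le> N'" by (cases N) auto
      have vol: "weighted_volume v (ball c r) = ennreal (measure \<mu>v (ball c r))" for c r
        using emeasure_eq_measure_subset_ball(1)[OF order_refl, of c r]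
        by (simp add: weighted_volume_def emeasure_weighted_lebesgue)
      \<comment> \<open>The Morrey norm restricted to one ball and raised to the power
        \<open>p\<close>, with the energy density recognised as
        \<open>|f| powr p * w powr p\<close>.\<close>
      have energy: "(\<integral>\<^sup>+y\<in>ball c r. energy_density F y \<partial>lebesgue) \<le> ennreal (N' powr p * measure \<mu>v (ball c r) powr \<kappa>)"
        if r: "0 < r" for c r
      proof -
        let ?V = "measure \<mu>v (ball c r)"
        let ?I = "\<integral>\<^sup>+x\<in>ball c r. ennreal (cmod (f x) powr p * w x powr p) \<partial>lebesgue"
        have V: "0 < ?V" by (rule measure_ball_pos[OF r])
        have "(\<integral>\<^sup>+y\<in>ball c r. energy_density F y \<partial>lebesgue) = ?I"
        proof (rule nn_integral_cong_AE)
          show "AE y in lebesgue. energy_density F y * indicator (ball c r) y = ennreal (cmod (f y) powr p * w y powr p) * indicator (ball c r) y"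
            using 1
          proof eventually_elim
            case (elim y)
            have "- (\<sigma> / b) * - (b / (1 - b)) = p"
              using b_pos \<sigma> by (simp add: b_def)
            then have "u y powr - (b / (1 - b)) = w y powr p" by (simp add: u_def powr_powr)
            moreover have "F y powr (1 / (1 - b)) = cmod (f y) powr p"
              unfolding exps F_def using \<sigma> by (simp add: powr_powr)
            ultimately show ?case by (simp add: energy_density_def)
          qed
        qed
        also have "?I \<le> ennreal (N' powr p) * ennreal (?V powr \<kappa>)"
        proof -
          have "ennpowr (?I / ennpowr (weighted_volume v (ball c r)) \<kappa>) (1 / p) \<le> N"
            unfolding N_def morrey_norm2_def by (rule SUP_upper) (use r in \<open>auto simp: balls_def\<close>)
          then have "ennpowr (ennpowr (?I / ennreal (?V powr \<kappa>)) (1 / p)) p \<le> ennpowr N p"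
            using p by (intro ennpowr_mono) (auto simp: vol)
          then have "?I / ennreal (?V powr \<kappa>) \<le> ennreal (N' powr p)"
            using p N' by (simp add: ennpowr_ennpowr)
          then have "?I / ennreal (?V powr \<kappa>) * ennreal (?V powr \<kappa>) \<le> ennreal (N' powr p) * ennreal (?V powr \<kappa>)"
            by (rule mult_right_mono) simp
          then show ?thesis using V by (simp add: ennreal_divide_times ennreal_mult_divide_eq)
        qed
        finally show ?thesis by (simp add: ennreal_mult)
      qed
      have \<Psi>_ex: "\<exists>\<Psi>\<in>borel_measurable lebesgue. (\<forall>x\<in>ball c r. ennpowr (frac_sum \<theta> F x) q \<le> \<Psi> x) \<and>
        (\<integral>\<^sup>+x\<in>ball c r. \<Psi> x \<partial>\<mu>v) \<le> ennreal (K * N' powr q * measure \<mu>v (ball c r) powr (\<kappa> * q / p))" if r: "0 < r" for c r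
      proof -
        have "(N' powr p) powr (q / p) = N' powr q" using p by (simp add: powr_powr)
        then show ?thesis using morrey[rule_format, OF F, of "N' powr p", OF F0[rule_format] _ energy r] by simp
      qed
      have integrable: "integrable lebesgue (frac_integrand \<Omega> \<alpha> f x)" if "E x < top" for x
        using frac_integrand_measurable[OF \<Omega> f, of \<alpha> x] that unfolding E_def by (simp add: integrable_iff_bounded)
      have T_le: "ennreal (cmod (?T x)) \<le> E x" for x
      proof (cases "E x < top")
        case True
        have "cmod (?T x) \<le> (\<integral>y. cmod (frac_integrand \<Omega> \<alpha> f x y) \<partial>lebesgue)"
          unfolding frac_integral_def by (rule integral_norm_bound)
        then have "ennreal (cmod (?T x)) \<le> ennreal (\<integral>y. cmod (frac_integrand \<Omega> \<alpha> f x y) \<partial>lebesgue)" by (rule ennreal_leI)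
        also have "\<dots> = E x"
          unfolding E_def using integrable[OF True] by (intro nn_integral_eq_integral[symmetric]) auto
        finally show ?thesis .
      next
        case False
        then have "E x = top" using top.not_eq_extremum[of "E x"] by blast
        then show ?thesis by simp
      qed
      show "frac_integral_defined \<Omega> \<alpha> v f"
      proof -
        \<comment> \<open>The majorant \<open>\<Psi>\<close> has finite \<open>v\<close>-integral on
          the ball, so it is finite \<open>v\<close>-almost everywhere there, and with it the dyadic
          sum and \<open>E\<close>.\<close>
        have "AE x in \<mu>v. x \<in> ball 0 (real m + 1) \<longrightarrow> integrable lebesgue (frac_integrand \<Omega> \<alpha> f x)" for m :: nat
        proof -
          have "0 < real m + 1" by simp
          from \<Psi>_ex[OF this, of 0] obtain \<Psi> where \<Psi>: "\<Psi> \<in> borel_measurable lebesgue"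
            "\<forall>x\<in>ball 0 (real m + 1). ennpowr (frac_sum \<theta> F x) q \<le> \<Psi> x"
            "(\<integral>\<^sup>+x\<in>ball 0 (real m + 1). \<Psi> x \<partial>\<mu>v) \<le> ennreal (K * N' powr q * measure \<mu>v (ball 0 (real m + 1)) powr (\<kappa> * q / p))"
            by blast
          note [measurable] = \<Psi>(1)
          have "AE x in \<mu>v. \<Psi> x * indicator (ball 0 (real m + 1)) x \<noteq> \<infinity>"
            using \<Psi>(3) by (intro nn_integral_PInf_AE) (auto simp: top_unique)
          then show ?thesis
          proof eventually_elim
            case (elim x)
            show ?case
            proof
              assume x: "x \<in> ball 0 (real m + 1)"
              then have "\<Psi> x < top" using elim by (simp add: less_top)
              then have "ennpowr (frac_sum \<theta> F x) q < top" using \<Psi>(2) x by (meson order.strict_trans1)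
              then have "E x < top" using E_le[of x] by (auto intro: order.strict_trans1 simp: ennreal_mult_less_top)
              then show "integrable lebesgue (frac_integrand \<Omega> \<alpha> f x)" by (rule integrable)
            qed
          qed
        qed
        then have "AE x in \<mu>v. \<forall>m::nat. x \<in> ball 0 (real m + 1) \<longrightarrow> integrable lebesgue (frac_integrand \<Omega> \<alpha> f x)"
          by (subst AE_all_countable) simp
        then show ?thesis
          unfolding frac_integral_defined_def weighted_lebesgue_def[symmetric]
        proof eventually_elim
          case (elim x)
          obtain m :: nat where "norm x < real m" using reals_Archimedean2 by blast
          then show ?case using elim by (auto dest!: spec[of _ m])
        qed
      qed
      \<comment> \<open>The pointwise chain from the operator over \<open>E\<close> to the dyadic
        sum is raised to the power \<open>q\<close> and integrated against \<open>v dx\<close>,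
        where \<open>\<Psi>\<close> takes over.\<close>
      have main: "(\<integral>\<^sup>+x\<in>ball c r. ennreal (cmod (?T x) powr q * v x) \<partial>lebesgue)
        \<le> ennreal (K2 powr q * K * N' powr q * measure \<mu>v (ball c r) powr (\<kappa> * q / p))" if r: "0 < r" for c r
      proof -
        let ?B = "ball c r"
        obtain \<Psi> where \<Psi>: "\<Psi> \<in> borel_measurable lebesgue"
            "\<forall>x\<in>?B. ennpowr (frac_sum \<theta> F x) q \<le> \<Psi> x"
            "(\<integral>\<^sup>+x\<in>?B. \<Psi> x \<partial>\<mu>v) \<le> ennreal (K * N' powr q * measure \<mu>v ?B powr (\<kappa> * q / p))"
          using \<Psi>_ex[OF r, of c] by blast
        note [measurable] = \<Psi>(1)
        have "(\<integral>\<^sup>+x\<in>?B. ennreal (cmod (?T x) powr q * v x) \<partial>lebesgue)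
          \<le> (\<integral>\<^sup>+x. ennreal (K2 powr q) * (ennreal (v x) * (\<Psi> x * indicator ?B x)) \<partial>lebesgue)"
        proof (rule nn_integral_mono)
          fix x
          show "ennreal (cmod (?T x) powr q * v x) * indicator ?B x \<le> ennreal (K2 powr q) * (ennreal (v x) * (\<Psi> x * indicator ?B x))"
          proof (cases "x \<in> ?B")
            case True
            have "ennreal (cmod (?T x) powr q) = ennpowr (ennreal (cmod (?T x))) q" by simp
            also have "\<dots> \<le> ennpowr (ennreal K2 * frac_sum \<theta> F x) q"
              using q by (intro ennpowr_mono order_trans[OF T_le E_le]) auto
            also have "\<dots> = ennreal (K2 powr q) * ennpowr (frac_sum \<theta> F x) q"
              using K2 by (simp add: ennpowr_mult)
            also have "\<dots> \<le> ennreal (K2 powr q) * \<Psi> x"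
              using \<Psi>(2) True by (intro mult_left_mono) auto
            finally have "ennreal (cmod (?T x) powr q) * ennreal (v x) \<le> ennreal (K2 powr q) * \<Psi> x * ennreal (v x)"
              by (rule mult_right_mono) simp
            then show ?thesis using True v0 by (simp add: ennreal_mult mult_ac)
          qed simp
        qed
        also have "\<dots> = ennreal (K2 powr q) * (\<integral>\<^sup>+x. ennreal (v x) * (\<Psi> x * indicator ?B x) \<partial>lebesgue)"
          by (rule nn_integral_cmult) measurable
        also have "(\<integral>\<^sup>+x. ennreal (v x) * (\<Psi> x * indicator ?B x) \<partial>lebesgue) = (\<integral>\<^sup>+x\<in>?B. \<Psi> x \<partial>\<mu>v)"
          by (rule nn_integral_weighted_lebesgue[symmetric]) measurable
        also have "ennreal (K2 powr q) * \<dots> \<le> ennreal (K2 powr q) * ennreal (K * N' powr q * measure \<mu>v ?B powr (\<kappa> * q / p))"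
          by (intro mult_left_mono \<Psi>(3)) simp
        finally show ?thesis by (simp add: ennreal_mult[symmetric] K less_imp_le mult.assoc)
      qed
      have norm: "morrey_norm2 q (\<kappa> * q / p) v v ?T \<le> ennreal C' * N"
        unfolding morrey_norm2_def
      proof (rule SUP_least)
        fix B :: "(real ^ 'n) set" assume "B \<in> balls"
        then obtain c r where B: "B = ball c r" and r: "0 < r" by (auto simp: balls_def)
        let ?V = "measure \<mu>v (ball c r)"
        let ?I = "\<integral>\<^sup>+x\<in>B. ennreal (cmod (?T x) powr q * v x) \<partial>lebesgue"
        have V: "0 < ?V" by (rule measure_ball_pos[OF r])
        have "?I / ennpowr (weighted_volume v B) (\<kappa> * q / p)
          \<le> ennreal (K2 powr q * K * N' powr q * ?V powr (\<kappa> * q / p)) / ennreal (?V powr (\<kappa> * q / p))"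
          using main[OF r, of c] unfolding B by (simp add: vol divide_right_mono_ennreal)
        also have "\<dots> = ennreal (K2 powr q * K * N' powr q)"
          using V K by (simp add: divide_ennreal)
        finally have "ennpowr (?I / ennpowr (weighted_volume v B) (\<kappa> * q / p)) (1 / q) \<le> ennpowr (ennreal (K2 powr q * K * N' powr q)) (1 / q)"
          using q by (intro ennpowr_mono) auto
        also have "\<dots> = ennreal ((K2 powr q * K * N' powr q) powr (1 / q))"
          using K by (intro ennpowr_ennreal) simp
        also have "(K2 powr q * K * N' powr q) powr (1 / q) = C' * N'"
          using q K2 N' by (simp add: powr_mult powr_powr C'_def)
        also have "ennreal (C' * N') = ennreal C' * N"
          using C' N' by (simp add: ennreal_mult)
        finally show "ennpowr (?I / ennpowr (weighted_volume v B) (\<kappa> * q / p)) (1 / q) \<le> ennreal C' * N" .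
      qed
      then show "morrey_norm q (\<kappa> * q / p) v ?T \<le> ennreal C' * morrey_norm2 p \<kappa> (\<lambda>x. w x powr p) v f"
        by (simp add: morrey_norm_def N_def)
      have "ennreal C' * N < top" using N' by (simp add: ennreal_mult_less_top)
      with norm have "morrey_norm2 q (\<kappa> * q / p) v v ?T < top" by (rule order.strict_trans1)
      moreover have "?T \<in> Lp_loc q v"
        unfolding Lp_loc_def
      proof (intro CollectI conjI T allI impI)
        fix K' :: "(real ^ 'n) set" assume "compact K'"
        then obtain r where r: "0 < r" "K' \<subseteq> ball 0 r"
          using bounded_subset_ballD compact_imp_bounded by blast
        have "(\<integral>\<^sup>+x\<in>K'. ennreal (cmod (?T x) powr q * v x) \<partial>lebesgue) \<le> (\<integral>\<^sup>+x\<in>ball 0 r. ennreal (cmod (?T x) powr q * v x) \<partial>lebesgue)"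
          using r(2) by (intro nn_integral_mono) (auto simp: indicator_def)
        also have "\<dots> < top" by (rule order.strict_trans1[OF main[OF r(1)]]) simp
        finally show "(\<integral>\<^sup>+x\<in>K'. ennreal (cmod (?T x) powr q * v x) \<partial>lebesgue) < \<infinity>" by simp
      qed
      ultimately show "?T \<in> morrey_space q (\<kappa> * q / p) v"
        by (simp add: morrey_space_def morrey_space2_def)
    qed
  qed
qed

end
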